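(* Let $M^{n}$ ($n\ge 3$) be a translation hypersurface in $\mathbb{R}^{n+1}$. Then, for $2<r<n$, $M^{n}$ has zero $S_r$ curvature if, and only if, it is congruent to the graph of one of the following functions: (i) $$F(x_{1},\ldots,x_{n})=\sum_{i=1}^{n-r+1}a_{i}x_{i}+\sum_{j=n-r+2}^{n}f_{j}(x_{j})+b$$ on $\mathbb{R}^{n-r+1}\times J_{n-r+2}\times\cdots\times J_n$, for some intervals $J_{n-r+2},\ldots,J_{n}$, real constants $a_1,\ldots,a_{n-r+1},b$, and arbitrary smooth functions $f_{j}:J_j\subset\mathbb{R}\to\mathbb{R}$, which defines, after a suitable linear change of variables, a vertical cylinder; (ii) a generalized periodic Enneper hypersurface given by $$F(x_{1},\ldots,x_{n})=\sum_{i=1}^{n-r-1}a_{i}x_{i}+\sum_{k=n-r}^{n-1}\frac{\sqrt{\beta}}{a_k}\ln\left|\frac{\cos\left(-\dfrac{a_{n-r}\cdots a_{n-1}}{\sigma_{r-1}(a_{n-r},\ldots ,a_{n-1})}\sqrt{\beta}\,x_n+b_n\right)}{\cos(a_k\sqrt{\beta}\,x_k+b_k)}\right|+c$$ on $\mathbb{R}^{n-r-1}\times I_{n-r}\times\cdots\times I_{n}$, where $a_1,\ldots,a_{n-r},\ldots,a_{n-1},b_{n-r},\ldots,b_{n}$ and $c$ are real constants with $a_{n-r},\ldots,a_{n-1}$ and $\sigma_{r-1}(a_{n-r},\ldots,a_{n-1})$ nonzero, $\beta=1+\sum_{i=1}^{n-r-1}a_{i}^{2}$, $I_k$ ($n-r\le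 k\le n-1$) are open intervals defined by the conditions $|a_k\sqrt{\beta}\,x_k+b_k|<\pi/2$, while $I_n$ is defined by $\left|-\dfrac{a_{n-r}\cdots a_{n-1}}{\sigma_{r-1}(a_{n-r},\ldots ,a_{n-1})}\sqrt{\beta}\,x_n+b_n\right|<\pi/2$.
   Context: A hypersurface $M^n$ of the Euclidean space $\mathbb{R}^{n+1}$ is a translation hypersurface if it is the graph of a function of the form $F(x_1,\ldots,x_n)=f_1(x_1)+\cdots+f_n(x_n)$, where $(x_1,\ldots,x_n)$ are cartesian coordinates and each $f_i$ is a smooth function of one real variable. For an oriented hypersurface $M^n\subset\mathbb{R}^{n+1}$ with principal curvatures $\lambda_1,\ldots,\lambda_n$ (eigenvalues of the shape operator), the $S_r$ curvature is $S_r=\sigma_r(\lambda_1,\ldots,\lambda_n)=\sum_{1\le i_1<\cdots<i_r\le n}\lambda_{i_1}\cdots\lambda_{i_r}$, without normalization. Here $\sigma_m$ denotes the $m$-th elementary symmetric polynomial of its arguments. Zero $S_r$ curvature means $S_r\equiv 0$ on $M^n$. Empty sums are $0$.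
   Formalization: In (ii) the factor before the logarithm is 1/a_k instead of √β/a_k (the printed one gives nonzero S_r unless β=1), and M is congruent to the graph of F over a box of open intervals contained in the stated domain, possibly smaller than it. *)

theory Defs
  imports "HOL-Analysis.Analysis"
begin

definition smooth_on :: "real set \<Rightarrow> (real \<Rightarrow> 'a::real_normed_vector) \<Rightarrow> bool" where
  "smooth_on J f \<longleftrightarrow>
     (\<forall>k. \<forall>t\<in>J. ((\<lambda>g t. vector_derivative g (at t)) ^^ k) f differentiable (at t))"

definition open_interval :: "real set \<Rightarrow> bool" where
  "open_interval J \<longleftrightarrow> open J \<and> is_interval J \<and> J \<noteq> {}"

definition esym :: "nat \<Rightarrow> (nat \<Rightarrow> real) \<Rightarrow> nat set \<Rightarrow> real" where
  "esym m a A = (\<Sum>I | I \<subseteq> A \<and> card I = m. \<Prod>i\<in>I. a i)"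

(* Extrinsic geometry of a hypersurface M, given as a subset of a Euclidean space. *)

definition smooth_curve_in :: "'a::euclidean_space set \<Rightarrow> 'a \<Rightarrow> 'a \<Rightarrow> (real \<Rightarrow> 'a) \<Rightarrow> bool" where
  "smooth_curve_in M p v \<gamma> \<longleftrightarrow>
     (\<exists>\<epsilon>>0. \<gamma> ` {-\<epsilon><..<\<epsilon>} \<subseteq> M \<and> smooth_on {-\<epsilon><..<\<epsilon>} \<gamma>) \<and>
     \<gamma> 0 = p \<and> (\<gamma> has_vector_derivative v) (at 0)"

definition tangent_space :: "'a::euclidean_space set \<Rightarrow> 'a \<Rightarrow> 'a set" where
  "tangent_space M p = {v. \<exists>\<gamma>. smooth_curve_in M p v \<gamma>}"

definition orientation :: "'a::euclidean_space set \<Rightarrow> ('a \<Rightarrow> 'a) \<Rightarrow> bool" where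
  "orientation M N \<longleftrightarrow> continuous_on M N \<and>
     (\<forall>p\<in>M. norm (N p) = 1 \<and> (\<forall>v\<in>tangent_space M p. N p \<bullet> v = 0))"

(* The shape operator -dN at p, the differential of the Gauss map N being computed along
   curves; it is meaningful on tangent_space M p only. *)
definition shape_operator :: "'a::euclidean_space set \<Rightarrow> ('a \<Rightarrow> 'a) \<Rightarrow> 'a \<Rightarrow> 'a \<Rightarrow> 'a" where
  "shape_operator M N p v =
     - (THE w. \<forall>\<gamma>. smooth_curve_in M p v \<gamma> \<longrightarrow> ((N \<circ> \<gamma>) has_vector_derivative w) (at 0))"

(* \<kappa> 1, ..., \<kappa> n (with n the dimension of M) lists the eigenvalues of the shape operator
   with multiplicity.  As the shape operator is self-adjoint, the multiplicity of an
   eigenvalue is the dimension of its eigenspace. *)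
definition principal_curvatures ::
    "'a::euclidean_space set \<Rightarrow> ('a \<Rightarrow> 'a) \<Rightarrow> 'a \<Rightarrow> (nat \<Rightarrow> real) \<Rightarrow> bool" where
  "principal_curvatures M N p \<kappa> \<longleftrightarrow>
     (\<forall>c. card {i \<in> {1..dim (tangent_space M p)}. \<kappa> i = c} =
          dim {v \<in> tangent_space M p. shape_operator M N p v = c *\<^sub>R v})"

(* The choice only fixes an order of the principal curvatures, on which esym does not depend. *)
definition S_curvature :: "nat \<Rightarrow> 'a::euclidean_space set \<Rightarrow> ('a \<Rightarrow> 'a) \<Rightarrow> 'a \<Rightarrow> real" where
  "S_curvature r M N p =
     esym r (SOME \<kappa>. principal_curvatures M N p \<kappa>) {1..dim (tangent_space M p)}"

definition congruent_sets :: "'a::euclidean_space set \<Rightarrow> 'a set \<Rightarrow> bool" where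
  "congruent_sets M M' \<longleftrightarrow>
     (\<exists>f c. orthogonal_transformation f \<and> M' = (\<lambda>x. c + f x) ` M)"

(* R^(n+1) is rendered as (real ^ 'n) \<times> real with n = CARD('n).  The map e : {1..n} \<rightarrow> 'n is a
   numbering of the coordinates, so that x_i is x $ e i. *)

definition graph_over :: "(real ^ 'n) set \<Rightarrow> (real ^ 'n \<Rightarrow> real) \<Rightarrow> ((real ^ 'n) \<times> real) set" where
  "graph_over D F = (\<lambda>x. (x, F x)) ` D"

definition coord_box :: "(nat \<Rightarrow> 'n::finite) \<Rightarrow> (nat \<Rightarrow> real set) \<Rightarrow> (real ^ 'n) set" where
  "coord_box e J = {x. \<forall>i\<in>{1..CARD('n)}. x $ e i \<in> J i}"

definition translation_hypersurface ::
    "(nat \<Rightarrow> 'n::finite) \<Rightarrow> ((real ^ 'n) \<times> real) set \<Rightarrow> bool" where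
  "translation_hypersurface e M \<longleftrightarrow>
     (\<exists>f J. (\<forall>i\<in>{1..CARD('n)}. open_interval (J i) \<and> smooth_on (J i) (f i)) \<and>
        M = graph_over (coord_box e J) (\<lambda>x. \<Sum>i=1..CARD('n). f i (x $ e i)))"

(* The functions F below have natural domains D, whereas a translation hypersurface may be
   defined over smaller intervals (a bounded piece of a hyperplane, say).  So M is compared
   with the graph of F over a box of intervals inside D, possibly D itself. *)
definition congruent_to_graph ::
    "(nat \<Rightarrow> 'n::finite) \<Rightarrow> ((real ^ 'n) \<times> real) set \<Rightarrow> (real ^ 'n) set \<Rightarrow> (real ^ 'n \<Rightarrow> real) \<Rightarrow> bool"
  where
  "congruent_to_graph e M D F \<longleftrightarrow>
     (\<exists>I. (\<forall>i\<in>{1..CARD('n)}. open_interval (I i)) \<and> coord_box e I \<subseteq> D \<and>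
        congruent_sets M (graph_over (coord_box e I) F))"

definition cylinder_fun ::
    "(nat \<Rightarrow> 'n::finite) \<Rightarrow> nat \<Rightarrow> (nat \<Rightarrow> real) \<Rightarrow> (nat \<Rightarrow> real \<Rightarrow> real) \<Rightarrow> real \<Rightarrow> real ^ 'n \<Rightarrow> real"
  where
  "cylinder_fun e r a f b x =
     (let n = CARD('n) in
       (\<Sum>i=1..n-r+1. a i * x $ e i) + (\<Sum>j=n-r+2..n. f j (x $ e j)) + b)"

definition cylinder_domain ::
    "(nat \<Rightarrow> 'n::finite) \<Rightarrow> nat \<Rightarrow> (nat \<Rightarrow> real set) \<Rightarrow> (real ^ 'n) set" where
  "cylinder_domain e r J = {x. \<forall>j\<in>{CARD('n)-r+2..CARD('n)}. x $ e j \<in> J j}"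

definition enneper_beta :: "nat \<Rightarrow> nat \<Rightarrow> (nat \<Rightarrow> real) \<Rightarrow> real" where
  "enneper_beta n r a = 1 + (\<Sum>i=1..n-r-1. (a i)\<^sup>2)"

(* The argument of the cosine in the variable x_k. *)
definition enneper_arg ::
    "nat \<Rightarrow> nat \<Rightarrow> (nat \<Rightarrow> real) \<Rightarrow> (nat \<Rightarrow> real) \<Rightarrow> nat \<Rightarrow> real \<Rightarrow> real" where
  "enneper_arg n r a b k t =
     (if k = n
      then - ((\<Prod>i=n-r..n-1. a i) / esym (r-1) a {n-r..n-1}) * sqrt (enneper_beta n r a) * t + b n
      else a k * sqrt (enneper_beta n r a) * t + b k)"

(* Write \<beta> = enneper_beta n r a.  For a sum of linear functions with slopes a 1, ..., a (n-r-1)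
   and functions f_k of x_k, k = n-r, ..., n, with nowhere vanishing second derivatives, S_r
   vanishes iff the sum over k of (\<beta> + f_k'^2) / f_k'' does.  For k < n this gives f_k'' = a k * (\<beta> + f_k'^2),
   and f_k is - ln (cos (a k * sqrt \<beta> * t + b k)) / a k up to a constant.  The factor in front
   of the logarithm is thus 1 / a k; the factor sqrt \<beta> / a k also found in print yields zero
   S_r curvature only if \<beta> = 1. *)
definition enneper_fun ::
    "(nat \<Rightarrow> 'n::finite) \<Rightarrow> nat \<Rightarrow> (nat \<Rightarrow> real) \<Rightarrow> (nat \<Rightarrow> real) \<Rightarrow> real \<Rightarrow> real ^ 'n \<Rightarrow> real"
  where
  "enneper_fun e r a b c x =
     (let n = CARD('n) in
       (\<Sum>i=1..n-r-1. a i * x $ e i) +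
       (\<Sum>k=n-r..n-1. 1 / a k *
          ln \<bar>cos (enneper_arg n r a b n (x $ e n)) / cos (enneper_arg n r a b k (x $ e k))\<bar>) + c)"

definition enneper_domain ::
    "(nat \<Rightarrow> 'n::finite) \<Rightarrow> nat \<Rightarrow> (nat \<Rightarrow> real) \<Rightarrow> (nat \<Rightarrow> real) \<Rightarrow> (real ^ 'n) set" where
  "enneper_domain e r a b =
     {x. \<forall>k\<in>{CARD('n)-r..CARD('n)}. \<bar>enneper_arg CARD('n) r a b k (x $ e k)\<bar> < pi / 2}"

end

theory Submission
  imports Defs
begin

text \<open>
  For a graph of \<open>f 1 (x 1) + \<dots> + f n (x n)\<close> with gradient \<open>g\<close>, the metric is \<open>1 + g g\<^sup>T\<close> and the
  second fundamental form is a multiple of the diagonal matrix of the second derivatives.  The matrix determinant lemma therefore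
  gives, up to a nonzero factor, the \<open>S\<^sub>r\<close> curvature as
  
  \<open>\<Sum>\<close> over index sets \<open>I\<close> of size \<open>r\<close> of \<open>(\<Prod>i\<in>I. f i'') * (1 + \<Sum>m\<notin>I. (f m')^2)\<close>
  
  (\<open>translation_graph_curvature\<close>).  Zero \<open>S\<^sub>r\<close> curvature means that this expression vanishes for independent arguments
  \<open>x i\<close>.  Let \<open>K\<close> be the set of the indices whose \<open>f i\<close> is not affine; the affine ones only change the
  constant 1 to \<open>\<beta>\<close>, 1 plus the squares of their slopes.
  
  If \<open>K\<close> has fewer than \<open>r\<close> elements, every product vanishes, and the graph is a cylinder.  If it has exactly \<open>r\<close>, a single
  product times \<open>\<beta>\<close> is left, which is nonzero somewhere.  If it has \<open>r + 1\<close>, separation of variables gives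
  \<open>f i'' = c i * (\<beta> + (f i')^2)\<close> with \<open>\<Sum> 1 / c i = 0\<close>; the solutions are the logarithms of cosines in the
  Enneper hypersurface.
  
  The heart of the matter is that \<open>K\<close> cannot have \<open>r + 2\<close> or more elements (\<open>curv_num_line_nonzero\<close>).  The
  expression is affine in each pair \<open>(f i'', (f i')^2)\<close>.  Hence, if it vanishes at two points of the curve traced by
  each pair, it vanishes on the product of the lines through them, and becomes a polynomial identity in independent
  variables.  Comparing coefficients then gives a contradiction.  Since two points of each curve suffice, one of them with
  \<open>f i'' \<noteq> 0\<close>, the argument works globally, whatever the zeros of the \<open>f i''\<close>.
  
  The geometric side needs the spectral theorem, to see that principal curvatures exist and that \<open>S\<^sub>r\<close> is
  a coefficient of a determinant, and the invariance of \<open>S\<^sub>r\<close> under congruences.  Conversely, a surface with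
  a congruent copy in one of the two families has zero curvature because that copy is itself a translation
  graph, for which the expression above vanishes.
\<close>

section \<open>Elementary symmetric polynomials\<close>

lemma esym_0: "finite A \<Longrightarrow> esym 0 a A = 1"
proof -
  assume "finite A"
  then have "{I. I \<subseteq> A \<and> card I = 0} = {{}}"
    by (auto dest: finite_subset simp: card_eq_0_iff)
  then show ?thesis by (simp add: esym_def)
qed

lemma esym_cong: "(\<And>i. i \<in> A \<Longrightarrow> a i = b i) \<Longrightarrow> esym r a A = esym r b A"
  unfolding esym_def by (intro sum.cong prod.cong) auto

lemma esym_insert:
  assumes "finite A" "x \<notin> A"
  shows "esym (Suc r) a (insert x A) = a x * esym r a A + esym (Suc r) a A"
proof -
  let ?S = "\<lambda>r A. {I. I \<subseteq> A \<and> card I = r}"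
  have fin: "finite (?S r A)" for r using assms(1) by simp
  have split: "?S (Suc r) (insert x A) = insert x ` ?S r A \<union> ?S (Suc r) A" (is "?L = ?R")
  proof
    show "?L \<subseteq> ?R"
    proof
      fix I assume I: "I \<in> ?L"
      show "I \<in> ?R"
      proof (cases "x \<in> I")
        case True
        have "finite I" using I assms(1) by (auto intro: finite_subset)
        then have "I - {x} \<in> ?S r A" using I True by auto
        moreover have "I = insert x (I - {x})" using True by auto
        ultimately show ?thesis by blast
      qed (use I in auto)
    qed
    show "?R \<subseteq> ?L"
    proof
      fix I assume "I \<in> ?R"
      then consider I' where "I = insert x I'" "I' \<subseteq> A" "card I' = r" | "I \<subseteq> A" "card I = Suc r"
        by auto
      then show "I \<in> ?L"
      proof cases
        case 1
        then have "finite I'" "x \<notin> I'" using assms by (auto intro: finite_subset)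
        then show ?thesis using 1 by auto
      qed auto
    qed
  qed
  have inj: "inj_on (insert x) (?S r A)"
    using assms(2) by (auto simp: inj_on_def)
  have disj: "insert x ` ?S r A \<inter> ?S (Suc r) A = {}"
    using assms(2) by auto
  have "esym (Suc r) a (insert x A)
      = (\<Sum>I\<in>?S r A. \<Prod>i\<in>insert x I. a i) + (\<Sum>I\<in>?S (Suc r) A. \<Prod>i\<in>I. a i)"
    unfolding esym_def split using fin disj inj
    by (subst sum.union_disjoint) (auto simp: sum.reindex)
  also have "(\<Sum>I\<in>?S r A. \<Prod>i\<in>insert x I. a i) = (\<Sum>I\<in>?S r A. a x * (\<Prod>i\<in>I. a i))"
    using assms by (intro sum.cong prod.insert) (auto intro: finite_subset)
  finally show ?thesis by (simp add: esym_def sum_distrib_left)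
qed

lemma esym_remove:
  assumes "finite A" "x \<in> A"
  shows "esym (Suc r) a A = a x * esym r a (A - {x}) + esym (Suc r) a (A - {x})"
  using esym_insert[of "A - {x}" x r a] assms by (simp add: insert_absorb)

lemma esym_scale: "finite A \<Longrightarrow> esym r (\<lambda>i. c * a i) A = c ^ r * esym r a A"
  unfolding esym_def by (auto simp: sum_distrib_left prod.distrib intro!: sum.cong)

lemma esym_drop_zeros:
  assumes "finite A" "K \<subseteq> A" "\<And>i. i \<in> A - K \<Longrightarrow> a i = 0"
  shows "esym r a A = esym r a K"
proof -
  have "(\<Prod>i\<in>I. a i) = 0" if "I \<subseteq> A" "\<not> I \<subseteq> K" for I
  proof -
    from that obtain i where "i \<in> I" "i \<in> A - K" by auto
    then show ?thesis using assms that(1) by (auto intro: prod_zero finite_subset)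
  qed
  then show ?thesis unfolding esym_def using assms
    by (intro sum.mono_neutral_right) auto
qed

lemma esym_card_less: "finite A \<Longrightarrow> card A < r \<Longrightarrow> esym r a A = 0"
proof -
  assume "finite A" "card A < r"
  then have "{I. I \<subseteq> A \<and> card I = r} = {}"
    using card_mono leD by auto
  then show ?thesis unfolding esym_def by (simp only: sum.empty)
qed

lemma esym_card: "finite A \<Longrightarrow> esym (card A) a A = (\<Prod>i\<in>A. a i)"
proof -
  assume "finite A"
  then have "{I. I \<subseteq> A \<and> card I = card A} = {A}"
    by (auto dest: card_subset_eq)
  then show ?thesis by (simp add: esym_def)
qed

lemma esym_card_pred:
  assumes "finite A" "card A = Suc r"
  shows "esym r a A = (\<Sum>m\<in>A. \<Prod>i\<in>A - {m}. a i)"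
proof -
  have "{I. I \<subseteq> A \<and> card I = r} = (\<lambda>m. A - {m}) ` A" (is "?L = ?R")
  proof
    show "?L \<subseteq> ?R"
    proof
      fix I assume I: "I \<in> ?L"
      then have "card (A - I) = 1" using assms
        by (subst card_Diff_subset) (auto intro: finite_subset)
      then obtain m where "A - I = {m}" by (auto simp: card_1_singleton_iff)
      then have "I = A - {m}" "m \<in> A" using I by auto
      then show "I \<in> ?R" by blast
    qed
    show "?R \<subseteq> ?L" using assms by auto
  qed
  moreover have "inj_on (\<lambda>m. A - {m}) A" by (auto simp: inj_on_def)
  ultimately show ?thesis unfolding esym_def by (simp add: sum.reindex)
qed

text \<open>
  Elementary symmetric polynomials enter the geometry only through this generating function:
  an identity between products of linear factors turns into identities between the \<open>esym r\<close>.
\<close>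

lemma coeff_prod_linear:
  assumes "finite A"
  shows "poly.coeff (\<Prod>i\<in>A. [:1, a i:]) r = esym r a A"
  using assms
proof (induction A arbitrary: r rule: finite_induct)
  case empty
  then show ?case
    by (cases r) (simp_all add: esym_0 esym_card_less)
next
  case (insert x A)
  then show ?case
    by (cases r) (simp_all add: esym_0 esym_insert algebra_simps coeff_pCons)
qed

text \<open>
  Double counting: a set of \<open>r\<close> indices is left intact by exactly those removals that hit its complement.
\<close>

lemma sum_esym_remove:
  assumes "finite A" "card A \<ge> r"
  shows "(\<Sum>i\<in>A. esym r a (A - {i})) = (card A - r) * esym r a A"
proof -
  have "(\<Sum>i\<in>A. esym r a (A - {i})) =
    (\<Sum>i\<in>A. \<Sum>I | I \<subseteq> A \<and> card I = r. if i \<in> I then 0 else \<Prod>j\<in>I. a j)"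
    unfolding esym_def using assms(1)
    by (intro sum.cong refl sum.mono_neutral_cong_left) (auto)
  also have "\<dots> = (\<Sum>I | I \<subseteq> A \<and> card I = r. \<Sum>i\<in>A. if i \<in> I then 0 else \<Prod>j\<in>I. a j)"
    by (rule sum.swap)
  also have "\<dots> = (\<Sum>I | I \<subseteq> A \<and> card I = r. (card A - r) * (\<Prod>j\<in>I. a j))"
  proof (rule sum.cong)
    fix I assume I: "I \<in> {I. I \<subseteq> A \<and> card I = r}"
    have "(\<Sum>i\<in>A. if i \<in> I then 0 else \<Prod>j\<in>I. a j) = (\<Sum>i\<in>A - I. \<Prod>j\<in>I. a j)"
      using assms(1) by (intro sum.mono_neutral_cong_right) auto
    also have "\<dots> = (card A - r) * (\<Prod>j\<in>I. a j)"
      using I assms(1) finite_subset[of I A] by (simp add: card_Diff_subset)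
    finally show "(\<Sum>i\<in>A. if i \<in> I then 0 else \<Prod>j\<in>I. a j) = (card A - r) * (\<Prod>j\<in>I. a j)" .
  qed simp
  finally show ?thesis by (simp add: esym_def sum_distrib_left)
qed

text \<open>
  The values at the indices in \<open>P\<close> are prescribed nonzero numbers, the others are free.  The claim is that
  \<open>esym s\<close> cannot vanish for all choices of the free values and all removals of one \<open>l \<in> P\<close>.
  A free variable can be split off, since both coefficients of an affine function that vanishes
  identically are zero; this lowers \<open>s\<close> and removes an index.  Once every index is prescribed, summing over the
  removals gives \<open>esym (Suc s) p K = 0\<close>, and then the recursion for \<open>esym\<close> shows
  \<open>p l * esym s p (K - {l}) = 0\<close>, which again lowers \<open>s\<close>.  At \<open>s = 0\<close> the polynomial is 1.
\<close>

lemma esym_remove_not_all_zero: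
  fixes p :: "nat \<Rightarrow> real"
  assumes "finite K" "P \<subseteq> K" "P \<noteq> {}" "s < card K" "\<And>l. l \<in> P \<Longrightarrow> p l \<noteq> 0"
  shows "\<exists>x l. (\<forall>l\<in>P. x l = p l) \<and> l \<in> P \<and> esym s x (K - {l}) \<noteq> 0"
  using assms(1,2,4)
proof (induction s arbitrary: K)
  case 0
  then show ?case using assms(3) by (auto simp: esym_0)
next
  case (Suc s)
  show ?case
  proof (rule ccontr)
    assume "\<not> ?thesis"
    then have zero: "esym (Suc s) x (K - {l}) = 0" if "\<forall>l\<in>P. x l = p l" "l \<in> P" for x l
      using that by blast
    show False
    proof (cases "P = K")
      case True
      have "(card K - Suc s) * esym (Suc s) p K = 0"
        using sum_esym_remove[of K "Suc s" p] Suc.prems zero[of p] True by simp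
      then have "esym (Suc s) p K = 0" using Suc.prems by simp
      then have z: "esym s p (K - {l}) = 0" if "l \<in> P" for l
        using esym_remove[of K l s p] zero[of p l] assms(5)[of l] that Suc.prems True by auto
      obtain x l where "\<forall>l\<in>P. x l = p l" "l \<in> P" "esym s x (K - {l}) \<noteq> 0"
        using Suc.IH[of K] Suc.prems by auto
      moreover have "esym s x (K - {l}) = esym s p (K - {l})"
        using \<open>\<forall>l\<in>P. x l = p l\<close> True by (intro esym_cong) auto
      ultimately show False using z by simp
    next
      case False
      then obtain i where i: "i \<in> K" "i \<notin> P" using Suc.prems by auto
      have "s < card (K - {i})" using Suc.prems i by simp
      then obtain x l where xl: "\<forall>l\<in>P. x l = p l" "l \<in> P" "esym s x (K - {i} - {l}) \<noteq> 0"
        using Suc.IH[of "K - {i}"] Suc.prems i by auto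
      have li: "l \<noteq> i" using xl i by auto
      have "0 = y * esym s x (K - {i} - {l}) + esym (Suc s) x (K - {i} - {l})" for y
      proof -
        let ?x = "x(i := y)"
        have "0 = esym (Suc s) ?x (K - {l})"
          using zero[of ?x l] xl i by auto
        also have "\<dots> = y * esym s ?x (K - {l} - {i}) + esym (Suc s) ?x (K - {l} - {i})"
          using esym_remove[of "K - {l}" i s ?x] Suc.prems i li by auto
        also have "K - {l} - {i} = K - {i} - {l}" by auto
        also have "esym s ?x (K - {i} - {l}) = esym s x (K - {i} - {l})"
          by (rule esym_cong) auto
        also have "esym (Suc s) ?x (K - {i} - {l}) = esym (Suc s) x (K - {i} - {l})"
          by (rule esym_cong) auto
        finally show ?thesis .
      qed
      from this[of 0] this[of 1] show False using xl by simp
    qed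
  qed
qed

section \<open>The numerator of the curvature\<close>

text \<open>
  Up to a nonvanishing factor this is the \<open>S\<^sub>r\<close> curvature of the graph of a sum of functions \<open>f i\<close> of one
  variable, where \<open>h i\<close> stands for \<open>f i''\<close>, \<open>v i\<close> for the square of \<open>f i'\<close>, and \<open>\<beta>\<close> for 1 plus the
  squared slopes of the variables outside \<open>A\<close> in which the graph is affine.
\<close>

definition curv_num :: "nat \<Rightarrow> (nat \<Rightarrow> real) \<Rightarrow> (nat \<Rightarrow> real) \<Rightarrow> nat set \<Rightarrow> real \<Rightarrow> real" where
  "curv_num r h v A \<beta> = \<beta> * esym r h A + (\<Sum>m\<in>A. v m * esym r h (A - {m}))"

lemma curv_num_cong:
  "(\<And>i. i \<in> A \<Longrightarrow> h i = h' i) \<Longrightarrow> (\<And>i. i \<in> A \<Longrightarrow> v i = v' i) \<Longrightarrow> curv_num r h v A \<beta> = curv_num r h' v' A \<beta>"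
  unfolding curv_num_def
  by (intro arg_cong2[where f="(+)"] arg_cong2[where f="(*)"] sum.cong esym_cong) auto

lemma curv_num_drop_zeros:
  assumes "finite A" "K \<subseteq> A" "\<And>i. i \<in> A - K \<Longrightarrow> h i = 0"
  shows "curv_num r h v A \<beta> = curv_num r h v K (\<beta> + (\<Sum>m\<in>A - K. v m))"
proof -
  have "(\<Sum>m\<in>A. v m * esym r h (A - {m}))
     = (\<Sum>m\<in>A - K. v m * esym r h (A - {m})) + (\<Sum>m\<in>K. v m * esym r h (A - {m}))"
    using assms by (intro sum.subset_diff) auto
  also have "(\<Sum>m\<in>A - K. v m * esym r h (A - {m})) = (\<Sum>m\<in>A - K. v m * esym r h K)"
    using assms by (intro sum.cong refl arg_cong2[where f="(*)"] esym_drop_zeros) auto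
  also have "(\<Sum>m\<in>K. v m * esym r h (A - {m})) = (\<Sum>m\<in>K. v m * esym r h (K - {m}))"
    using assms by (intro sum.cong refl arg_cong2[where f="(*)"] esym_drop_zeros) auto
  finally show ?thesis
    using esym_drop_zeros[OF assms(1,2), of h r] assms(3) unfolding curv_num_def
    by (simp add: sum_distrib_right[symmetric] algebra_simps)
qed

lemma curv_num_few:
  assumes "finite A" "card A < r"
  shows "curv_num r h v A \<beta> = 0"
proof -
  have "esym r h (A - {m}) = 0" for m
    using assms card_Diff1_le[of A m] by (intro esym_card_less) auto
  then show ?thesis using assms by (simp add: curv_num_def esym_card_less)
qed

lemma curv_num_card:
  assumes "finite A"
  shows "curv_num (card A) h v A \<beta> = \<beta> * (\<Prod>i\<in>A. h i)"
proof -
  have "esym (card A) h (A - {m}) = 0" if "m \<in> A" for m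
    using assms that card_Diff1_less[of A m] by (intro esym_card_less) auto
  then show ?thesis using assms by (simp add: curv_num_def esym_card)
qed

lemma curv_num_card_pred:
  assumes "finite A" "card A = Suc r"
  shows "curv_num r h v A \<beta> = (\<Sum>m\<in>A. (\<beta> + v m) * (\<Prod>i\<in>A - {m}. h i))"
proof -
  have "esym r h (A - {m}) = (\<Prod>i\<in>A - {m}. h i)" if "m \<in> A" for m
    using esym_card[of "A - {m}" h] assms that by simp
  then show ?thesis using assms
    by (simp add: curv_num_def esym_card_pred sum_distrib_left algebra_simps sum.distrib)
qed

text \<open>
  The numerator is affine in each pair \<open>(h i, v i)\<close>, because the term with factor \<open>v i\<close> does not contain
  \<open>h i\<close>.  Everything below rests on this.
\<close>

lemma curv_num_affine:
  assumes "finite A" "i \<in> A"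
  shows "\<exists>\<alpha> \<gamma> \<delta>. \<forall>h' v'. (\<forall>j\<in>A - {i}. h' j = h j \<and> v' j = v j) \<longrightarrow>
     curv_num r h' v' A \<beta> = \<alpha> * h' i + \<gamma> * v' i + \<delta>"
proof (cases r)
  case 0
  have "curv_num r h' v' A \<beta> = 0 * h' i + 1 * v' i + (\<beta> + (\<Sum>m\<in>A - {i}. v m))"
    if "\<forall>j\<in>A - {i}. h' j = h j \<and> v' j = v j" for h' v'
    using assms that by (simp add: curv_num_def 0 esym_0 sum.remove)
  then show ?thesis by blast
next
  case (Suc s)
  let ?B = "A - {i}"
  have "curv_num r h' v' A \<beta> =
      (\<beta> * esym s h ?B + (\<Sum>m\<in>?B. v m * esym s h (?B - {m}))) * h' i + esym r h ?B * v' i +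
      (\<beta> * esym r h ?B + (\<Sum>m\<in>?B. v m * esym r h (?B - {m})))"
    if eq: "\<forall>j\<in>A - {i}. h' j = h j \<and> v' j = v j" for h' v'
  proof -
    have c: "esym q h' (?B - C) = esym q h (?B - C)" for q C
      using eq by (intro esym_cong) auto
    from c[of _ "{}"] have c0: "esym q h' ?B = esym q h ?B" for q by simp
    have "esym r h' A = h' i * esym s h ?B + esym r h ?B"
      using esym_remove[OF assms, of s h'] Suc c0 by simp
    moreover have "(\<Sum>m\<in>A. v' m * esym r h' (A - {m})) =
       v' i * esym r h ?B + (\<Sum>m\<in>?B. v' m * esym r h' (A - {m}))"
      using assms c0 by (simp add: sum.remove)
    moreover have "(\<Sum>m\<in>?B. v' m * esym r h' (A - {m})) =
       (\<Sum>m\<in>?B. v m * (h' i * esym s h (?B - {m}) + esym r h (?B - {m})))"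
    proof (rule sum.cong[OF refl])
      fix m assume m: "m \<in> ?B"
      have "A - {m} - {i} = ?B - {m}" by auto
      then have "esym r h' (A - {m}) = h' i * esym s h (?B - {m}) + esym r h (?B - {m})"
        using esym_remove[of "A - {m}" i s h'] assms m Suc c[of _ "{m}"] by auto
      then show "v' m * esym r h' (A - {m}) = v m * (h' i * esym s h (?B - {m}) + esym r h (?B - {m}))"
        using eq m by simp
    qed
    ultimately show ?thesis
      by (simp add: curv_num_def algebra_simps sum.distrib sum_distrib_left)
  qed
  then show ?thesis by blast
qed

lemma affine_two_zeros:
  fixes \<alpha> \<delta> s u w :: real
  assumes "u \<noteq> w" "\<alpha> * u + \<delta> = 0" "\<alpha> * w + \<delta> = 0"
  shows "\<alpha> * s + \<delta> = 0"
proof -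
  have "\<alpha> * (u - w) = (\<alpha> * u + \<delta>) - (\<alpha> * w + \<delta>)" by (simp add: algebra_simps)
  then have "\<alpha> * (u - w) = 0" using assms by simp
  then have "\<alpha> = 0" using assms by simp
  then show ?thesis using assms by simp
qed

text \<open>
  If each pair \<open>(h i, v i)\<close> may be any of two points on a line, and the numerator vanishes for all these
  choices, then by affinity it vanishes along the whole lines.  The identity between functions
  thereby becomes an identity between polynomials in free variables \<open>v i\<close>.
\<close>

lemma curv_num_extend:
  assumes "finite A"
    and uw: "\<And>i. i \<in> A \<Longrightarrow> u i \<noteq> w i"
    and zero: "\<And>v. (\<And>i. i \<in> A \<Longrightarrow> v i \<in> {u i, w i}) \<Longrightarrow> curv_num r (\<lambda>i. p i + q i * v i) v A \<beta> = 0"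
  shows "curv_num r (\<lambda>i. p i + q i * v i) v A \<beta> = 0"
proof -
  have "\<forall>v. (\<forall>i\<in>A - S. v i \<in> {u i, w i}) \<longrightarrow> curv_num r (\<lambda>i. p i + q i * v i) v A \<beta> = 0" if "S \<subseteq> A" for S
    using finite_subset[OF that assms(1)] that
  proof (induction S rule: finite_induct)
    case empty
    then show ?case using zero by blast
  next
    case (insert j S)
    show ?case
    proof (intro allI impI)
      fix v assume v: "\<forall>i\<in>A - insert j S. v i \<in> {u i, w i}"
      have j: "j \<in> A" using insert.prems by simp
      obtain a c d where acd: "\<forall>h' v'. (\<forall>i\<in>A - {j}. h' i = p i + q i * v i \<and> v' i = v i) \<longrightarrow>
         curv_num r h' v' A \<beta> = a * h' j + c * v' j + d"
        using curv_num_affine[OF assms(1) j, of "\<lambda>i. p i + q i * v i" v r \<beta>] by blast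
      have eq: "curv_num r (\<lambda>i. p i + q i * (v(j := s)) i) (v(j := s)) A \<beta> = (a * q j + c) * s + (a * p j + d)" for s
        using acd[rule_format, of "\<lambda>i. p i + q i * (v(j := s)) i" "v(j := s)"] by (auto simp: algebra_simps)
      have z: "curv_num r (\<lambda>i. p i + q i * (v(j := s)) i) (v(j := s)) A \<beta> = 0" if "s \<in> {u j, w j}" for s
      proof -
        have "\<forall>i\<in>A - S. (v(j := s)) i \<in> {u i, w i}" using v that by auto
        then show ?thesis using insert.IH insert.prems by blast
      qed
      have "(a * q j + c) * v j + (a * p j + d) = 0"
        by (rule affine_two_zeros[OF uw[OF j]]) (use eq z in auto)
      then show "curv_num r (\<lambda>i. p i + q i * v i) v A \<beta> = 0"
        using eq[of "v j"] by simp
    qed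
  qed
  from this[of A] show ?thesis by auto
qed

text \<open>
  This is the algebraic reason why at most \<open>r + 1\<close> of the functions are not affine.
  If some line has slope \<open>q l = 0\<close>, differentiating in \<open>v l\<close> gives \<open>esym r\<close> over \<open>K - {l}\<close>
  equal to zero, which is excluded by \<open>esym_remove_not_all_zero\<close>.  Otherwise the \<open>h i\<close> serve as free
  variables, and the coefficients of the monomials of degree \<open>r + 1\<close> say that \<open>1 / q\<close> sums to zero
  over every index set of size \<open>r + 1\<close>.  With at least \<open>r + 2\<close> indices one element of such a set can be exchanged, so
  all \<open>1 / q i\<close> are equal, hence zero, which is absurd.
\<close>

lemma curv_num_line_nonzero:
  assumes "finite K" "r + 2 \<le> card K"
    and pq: "\<And>i. i \<in> K \<Longrightarrow> p i \<noteq> 0 \<or> q i \<noteq> 0"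
  shows "\<exists>v. curv_num r (\<lambda>i. p i + q i * v i) v K \<beta> \<noteq> 0"
proof (rule ccontr)
  assume "\<not> ?thesis"
  then have zero: "curv_num r (\<lambda>i. p i + q i * v i) v K \<beta> = 0" for v by blast
  define P where "P = {i \<in> K. q i = 0}"
  show False
  proof (cases "P = {}")
    case False
    obtain x l where xl: "\<forall>l\<in>P. x l = p l" "l \<in> P" "esym r x (K - {l}) \<noteq> 0"
      using esym_remove_not_all_zero[of K P r p] assms False P_def by auto
    \<comment> \<open>The free values realise \<open>x\<close> off \<open>P\<close>; the parameter \<open>y = v l\<close> does not affect \<open>h\<close>, as \<open>q l = 0\<close>.\<close>
    define v where "v y i = (if i = l then y else (x i - p i) / q i)" for y i
    have hx: "p i + q i * v y i = x i" if "i \<in> K" for i y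
      using that xl by (auto simp: P_def v_def)
    have lK: "l \<in> K" using xl P_def by auto
    have "0 = \<beta> * esym r x K + y * esym r x (K - {l}) + (\<Sum>m\<in>K - {l}. v 0 m * esym r x (K - {m}))" for y
    proof -
      have "0 = curv_num r x (v y) K \<beta>"
        using zero[of "v y"] curv_num_cong[of K "\<lambda>i. p i + q i * v y i" x "v y" "v y" r \<beta>] hx by simp
      also have "\<dots> = \<beta> * esym r x K + v y l * esym r x (K - {l}) + (\<Sum>m\<in>K - {l}. v y m * esym r x (K - {m}))"
        using assms(1) lK by (simp add: curv_num_def sum.remove)
      also have "(\<Sum>m\<in>K - {l}. v y m * esym r x (K - {m})) = (\<Sum>m\<in>K - {l}. v 0 m * esym r x (K - {m}))"
        by (rule sum.cong) (auto simp: v_def)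
      finally show ?thesis by (simp add: v_def)
    qed
    from this[of 0] this[of 1] show False using xl by simp
  next
    case True
    then have q: "q i \<noteq> 0" if "i \<in> K" for i using that by (auto simp: P_def)
    have sumJ: "(\<Sum>m\<in>J. 1 / q m) = 0" if J: "J \<subseteq> K" "card J = Suc r" for J
    proof -
      have finJ: "finite J" using J assms(1) finite_subset by blast
      \<comment> \<open>Only indices in \<open>J\<close> get a nonzero \<open>h\<close>, so dividing by \<open>t ^ r\<close> leaves a function affine in \<open>t\<close>.\<close>
      define h where "h t i = (if i \<in> J then t else (0::real))" for t i
      define v where "v t i = (h t i - p i) / q i" for t i
      have eJ: "esym r (h t) J = real (r + 1) * t ^ r" for t
      proof -
        have "esym r (h t) J = (\<Sum>m\<in>J. \<Prod>i\<in>J - {m}. t)"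
          unfolding esym_card_pred[OF finJ J(2)] by (intro sum.cong prod.cong) (auto simp: h_def)
        then show ?thesis using J finJ by simp
      qed
      have eJm: "esym r (h t) (J - {m}) = t ^ r" if "m \<in> J" for t m
      proof -
        have "esym r (h t) (J - {m}) = (\<Prod>i\<in>J - {m}. h t i)"
          using esym_card[of "J - {m}" "h t"] finJ J that by simp
        also have "\<dots> = (\<Prod>i\<in>J - {m}. t)" by (rule prod.cong) (auto simp: h_def)
        finally show ?thesis using finJ J that by simp
      qed
      have E: "(r + 1) * (\<beta> + (\<Sum>m\<in>K - J. - p m / q m)) + (\<Sum>m\<in>J. (t - p m) / q m) = 0"
        if t: "t \<noteq> 0" for t
      proof -
        have "0 = curv_num r (h t) (v t) K \<beta>"
          using zero[of "v t"] curv_num_cong[of K "\<lambda>i. p i + q i * v t i" "h t" "v t" "v t" r \<beta>] q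
          by (simp add: v_def)
        also have "\<dots> = curv_num r (h t) (v t) J (\<beta> + (\<Sum>m\<in>K - J. v t m))"
          using assms(1) J by (intro curv_num_drop_zeros) (auto simp: h_def)
        also have "\<dots> = (\<beta> + (\<Sum>m\<in>K - J. v t m)) * ((r + 1) * t ^ r) + (\<Sum>m\<in>J. v t m * t ^ r)"
          unfolding curv_num_def eJ using eJm by simp
        also have "\<dots> = t ^ r * ((r + 1) * (\<beta> + (\<Sum>m\<in>K - J. v t m)) + (\<Sum>m\<in>J. v t m))"
          by (simp add: algebra_simps sum_distrib_left sum.distrib)
        finally have "(r + 1) * (\<beta> + (\<Sum>m\<in>K - J. v t m)) + (\<Sum>m\<in>J. v t m) = 0"
          using t by simp
        moreover have "(\<Sum>m\<in>K - J. v t m) = (\<Sum>m\<in>K - J. - p m / q m)"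
          by (rule sum.cong) (auto simp: v_def h_def)
        moreover have "(\<Sum>m\<in>J. v t m) = (\<Sum>m\<in>J. (t - p m) / q m)"
          by (rule sum.cong) (auto simp: v_def h_def)
        ultimately show ?thesis by simp
      qed
      have "(\<Sum>m\<in>J. 1 / q m) = (\<Sum>m\<in>J. (2 - p m) / q m) - (\<Sum>m\<in>J. (1 - p m) / q m)"
        by (simp add: sum_subtractf[symmetric] diff_divide_distrib)
      also have "\<dots> = 0" using E[of 2] E[of 1] by simp
      finally show ?thesis .
    qed
    have eq: "1 / q a = 1 / q b" if ab: "a \<in> K" "b \<in> K" "a \<noteq> b" for a b
    proof -
      have "r \<le> card (K - {a, b})" using assms(2) ab assms(1) by (simp add: card_Diff_subset)
      then obtain J where J: "J \<subseteq> K - {a, b}" "card J = r"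
        using obtain_subset_with_card_n by metis
      have fJ: "finite J" using J assms(1) by (auto intro: finite_subset)
      have nJ: "a \<notin> J" "b \<notin> J" using J by auto
      have "(\<Sum>m\<in>insert c J. 1 / q m) = 0" if "c \<in> {a, b}" for c
        using J ab fJ nJ that by (intro sumJ) auto
      from this[of a] this[of b] have "(\<Sum>m\<in>insert a J. 1 / q m) = 0" "(\<Sum>m\<in>insert b J. 1 / q m) = 0"
        by simp_all
      then have "1 / q a + (\<Sum>m\<in>J. 1 / q m) = 1 / q b + (\<Sum>m\<in>J. 1 / q m)" using fJ nJ by simp
      then show ?thesis by (rule add_right_imp_eq)
    qed
    obtain J where J: "J \<subseteq> K" "card J = Suc r"
      using obtain_subset_with_card_n[of "Suc r" K] assms(2) by auto
    then obtain a where a: "a \<in> J" by fastforce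
    have "(\<Sum>m\<in>J. 1 / q m) = (\<Sum>m\<in>J. 1 / q a)"
    proof (rule sum.cong[OF refl])
      fix m assume "m \<in> J"
      then show "1 / q m = 1 / q a" using a J eq[of m a] by (cases "m = a") auto
    qed
    then show False using sumJ[OF J] J q a by auto
  qed
qed

section \<open>Determinants and self-adjoint maps\<close>

text \<open>
  Only the identity permutation contributes: any other one moves some index besides \<open>k\<close>.
\<close>

lemma det_row_replaced_diagonal:
  fixes v :: "real ^ 'n"
  shows "det ((\<chi> i. if i = k then v else axis i (d i)) :: real^'n^'n) = v $ k * (\<Prod>i\<in>UNIV - {k}. d i)"
proof -
  let ?A = "(\<chi> i. if i = k then v else axis i (d i)) :: real^'n^'n"
  let ?f = "\<lambda>p. of_int (sign p) * (\<Prod>i\<in>UNIV. ?A $ i $ p i)"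
  have other: "?f p = 0" if p: "p permutes UNIV" "p \<noteq> id" for p
  proof -
    have "\<exists>i. i \<noteq> k \<and> p i \<noteq> i"
    proof (rule ccontr)
      assume "\<not> ?thesis"
      then have fixp: "p i = i" if "i \<noteq> k" for i using that by blast
      have "p k = k"
        using fixp permutes_inj[OF p(1)] by (metis injD)
      then have "p = id" using fixp by (metis eq_id_iff)
      then show False using p by simp
    qed
    then obtain i where i: "i \<noteq> k" "p i \<noteq> i" by blast
    then have "?A $ i $ p i = 0" by (simp add: axis_def)
    then have "\<exists>i\<in>UNIV. ?A $ i $ p i = 0" by blast
    then have "(\<Prod>i\<in>UNIV. ?A $ i $ p i) = 0" by (rule prod_zero[OF finite])
    then show ?thesis by simp
  qed
  have "det ?A = (\<Sum>p\<in>{id}. ?f p)"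
    unfolding det_def
    by (rule sum.mono_neutral_right) (use other permutes_id in auto)
  also have "\<dots> = (\<Prod>i\<in>UNIV. ?A $ i $ i)"
    by (simp add: sign_id)
  also have "\<dots> = ?A $ k $ k * (\<Prod>i\<in>UNIV - {k}. ?A $ i $ i)"
    by (rule prod.remove) auto
  also have "(\<Prod>i\<in>UNIV - {k}. ?A $ i $ i) = (\<Prod>i\<in>UNIV - {k}. d i)"
    by (rule prod.cong) (auto simp: axis_def)
  finally show ?thesis by simp
qed

text \<open>
  The matrix determinant lemma in a form that allows zeros on the diagonal.  The rank-one part is
  switched on row by row: linearity in row \<open>k\<close> splits off a determinant whose row \<open>k\<close> is \<open>v\<close>, and multiples of this
  row clear the rank-one part from all other rows.
\<close>

lemma det_diagonal_plus_rank_one: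
  fixes u v d :: "'n::finite \<Rightarrow> real"
  shows "det (\<chi> i j. (if i = j then d i else 0) + u i * v j) =
    (\<Prod>i\<in>UNIV. d i) + (\<Sum>k\<in>UNIV. u k * v k * (\<Prod>i\<in>UNIV - {k}. d i))"
proof -
  define w :: "real ^ 'n" where "w = (\<chi> j. v j)"
  \<comment> \<open>Row \<open>i\<close> of the matrix in which the rank-one part is present in the rows of \<open>S\<close> only.\<close>
  define A where "A S i = axis i (d i) + (if i \<in> S then u i *s w else 0)" for S and i :: 'n
  have repl: "det ((\<chi> i. if i = k then w else A S i) :: real^'n^'n) = v k * (\<Prod>i\<in>UNIV - {k}. d i)"
    if "k \<notin> S" for k S
    using finite[of S] that
  proof (induction S rule: finite_induct)
    case empty
    have "((\<chi> i. if i = k then w else A {} i) :: real^'n^'n) = (\<chi> i. if i = k then w else axis i (d i))"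
      by (auto simp: vec_eq_iff A_def)
    then show ?case using det_row_replaced_diagonal[of k w d] by (simp add: w_def)
  next
    case (insert l S)
    let ?R = "(\<chi> i. if i = k then w else A S i) :: real^'n^'n"
    have lk: "l \<noteq> k" using insert by auto
    have "((\<chi> i. if i = k then w else A (insert l S) i) :: real^'n^'n) =
        (\<chi> i. if i = l then row l ?R + u l *s row k ?R else row i ?R)"
      using lk insert.hyps by (auto simp: vec_eq_iff A_def row_def)
    then show ?case using insert det_row_operation[OF lk, of ?R "u l"] by simp
  qed
  have "det ((\<chi> i. A S i) :: real^'n^'n) = (\<Prod>i\<in>UNIV. d i) + (\<Sum>k\<in>S. u k * v k * (\<Prod>i\<in>UNIV - {k}. d i))" for S
    using finite[of S]
  proof (induction S rule: finite_induct)
    case empty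
    have "det ((\<chi> i. A {} i) :: real^'n^'n) = (\<Prod>i\<in>UNIV. d i)"
      by (subst det_diagonal) (auto simp: A_def axis_def)
    then show ?case by simp
  next
    case (insert k S)
    have "(\<chi> i. A (insert k S) i) = (\<chi> i. if i = k then axis i (d i) + u i *s w else A S i)"
      using insert.hyps by (auto simp: vec_eq_iff A_def)
    also have "det \<dots> = det (\<chi> i. if i = k then axis i (d i) else A S i)
        + det (\<chi> i. if i = k then u i *s w else A S i)"
      by (rule det_row_add)
    also have "(\<chi> i. if i = k then axis i (d i) else A S i) = (\<chi> i. A S i)"
      using insert.hyps by (auto simp: vec_eq_iff A_def)
    also have "(\<chi> i. if i = k then u i *s w else A S i) = (\<chi> i. if i = k then u k *s w else A S i)"
      by (auto simp: vec_eq_iff)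
    also have "det \<dots> = u k * (v k * (\<Prod>i\<in>UNIV - {k}. d i))"
      using det_row_mul[of k "u k" "\<lambda>i. w" "A S"] repl[OF insert.hyps(2)] by simp
    finally show ?case using insert by simp
  qed
  moreover have "(\<chi> i j. (if i = j then d i else 0) + u i * v j) = (\<chi> i. A UNIV i)"
    by (auto simp: vec_eq_iff A_def axis_def w_def)
  ultimately show ?thesis by simp
qed

lemma linear_coeff_zero_if_nonpos:
  fixes \<alpha> \<gamma> :: real
  assumes "\<And>t. 2 * t * \<alpha> + t\<^sup>2 * \<gamma> \<le> 0"
  shows "\<alpha> = 0"
proof -
  define g where "g = \<bar>\<gamma>\<bar> + 1"
  have g: "g > 0" by (simp add: g_def)
  have "(2 * (\<alpha> / g) * \<alpha> + (\<alpha> / g)\<^sup>2 * \<gamma>) * g\<^sup>2 \<le> 0"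
    using assms[of "\<alpha> / g"] by (simp add: mult_nonpos_nonneg)
  also have "(2 * (\<alpha> / g) * \<alpha> + (\<alpha> / g)\<^sup>2 * \<gamma>) * g\<^sup>2 = \<alpha>\<^sup>2 * (2 * g + \<gamma>)"
    using g by (simp add: field_simps power2_eq_square)
  finally have "\<alpha>\<^sup>2 * (2 * g + \<gamma>) \<le> 0" .
  moreover have "2 * g + \<gamma> > 0" by (cases "\<gamma> \<ge> 0") (simp_all add: g_def)
  ultimately show ?thesis
    by (auto simp: mult_le_0_iff)
qed

text \<open>
  A maximiser \<open>v\<close> of the quadratic form on the unit sphere is an eigenvector: moving it in a direction
  \<open>w\<close> cannot increase the Rayleigh quotient, so the first variation \<open>(L v - c v) \<bullet> w\<close> vanishes.
\<close>

lemma self_adjoint_eigenvector: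
  fixes L :: "'a::euclidean_space \<Rightarrow> 'a"
  assumes L: "linear L" and T: "subspace T" "T \<noteq> {0}" and inv: "\<And>v. v \<in> T \<Longrightarrow> L v \<in> T"
    and sa: "\<And>v w. v \<in> T \<Longrightarrow> w \<in> T \<Longrightarrow> L v \<bullet> w = v \<bullet> L w"
  shows "\<exists>v c. v \<in> T \<and> norm v = 1 \<and> L v = c *\<^sub>R v"
proof -
  let ?K = "T \<inter> sphere 0 1"
  have "compact ?K" using T by (simp add: closed_subspace compact_Int closed_Int_compact)
  obtain x where x: "x \<in> T" "x \<noteq> 0" using T subspace_0 by blast
  then have "x /\<^sub>R norm x \<in> ?K" using T by (simp add: subspace_scale)
  then have "?K \<noteq> {}" by blast
  have "continuous_on ?K (\<lambda>v. L v \<bullet> v)"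
    using L by (intro continuous_intros linear_continuous_on linear_conv_bounded_linear[THEN iffD1])
  then obtain v where v: "v \<in> ?K" and max: "\<And>w. w \<in> ?K \<Longrightarrow> L w \<bullet> w \<le> L v \<bullet> v"
    using continuous_attains_sup[OF \<open>compact ?K\<close> \<open>?K \<noteq> {}\<close>] by blast
  define c where "c = L v \<bullet> v"
  have vT: "v \<in> T" "norm v = 1" using v by auto
  have le: "L w \<bullet> w \<le> c * (w \<bullet> w)" if "w \<in> T" for w
  proof (cases "w = 0")
    case True
    then show ?thesis by simp
  next
    case False
    then have "w /\<^sub>R norm w \<in> ?K" using that T by (simp add: subspace_scale)
    from max[OF this] have "L w \<bullet> w / (norm w * norm w) \<le> c"
      using L by (simp add: linear_scale c_def divide_inverse ac_simps)
    then show ?thesis using False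
      by (simp add: divide_le_eq dot_square_norm power2_eq_square)
  qed
  have "L v \<bullet> w - c * (v \<bullet> w) = 0" if w: "w \<in> T" for w
  proof (rule linear_coeff_zero_if_nonpos)
    fix t
    have "L (v + t *\<^sub>R w) \<bullet> (v + t *\<^sub>R w) \<le> c * ((v + t *\<^sub>R w) \<bullet> (v + t *\<^sub>R w))"
      using vT w T by (intro le) (simp add: subspace_add subspace_scale)
    moreover have "L w \<bullet> v = L v \<bullet> w" using sa[OF vT(1) w] by (simp add: inner_commute)
    moreover have "v \<bullet> v = 1" using vT by (simp add: dot_square_norm)
    ultimately show "2 * t * (L v \<bullet> w - c * (v \<bullet> w)) + t\<^sup>2 * (L w \<bullet> w - c * (w \<bullet> w)) \<le> 0"
      using L by (simp add: linear_add linear_scale inner_add_left inner_add_right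
          algebra_simps power2_eq_square inner_commute[of w v] c_def)
  qed
  from this[of "L v - c *\<^sub>R v"] have "(L v - c *\<^sub>R v) \<bullet> (L v - c *\<^sub>R v) = 0"
    using vT inv T by (simp add: subspace_diff subspace_scale inner_diff_left)
  then have "L v = c *\<^sub>R v" by simp
  then show ?thesis using vT by blast
qed

text \<open>
  The spectral theorem on an invariant subspace, by splitting off one eigenvector and passing to its
  orthogonal complement.
\<close>

lemma self_adjoint_eigenbasis:
  fixes L :: "'a::euclidean_space \<Rightarrow> 'a"
  assumes L: "linear L" and T: "subspace T" and inv: "\<And>v. v \<in> T \<Longrightarrow> L v \<in> T"
    and sa: "\<And>v w. v \<in> T \<Longrightarrow> w \<in> T \<Longrightarrow> L v \<bullet> w = v \<bullet> L w"
  shows "\<exists>B \<mu>. B \<subseteq> T \<and> pairwise orthogonal B \<and> (\<forall>b\<in>B. norm b = 1 \<and> L b = \<mu> b *\<^sub>R b) \<and> span B = T"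
proof -
  have "\<exists>B. B \<subseteq> T \<and> pairwise orthogonal B \<and> (\<forall>b\<in>B. norm b = 1 \<and> (\<exists>c. L b = c *\<^sub>R b)) \<and> span B = T"
    using T inv sa
  proof (induction "dim T" arbitrary: T rule: less_induct)
    case less
    show ?case
    proof (cases "T = {0}")
      case True
      then show ?thesis by (intro exI[of _ "{}"]) auto
    next
      case False
      obtain v c where v: "v \<in> T" "norm v = 1" "L v = c *\<^sub>R v"
        using self_adjoint_eigenvector[OF L less.prems(1) False] less.prems by blast
      define T' where "T' = T \<inter> {w. v \<bullet> w = 0}"
      have sub: "subspace T'"
        unfolding T'_def using less.prems(1) by (intro subspace_inter) (auto simp: subspace_hyperplane)
      have "v \<bullet> v \<noteq> 0" using v by auto
      then have "v \<notin> T'" by (simp add: T'_def)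
      moreover have "T' \<subseteq> T" by (simp add: T'_def)
      ultimately have "T' \<subset> T" using v by blast
      then have "dim T' < dim T" using sub less.prems(1)
        by (intro dim_psubset) (metis span_eq_iff)
      moreover have "L w \<in> T'" if "w \<in> T'" for w
        using that less.prems(2)[of w] less.prems(3)[of v w] v
        by (auto simp: T'_def)
      moreover have "L x \<bullet> y = x \<bullet> L y" if "x \<in> T'" "y \<in> T'" for x y
        using less.prems(3) that by (auto simp: T'_def)
      ultimately obtain B where B: "B \<subseteq> T'" "pairwise orthogonal B"
          "\<forall>b\<in>B. norm b = 1 \<and> (\<exists>c. L b = c *\<^sub>R b)" "span B = T'"
        using less.hyps[OF _ sub] by blast
      have vB: "orthogonal v b" "orthogonal b v" if "b \<in> B" for b
        using B that by (auto simp: T'_def orthogonal_def inner_commute)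
      have "T \<subseteq> span (insert v B)"
      proof
        fix x assume x: "x \<in> T"
        have "v \<bullet> v = 1" using v by (simp add: dot_square_norm)
        then have "x - (v \<bullet> x) *\<^sub>R v \<in> T'"
          using x v less.prems(1) by (simp add: T'_def subspace_diff subspace_scale inner_diff_right)
        then show "x \<in> span (insert v B)"
          using B(4) by (auto simp: span_breakdown_eq)
      qed
      moreover have "span (insert v B) \<subseteq> T"
        using v B less.prems(1) by (intro span_minimal) (auto simp: T'_def)
      moreover have "pairwise orthogonal (insert v B)"
        using B(2) vB by (auto simp: pairwise_insert)
      ultimately show ?thesis
        using B v by (intro exI[of _ "insert v B"]) (auto simp: T'_def)
    qed
  qed
  then obtain B where B: "B \<subseteq> T" "pairwise orthogonal B"
      "\<forall>b\<in>B. norm b = 1 \<and> (\<exists>c. L b = c *\<^sub>R b)" "span B = T" by blast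
  then have "\<forall>b\<in>B. \<exists>c. L b = c *\<^sub>R b" by blast
  then obtain \<mu> where "\<forall>b\<in>B. L b = \<mu> b *\<^sub>R b" by metis
  then show ?thesis using B by blast
qed

lemma orthonormal_set:
  fixes B :: "'a::euclidean_space set"
  assumes "pairwise orthogonal B" "\<forall>b\<in>B. norm b = 1"
  shows "independent B" "finite B" "dim (span B) = card B"
proof -
  show "independent B"
    using assms by (intro pairwise_orthogonal_independent) auto
  then show "finite B" by (rule independent_imp_finite)
  show "dim (span B) = card B"
    using \<open>independent B\<close> by (simp add: dim_eq_card_independent)
qed

lemma dim_eigenspace:
  fixes L :: "'a::euclidean_space \<Rightarrow> 'a"
  assumes L: "linear L" and sa: "\<And>v w. v \<in> span B \<Longrightarrow> w \<in> span B \<Longrightarrow> L v \<bullet> w = v \<bullet> L w"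
    and B: "pairwise orthogonal B" "\<And>b. b \<in> B \<Longrightarrow> norm b = 1" "\<And>b. b \<in> B \<Longrightarrow> L b = \<mu> b *\<^sub>R b"
  shows "dim {v \<in> span B. L v = c *\<^sub>R v} = card {b \<in> B. \<mu> b = c}"
proof -
  note on = orthonormal_set[OF B(1)]
  let ?C = "{b \<in> B. \<mu> b = c}"
  have "{v \<in> span B. L v = c *\<^sub>R v} = span ?C"
  proof
    have "subspace {v. L v = c *\<^sub>R v}"
      using L by (auto simp: subspace_def linear_add linear_scale linear_0 algebra_simps)
    then have "span ?C \<subseteq> {v. L v = c *\<^sub>R v}"
      using B(3) by (intro span_minimal) auto
    moreover have "span ?C \<subseteq> span B" by (rule span_mono) auto
    ultimately show "span ?C \<subseteq> {v \<in> span B. L v = c *\<^sub>R v}" by blast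
    show "{v \<in> span B. L v = c *\<^sub>R v} \<subseteq> span ?C"
    proof
      fix v assume v: "v \<in> {v \<in> span B. L v = c *\<^sub>R v}"
      have "(v \<bullet> b) *\<^sub>R b \<in> span ?C" if b: "b \<in> B" for b
      proof (cases "\<mu> b = c")
        case True
        then show ?thesis using b by (auto intro: span_scale span_base)
      next
        case False
        have "L v \<bullet> b = v \<bullet> L b" using v b by (intro sa) (auto intro: span_base)
        then have "(c - \<mu> b) * (v \<bullet> b) = 0" using v B(3)[OF b] by (simp add: algebra_simps)
        then show ?thesis using False by (simp add: span_zero)
      qed
      moreover have "v = (\<Sum>b\<in>B. (v \<bullet> b) *\<^sub>R b)"
        using orthonormal_basis_expand[of B v] on B v by auto
      ultimately show "v \<in> span ?C" using span_sum[of B "\<lambda>b. (v \<bullet> b) *\<^sub>R b" ?C] by simp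
    qed
  qed
  moreover have "dim (span ?C) = card ?C"
    using on(1) B by (simp add: dim_span dim_eq_card_independent independent_mono)
  ultimately show ?thesis by simp
qed

text \<open>
  Equal fibre sizes mean equal multisets of values.  This allows working with any list of principal curvatures.
\<close>

lemma prod_eq_if_fibers_eq:
  assumes "finite A" "finite B" "\<And>c. card {i \<in> A. \<kappa> i = c} = card {b \<in> B. \<mu> b = c}"
  shows "(\<Prod>i\<in>A. g (\<kappa> i)) = (\<Prod>b\<in>B. g (\<mu> b))"
proof -
  have "image_mset \<kappa> (mset_set A) = image_mset \<mu> (mset_set B)"
  proof (rule multiset_eqI)
    fix c
    show "count (image_mset \<kappa> (mset_set A)) c = count (image_mset \<mu> (mset_set B)) c"
      using assms by (simp add: count_image_mset_eq_card_vimage)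
  qed
  then have "prod_mset (image_mset g (image_mset \<kappa> (mset_set A))) = prod_mset (image_mset g (image_mset \<mu> (mset_set B)))"
    by simp
  then show ?thesis by (simp add: prod_unfold_prod_mset image_mset.compositionality o_def)
qed

section \<open>Smooth functions and curves\<close>

text \<open>
  The iterated derivatives that occur inside \<open>smooth_on\<close>.
\<close>

definition higher_deriv :: "nat \<Rightarrow> (real \<Rightarrow> 'a::real_normed_vector) \<Rightarrow> real \<Rightarrow> 'a" where
  "higher_deriv k f = ((\<lambda>g t. vector_derivative g (at t)) ^^ k) f"

lemma higher_deriv_0 [simp]: "higher_deriv 0 f = f"
  by (simp add: higher_deriv_def)

lemma higher_deriv_Suc: "higher_deriv (Suc k) f t = vector_derivative (higher_deriv k f) (at t)"
  by (simp add: higher_deriv_def)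

lemma smooth_on_has_vector_derivative:
  "smooth_on J f \<Longrightarrow> t \<in> J \<Longrightarrow> (higher_deriv k f has_vector_derivative higher_deriv (Suc k) f t) (at t)"
  by (simp add: smooth_on_def higher_deriv_def vector_derivative_works)

text \<open>
  Smoothness is shown by exhibiting the sequence \<open>g\<close> of all derivatives.  Since \<open>J\<close> is open, derivatives at points of
  \<open>J\<close> depend on the values on \<open>J\<close> only.
\<close>

lemma smooth_onI:
  assumes J: "open J" and f: "\<And>t. t \<in> J \<Longrightarrow> g 0 t = f t"
    and g: "\<And>k t. t \<in> J \<Longrightarrow> (g k has_vector_derivative g (Suc k) t) (at t)"
  shows "smooth_on J f"
proof -
  have step: "(higher_deriv k f has_vector_derivative g (Suc k) t) (at t)"
    if "\<forall>t\<in>J. higher_deriv k f t = g k t" "t \<in> J" for k t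
    using has_vector_derivative_transform_within_open[OF g[OF that(2)] J that(2)] that(1) by metis
  have eq: "\<forall>t\<in>J. higher_deriv k f t = g k t" for k
  proof (induction k)
    case 0
    then show ?case using f by simp
  next
    case (Suc k)
    then show ?case using step[OF Suc] by (simp add: higher_deriv_Suc vector_derivative_at)
  qed
  have "higher_deriv k f differentiable (at t)" if "t \<in> J" for k t
    using step[OF eq that] by (auto simp: differentiable_def has_vector_derivative_def)
  then show ?thesis by (simp add: smooth_on_def higher_deriv_def)
qed

lemma smooth_on_subset: "smooth_on J f \<Longrightarrow> I \<subseteq> J \<Longrightarrow> smooth_on I f"
  unfolding smooth_on_def by blast

lemma smooth_on_affine_image:
  fixes f :: "real \<Rightarrow> 'a::euclidean_space" and A :: "'a \<Rightarrow> 'b::euclidean_space"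
  assumes "open J" "smooth_on J f" "linear A"
  shows "smooth_on J (\<lambda>t. c + A (f t))"
proof (rule smooth_onI[OF assms(1), where g = "\<lambda>k t. (if k = 0 then c else 0) + A (higher_deriv k f t)"])
  fix k t assume t: "t \<in> J"
  have "bounded_linear A" using assms(3) by (simp add: linear_conv_bounded_linear)
  from bounded_linear.has_vector_derivative[OF this smooth_on_has_vector_derivative[OF assms(2) t]]
  have "((\<lambda>t. (if k = 0 then c else 0) + A (higher_deriv k f t)) has_vector_derivative
      0 + A (higher_deriv (Suc k) f t)) (at t)"
    by (intro derivative_intros)
  then show "((\<lambda>t. (if k = 0 then c else 0) + A (higher_deriv k f t)) has_vector_derivative
      (if Suc k = 0 then c else 0) + A (higher_deriv (Suc k) f t)) (at t)" by simp
qed simp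

lemma smooth_on_sum:
  fixes f :: "'i \<Rightarrow> real \<Rightarrow> 'a::real_normed_vector"
  assumes "open J" "\<And>i. i \<in> I \<Longrightarrow> smooth_on J (f i)"
  shows "smooth_on J (\<lambda>t. \<Sum>i\<in>I. f i t)"
proof (rule smooth_onI[OF assms(1), where g = "\<lambda>k t. \<Sum>i\<in>I. higher_deriv k (f i) t"])
  show "((\<lambda>t. \<Sum>i\<in>I. higher_deriv k (f i) t) has_vector_derivative
      (\<Sum>i\<in>I. higher_deriv (Suc k) (f i) t)) (at t)" if "t \<in> J" for k t
    using smooth_on_has_vector_derivative[OF assms(2) that]
    by (intro has_vector_derivative_sum) auto
qed simp

lemma smooth_on_affine_arg:
  fixes f :: "real \<Rightarrow> real"
  assumes "open J" "smooth_on J f" "open I" "\<And>t. t \<in> I \<Longrightarrow> a + b * t \<in> J"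
  shows "smooth_on I (\<lambda>t. f (a + b * t))"
proof (rule smooth_onI[OF assms(3), where g = "\<lambda>k t. b ^ k * higher_deriv k f (a + b * t)"])
  show "((\<lambda>t. b ^ k * higher_deriv k f (a + b * t)) has_vector_derivative
      b ^ Suc k * higher_deriv (Suc k) f (a + b * t)) (at t)" if t: "t \<in> I" for k t
  proof -
    have "(higher_deriv k f has_real_derivative higher_deriv (Suc k) f (a + b * t)) (at (a + b * t))"
      using smooth_on_has_vector_derivative[OF assms(2) assms(4)[OF t]]
      by (simp add: has_real_derivative_iff_has_vector_derivative)
    then have "((\<lambda>t. higher_deriv k f (a + b * t)) has_real_derivative higher_deriv (Suc k) f (a + b * t) * b) (at t)"
      by (rule DERIV_chain2) (auto intro!: derivative_eq_intros)
    from DERIV_cmult[OF this, of "b ^ k"] show ?thesis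
      by (simp add: has_real_derivative_iff_has_vector_derivative[symmetric] algebra_simps)
  qed
qed simp

lemma smooth_on_Pair:
  fixes f :: "real \<Rightarrow> 'a::real_normed_vector" and g :: "real \<Rightarrow> 'b::real_normed_vector"
  assumes "open J" "smooth_on J f" "smooth_on J g"
  shows "smooth_on J (\<lambda>t. (f t, g t))"
  by (rule smooth_onI[OF assms(1), where g = "\<lambda>k t. (higher_deriv k f t, higher_deriv k g t)"])
    (auto intro!: has_vector_derivative_Pair smooth_on_has_vector_derivative assms)

lemma smooth_on_line:
  fixes x v :: "'a::real_normed_vector"
  assumes "open J"
  shows "smooth_on J (\<lambda>t. x + t *\<^sub>R v)"
proof (rule smooth_onI[OF assms, where g = "\<lambda>k t. if k = 0 then x + t *\<^sub>R v else if k = 1 then v else 0"])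
  fix k t
  show "((\<lambda>t. if k = 0 then x + t *\<^sub>R v else if k = 1 then v else 0) has_vector_derivative
        (if Suc k = 0 then x + t *\<^sub>R v else if Suc k = 1 then v else 0)) (at t)"
  proof (cases "k = 0")
    case True
    have "((\<lambda>t. x + t *\<^sub>R v) has_vector_derivative v) (at t)"
      by (auto intro!: derivative_eq_intros)
    then show ?thesis using True by simp
  qed auto
qed simp

lemma smooth_on_linear_real:
  fixes a b :: real
  assumes "open J"
  shows "smooth_on J (\<lambda>t. a * t + b)"
  using smooth_on_line[OF assms, of b a] by (simp add: algebra_simps)

text \<open>
  The derivative of \<open>ln (cos t)\<close> is \<open>- tan t\<close>, and since \<open>tan' = 1 + tan^2\<close> the higher ones are polynomials in \<open>tan t\<close>.
\<close>

lemma smooth_on_ln_cos: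
  assumes J: "open J" "\<And>t. t \<in> J \<Longrightarrow> \<bar>t\<bar> < pi / 2"
  shows "smooth_on J (\<lambda>t. ln (cos t))"
proof -
  define P :: "nat \<Rightarrow> real poly" where "P k = ((\<lambda>p. pderiv p * [:1, 0, 1:]) ^^ k) [:0, -1:]" for k
  have P_Suc: "P (Suc k) = pderiv (P k) * [:1, 0, 1:]" for k
    by (simp add: P_def del: mult_pCons_right)
  show ?thesis
  proof (rule smooth_onI[OF J(1), where g = "\<lambda>k t. case k of 0 \<Rightarrow> ln (cos t) | Suc m \<Rightarrow> poly (P m) (tan t)"])
    fix k t assume "t \<in> J"
    then have c: "cos t > 0" using J(2)[of t] by (intro cos_gt_zero_pi) auto
    have D: "((\<lambda>t. poly (P m) (tan t)) has_real_derivative poly (P (Suc m)) (tan t)) (at t)" for m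
    proof -
      have "((\<lambda>t. poly (P m) (tan t)) has_real_derivative poly (pderiv (P m)) (tan t) * inverse ((cos t)\<^sup>2)) (at t)"
        using c by (intro DERIV_chain2[OF poly_DERIV DERIV_tan]) auto
      moreover have "inverse ((cos t)\<^sup>2) = 1 + (tan t)\<^sup>2"
        using c tan_sec[of t] by (simp add: power_inverse)
      ultimately show ?thesis by (simp add: P_Suc power2_eq_square del: mult_pCons_right)
    qed
    have "((\<lambda>t. ln (cos t)) has_real_derivative poly (P 0) (tan t)) (at t)"
      using c by (auto intro!: derivative_eq_intros simp: P_def tan_def)
    then show "((\<lambda>t. case k of 0 \<Rightarrow> ln (cos t) | Suc m \<Rightarrow> poly (P m) (tan t)) has_vector_derivative
        (case Suc k of 0 \<Rightarrow> ln (cos t) | Suc m \<Rightarrow> poly (P m) (tan t))) (at t)"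
      using D by (cases k) (simp_all add: has_real_derivative_iff_has_vector_derivative)
  qed simp
qed

section \<open>Congruence invariance of the curvatures\<close>

text \<open>
  The property that \<open>shape_operator\<close> selects by a definite description.
\<close>

definition normal_derivative :: "'a::euclidean_space set \<Rightarrow> ('a \<Rightarrow> 'a) \<Rightarrow> 'a \<Rightarrow> 'a \<Rightarrow> 'a \<Rightarrow> bool" where
  "normal_derivative M N p v w \<longleftrightarrow>
     (\<forall>\<gamma>. smooth_curve_in M p v \<gamma> \<longrightarrow> ((N \<circ> \<gamma>) has_vector_derivative w) (at 0))"

lemma shape_operator_eq: "normal_derivative M N p v w \<Longrightarrow> v \<in> tangent_space M p \<Longrightarrow> shape_operator M N p v = - w"
proof -
  assume w: "normal_derivative M N p v w" and "v \<in> tangent_space M p"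
  then obtain \<gamma> where \<gamma>: "smooth_curve_in M p v \<gamma>" by (auto simp: tangent_space_def)
  have "w' = w" if "normal_derivative M N p v w'" for w'
    using that w \<gamma> vector_derivative_unique_at unfolding normal_derivative_def by blast
  then have "(THE w. normal_derivative M N p v w) = w" using w by blast
  then show ?thesis unfolding shape_operator_def normal_derivative_def by simp
qed

lemma orthogonal_transformation_inverse:
  fixes f :: "'a::euclidean_space \<Rightarrow> 'a"
  assumes "orthogonal_transformation f"
  shows "inv f (f x) = x" "f (inv f x) = x"
proof -
  note bij = orthogonal_transformation_bij[OF assms]
  show "inv f (f x) = x" by (rule inv_f_f[OF bij_is_inj[OF bij]])
  show "f (inv f x) = x" by (rule surj_f_inv_f[OF bij_is_surj[OF bij]])
qed

lemma smooth_curve_in_affine_image: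
  fixes f :: "'a::euclidean_space \<Rightarrow> 'a"
  assumes "linear f" "smooth_curve_in M p v \<gamma>"
  shows "smooth_curve_in ((\<lambda>x. c + f x) ` M) (c + f p) (f v) (\<lambda>t. c + f (\<gamma> t))"
proof -
  have "bounded_linear f" using assms(1) by (simp add: linear_conv_bounded_linear)
  from bounded_linear.has_vector_derivative[OF this, of \<gamma> v "at 0"]
  have "((\<lambda>t. f (\<gamma> t)) has_vector_derivative f v) (at 0)"
    using assms(2) by (simp add: smooth_curve_in_def)
  then have "((\<lambda>t. c + f (\<gamma> t)) has_vector_derivative (0 + f v)) (at 0)"
    by (rule has_vector_derivative_add[OF has_vector_derivative_const])
  moreover have "\<exists>\<epsilon>>0. (\<lambda>t. c + f (\<gamma> t)) ` {-\<epsilon><..<\<epsilon>} \<subseteq> (\<lambda>x. c + f x) ` M \<and> smooth_on {-\<epsilon><..<\<epsilon>} (\<lambda>t. c + f (\<gamma> t))"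
  proof -
    obtain \<epsilon> where \<epsilon>: "\<epsilon> > 0" "\<gamma> ` {-\<epsilon><..<\<epsilon>} \<subseteq> M" "smooth_on {-\<epsilon><..<\<epsilon>} \<gamma>"
      using assms(2) by (auto simp: smooth_curve_in_def)
    have "(\<lambda>t. c + f (\<gamma> t)) ` {-\<epsilon><..<\<epsilon>} \<subseteq> (\<lambda>x. c + f x) ` M" using \<epsilon>(2) by blast
    moreover have "smooth_on {-\<epsilon><..<\<epsilon>} (\<lambda>t. c + f (\<gamma> t))"
      using smooth_on_affine_image[OF _ \<epsilon>(3) assms(1)] by simp
    ultimately show ?thesis using \<epsilon>(1) by blast
  qed
  ultimately show ?thesis using assms(2) by (simp add: smooth_curve_in_def)
qed

lemma smooth_curve_in_congruent:
  fixes f :: "'a::euclidean_space \<Rightarrow> 'a"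
  assumes f: "orthogonal_transformation f"
  shows "smooth_curve_in ((\<lambda>x. c + f x) ` M) (c + f p) (f v) \<gamma> \<longleftrightarrow>
    smooth_curve_in M p v (\<lambda>t. inv f (\<gamma> t - c))"
proof -
  note inv = orthogonal_transformation_inverse[OF f]
  have lin: "linear f" "linear (inv f)"
    using f orthogonal_transformation_inv[OF f] by (simp_all add: orthogonal_transformation_def)
  have eq: "inv f (x - c) = - inv f c + inv f x" for x
    using lin(2) by (simp add: linear_diff)
  have im: "(\<lambda>x. - inv f c + inv f x) ` (\<lambda>x. c + f x) ` M = M"
    unfolding image_image eq[symmetric] by (simp add: inv)
  show ?thesis
  proof
    assume "smooth_curve_in ((\<lambda>x. c + f x) ` M) (c + f p) (f v) \<gamma>"
    from smooth_curve_in_affine_image[OF lin(2) this, of "- inv f c"]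
    show "smooth_curve_in M p v (\<lambda>t. inv f (\<gamma> t - c))"
      unfolding im unfolding eq[symmetric] by (simp add: inv)
  next
    assume "smooth_curve_in M p v (\<lambda>t. inv f (\<gamma> t - c))"
    from smooth_curve_in_affine_image[OF lin(1) this, of c]
    show "smooth_curve_in ((\<lambda>x. c + f x) ` M) (c + f p) (f v) \<gamma>"
      by (simp add: inv)
  qed
qed

lemma tangent_space_congruent:
  fixes f :: "'a::euclidean_space \<Rightarrow> 'a"
  assumes f: "orthogonal_transformation f"
  shows "tangent_space ((\<lambda>x. c + f x) ` M) (c + f p) = f ` tangent_space M p"
proof -
  note inv = orthogonal_transformation_inverse[OF f]
  have "f v \<in> tangent_space ((\<lambda>x. c + f x) ` M) (c + f p) \<longleftrightarrow> v \<in> tangent_space M p" for v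
  proof
    assume "f v \<in> tangent_space ((\<lambda>x. c + f x) ` M) (c + f p)"
    then show "v \<in> tangent_space M p"
      unfolding tangent_space_def smooth_curve_in_congruent[OF f] mem_Collect_eq by (elim exE) (rule exI)
  next
    assume "v \<in> tangent_space M p"
    then obtain \<gamma> where "smooth_curve_in M p v \<gamma>" by (auto simp: tangent_space_def)
    from smooth_curve_in_affine_image[OF _ this, of f c]
    show "f v \<in> tangent_space ((\<lambda>x. c + f x) ` M) (c + f p)"
      unfolding tangent_space_def using f by (auto simp: orthogonal_transformation_def)
  qed
  from this[of "inv f _"] have "y \<in> tangent_space ((\<lambda>x. c + f x) ` M) (c + f p) \<longleftrightarrow> inv f y \<in> tangent_space M p" for y
    by (simp only: inv)
  moreover have "y \<in> f ` V \<longleftrightarrow> inv f y \<in> V" for y V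
  proof
    assume "inv f y \<in> V"
    then have "f (inv f y) \<in> f ` V" by (rule imageI)
    then show "y \<in> f ` V" by (simp only: inv)
  qed (auto simp: inv)
  ultimately show ?thesis by blast
qed

lemma normal_derivative_congruent:
  fixes f :: "'a::euclidean_space \<Rightarrow> 'a"
  assumes f: "orthogonal_transformation f" and w: "normal_derivative M N p v w"
  shows "normal_derivative ((\<lambda>x. c + f x) ` M) (\<lambda>y. f (N (inv f (y - c)))) (c + f p) (f v) (f w)"
proof -
  have "bounded_linear f" using f
    by (simp add: orthogonal_transformation_def linear_conv_bounded_linear)
  then show ?thesis
    using w bounded_linear.has_vector_derivative[of f]
    unfolding normal_derivative_def smooth_curve_in_congruent[OF f] by (simp add: o_def)
qed

lemma orientation_congruent:
  fixes f :: "'a::euclidean_space \<Rightarrow> 'a"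
  assumes f: "orthogonal_transformation f" and N: "orientation M N"
  shows "orientation ((\<lambda>x. c + f x) ` M) (\<lambda>y. f (N (inv f (y - c))))"
proof -
  note inv = orthogonal_transformation_inverse[OF f]
  have bl: "bounded_linear f" "bounded_linear (inv f)" using f orthogonal_transformation_inv[OF f]
    by (simp_all add: orthogonal_transformation_def linear_conv_bounded_linear)
  have "continuous_on ((\<lambda>x. c + f x) ` M) (\<lambda>y. f (N (inv f (y - c))))"
  proof (rule bounded_linear.continuous_on[OF bl(1)], rule continuous_on_compose2[of M N])
    show "continuous_on M N" using N by (simp add: orientation_def)
    show "continuous_on ((\<lambda>x. c + f x) ` M) (\<lambda>y. inv f (y - c))"
      by (intro bounded_linear.continuous_on[OF bl(2)] continuous_intros)
    show "(\<lambda>y. inv f (y - c)) ` (\<lambda>x. c + f x) ` M \<subseteq> M" using inv by auto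
  qed
  moreover have "norm (f (N p)) = 1 \<and> (\<forall>v\<in>tangent_space ((\<lambda>x. c + f x) ` M) (c + f p). f (N p) \<bullet> v = 0)"
    if "p \<in> M" for p
  proof -
    have "f x \<bullet> f y = x \<bullet> y" for x y using f by (simp add: orthogonal_transformation_def)
    then show ?thesis
      using N that orthogonal_transformation_norm[OF f, of "N p"]
      unfolding tangent_space_congruent[OF f] by (simp add: orientation_def)
  qed
  ultimately show ?thesis unfolding orientation_def by (simp add: inv)
qed

text \<open>
  A congruence maps curves, tangent spaces and normal fields to one another, hence conjugates the shape operator.
  So the lists of principal curvatures at corresponding points are the same.
\<close>

lemma S_curvature_congruent:
  fixes f :: "'a::euclidean_space \<Rightarrow> 'a"
  assumes f: "orthogonal_transformation f"
    and ex: "\<And>v. v \<in> tangent_space M p \<Longrightarrow> \<exists>w. normal_derivative M N p v w"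
  shows "S_curvature r ((\<lambda>x. c + f x) ` M) (\<lambda>y. f (N (inv f (y - c)))) (c + f p) = S_curvature r M N p"
proof -
  let ?M = "(\<lambda>x. c + f x) ` M" and ?N = "\<lambda>y. f (N (inv f (y - c)))" and ?p = "c + f p"
  have lin: "linear f" and inj: "inj f"
    using f bij_is_inj[OF orthogonal_transformation_bij[OF f]] by (simp_all add: orthogonal_transformation_def)
  have tan: "tangent_space ?M ?p = f ` tangent_space M p"
    by (rule tangent_space_congruent[OF f])
  have shape: "shape_operator ?M ?N ?p (f v) = f (shape_operator M N p v)" if v: "v \<in> tangent_space M p" for v
  proof -
    obtain w where w: "normal_derivative M N p v w" using ex[OF v] by blast
    have "f v \<in> tangent_space ?M ?p" using v tan by simp
    from shape_operator_eq[OF normal_derivative_congruent[OF f w] this] shape_operator_eq[OF w v]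
    show ?thesis using lin by (simp add: linear_neg)
  qed
  have dim: "dim (f ` V) = dim V" for V
    using lin inj by (intro dim_image_eq) (auto simp: inj_on_def)
  have "{v \<in> tangent_space ?M ?p. shape_operator ?M ?N ?p v = k *\<^sub>R v} =
      f ` {v \<in> tangent_space M p. shape_operator M N p v = k *\<^sub>R v}" for k
    using shape inj lin unfolding tan by (auto simp: linear_scale[symmetric] inj_eq)
  then have "principal_curvatures ?M ?N ?p = principal_curvatures M N p"
    unfolding principal_curvatures_def fun_eq_iff by (simp add: dim tan)
  then show ?thesis unfolding S_curvature_def by (simp add: dim tan)
qed

section \<open>Curvature of graphs of separated sums\<close>

text \<open>
  Indexing the functions by the type \<open>'n\<close> itself keeps the numbering of the coordinates out of the differential geometry.
\<close>

locale separable_graph =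
  fixes \<phi> :: "'n::finite \<Rightarrow> real \<Rightarrow> real" and I :: "'n \<Rightarrow> real set"
  assumes interval: "\<And>j. open_interval (I j)" and smooth: "\<And>j. smooth_on (I j) (\<phi> j)"
begin

definition base :: "(real ^ 'n) set" where "base = {x. \<forall>j. x $ j \<in> I j}"
definition F :: "real ^ 'n \<Rightarrow> real" where "F x = (\<Sum>j\<in>UNIV. \<phi> j (x $ j))"
definition d1 :: "'n \<Rightarrow> real \<Rightarrow> real" where "d1 j = higher_deriv 1 (\<phi> j)"
definition d2 :: "'n \<Rightarrow> real \<Rightarrow> real" where "d2 j = higher_deriv 2 (\<phi> j)"
definition grad :: "real ^ 'n \<Rightarrow> real ^ 'n" where "grad x = (\<chi> j. d1 j (x $ j))"
definition hess :: "real ^ 'n \<Rightarrow> real ^ 'n \<Rightarrow> real ^ 'n" where "hess x h = (\<chi> j. d2 j (x $ j) * h $ j)"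
definition W :: "real ^ 'n \<Rightarrow> real" where "W x = sqrt (1 + grad x \<bullet> grad x)"
text \<open>
  The upward unit normal over a point of the base.
\<close>

definition \<nu> :: "real ^ 'n \<Rightarrow> (real ^ 'n) \<times> real" where "\<nu> x = inverse (W x) *\<^sub>R (- grad x, 1)"
definition d\<nu> :: "real ^ 'n \<Rightarrow> real ^ 'n \<Rightarrow> (real ^ 'n) \<times> real" where
  "d\<nu> x h = inverse (W x) *\<^sub>R (- hess x h, 0) - ((grad x \<bullet> hess x h) * inverse (W x ^ 3)) *\<^sub>R (- grad x, 1)"
abbreviation M :: "((real ^ 'n) \<times> real) set" where "M \<equiv> graph_over base F"
definition T :: "real ^ 'n \<Rightarrow> ((real ^ 'n) \<times> real) set" where "T x = (\<lambda>h. (h, grad x \<bullet> h)) ` UNIV"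

lemma has_deriv_1: "t \<in> I j \<Longrightarrow> (\<phi> j has_real_derivative d1 j t) (at t)"
  and has_deriv_2: "t \<in> I j \<Longrightarrow> (d1 j has_real_derivative d2 j t) (at t)"
  using smooth_on_has_vector_derivative[OF smooth, of t j 0] smooth_on_has_vector_derivative[OF smooth, of t j 1]
  by (simp_all add: has_real_derivative_iff_has_vector_derivative d1_def d2_def numeral_2_eq_2)

lemma open_base: "open base"
proof -
  have "base = (\<Inter>j. (\<lambda>x. x $ j) -` I j)" by (auto simp: base_def)
  moreover have "open ((\<lambda>x::real^'n. x $ j) -` I j)" for j
    using interval by (intro open_vimage_vec_nth) (simp add: open_interval_def)
  ultimately show ?thesis by auto
qed

lemma connected_base: "connected base"
proof -
  have "convex (I j)" for j using interval by (simp add: open_interval_def is_interval_convex)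
  then have "convex base"
    unfolding convex_def base_def by simp
  then show ?thesis by (rule convex_connected)
qed

lemma F_has_derivative: "x \<in> base \<Longrightarrow> (F has_derivative (\<lambda>h. grad x \<bullet> h)) (at x)"
proof -
  assume x: "x \<in> base"
  have "((\<lambda>x. \<phi> j (x $ j)) has_derivative (\<lambda>h. d1 j (x $ j) * h $ j)) (at x)" for j
  proof -
    have "(\<phi> j has_derivative (*) (d1 j (x $ j))) (at (x $ j))"
      using x has_deriv_1 by (simp add: base_def has_field_derivative_def)
    from has_derivative_compose[OF bounded_linear_imp_has_derivative[OF bounded_linear_vec_nth] this]
    show ?thesis .
  qed
  then have "(F has_derivative (\<lambda>h. \<Sum>j\<in>UNIV. d1 j (x $ j) * h $ j)) (at x)"
    unfolding F_def by (intro has_derivative_sum) auto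
  then show ?thesis by (simp add: grad_def inner_vec_def)
qed

lemma grad_has_derivative: "x \<in> base \<Longrightarrow> (grad has_derivative hess x) (at x)"
proof -
  assume x: "x \<in> base"
  have "((\<lambda>y. d1 j (y $ j)) has_derivative (\<lambda>h. d2 j (x $ j) * h $ j)) (at x)" for j
  proof -
    have "(d1 j has_derivative (*) (d2 j (x $ j))) (at (x $ j))"
      using x has_deriv_2 by (simp add: base_def has_field_derivative_def)
    from has_derivative_compose[OF bounded_linear_imp_has_derivative[OF bounded_linear_vec_nth] this]
    show ?thesis .
  qed
  then show ?thesis
    by (subst has_derivative_componentwise_within)
      (auto simp: Basis_vec_def inner_axis grad_def hess_def)
qed

lemma W_pos: "W x > 0" and W_sq: "(W x)\<^sup>2 = 1 + grad x \<bullet> grad x"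
  using inner_ge_zero[of "grad x"] by (simp_all add: W_def add_pos_nonneg)

lemma linear_hess: "linear (hess x)"
  by (auto simp: linear_iff hess_def vec_eq_iff algebra_simps)

lemma \<nu>_has_derivative:
  assumes x: "x \<in> base"
  shows "(\<nu> has_derivative d\<nu> x) (at x)"
proof -
  note g = grad_has_derivative[OF x]
  have pos: "1 + grad x \<bullet> grad x > 0"
    using inner_ge_zero[of "grad x"] by linarith
  have "((\<lambda>x. 1 + grad x \<bullet> grad x) has_derivative (\<lambda>h. 2 * (grad x \<bullet> hess x h))) (at x)"
    using has_derivative_add[OF has_derivative_const[of 1] has_derivative_inner[OF g g]]
    by (simp add: inner_commute)
  from DERIV_compose_FDERIV[OF DERIV_real_sqrt[OF pos] this]
  have "(W has_derivative (\<lambda>h. (grad x \<bullet> hess x h) * inverse (W x))) (at x)"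
    unfolding W_def[abs_def] by (simp add: field_simps)
  from Deriv.has_derivative_inverse[OF _ this] have
    "((\<lambda>x. inverse (W x)) has_derivative (\<lambda>h. - (inverse (W x) * ((grad x \<bullet> hess x h) * inverse (W x)) * inverse (W x)))) (at x)"
    using W_pos[of x] by simp
  from has_derivative_scaleR[OF this has_derivative_Pair[OF has_derivative_minus[OF g] has_derivative_const[of "1::real"]]]
  show ?thesis unfolding \<nu>_def[abs_def] d\<nu>_def[abs_def]
    by (simp add: power3_eq_cube mult_ac)
qed

lemma subspace_T: "subspace (T x)"
  unfolding T_def
  by (rule linear_subspace_image) (auto simp: linear_iff inner_add_right)

lemma dim_T: "dim (T x) = CARD('n)"
proof -
  have "dim (T x) = dim (UNIV :: (real^'n) set)"
    unfolding T_def by (rule dim_image_eq) (auto simp: linear_iff inner_add_right inj_on_def)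
  then show ?thesis by simp
qed

lemma curve_in_base:
  assumes "smooth_curve_in M p v \<gamma>"
  obtains \<epsilon> where "\<epsilon> > 0" "\<And>t. t \<in> {-\<epsilon><..<\<epsilon>} \<Longrightarrow> fst (\<gamma> t) \<in> base \<and> \<gamma> t = (fst (\<gamma> t), F (fst (\<gamma> t)))"
proof -
  obtain \<epsilon> where \<epsilon>: "\<epsilon> > 0" "\<gamma> ` {-\<epsilon><..<\<epsilon>} \<subseteq> M"
    using assms by (auto simp: smooth_curve_in_def)
  have "fst (\<gamma> t) \<in> base \<and> \<gamma> t = (fst (\<gamma> t), F (fst (\<gamma> t)))" if "t \<in> {-\<epsilon><..<\<epsilon>}" for t
  proof -
    have "\<gamma> t \<in> M" using \<epsilon>(2) that by blast
    then show ?thesis by (auto simp: graph_over_def)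
  qed
  then show ?thesis using \<epsilon>(1) that by blast
qed

lemma curve_fst_derivative:
  assumes "smooth_curve_in M p v \<gamma>"
  shows "((\<lambda>t. fst (\<gamma> t)) has_vector_derivative fst v) (at 0)"
  using assms bounded_linear.has_vector_derivative[OF bounded_linear_fst, of \<gamma> v "at 0"]
  by (simp add: smooth_curve_in_def)

lemma has_vector_derivative_along_curve:
  assumes g: "(g has_derivative g') (at x)" and \<gamma>: "smooth_curve_in M (x, F x) v \<gamma>"
  shows "((\<lambda>t. g (fst (\<gamma> t))) has_vector_derivative g' (fst v)) (at 0)"
proof -
  have "fst (\<gamma> 0) = x" using \<gamma> by (simp add: smooth_curve_in_def)
  then have g0: "(g has_derivative g') (at (fst (\<gamma> 0)))" using g by simp
  have "((\<lambda>t. fst (\<gamma> t)) has_derivative (\<lambda>s. s *\<^sub>R fst v)) (at 0)"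
    using curve_fst_derivative[OF \<gamma>] by (simp add: has_vector_derivative_def)
  from has_derivative_compose[OF this g0]
  have "((\<lambda>t. g (fst (\<gamma> t))) has_derivative (\<lambda>s. g' (s *\<^sub>R fst v))) (at 0)" .
  moreover have "g' (s *\<^sub>R w) = s *\<^sub>R g' w" for s w
    using has_derivative_linear[OF g] by (simp add: linear_scale)
  ultimately show ?thesis by (simp add: has_vector_derivative_def)
qed

text \<open>
  Lifting straight lines realises every vector \<open>(h, grad x \<bullet> h)\<close> as the velocity of a curve in the graph.
\<close>

lemma smooth_curve_line:
  assumes x: "x \<in> base"
  shows "smooth_curve_in M (x, F x) (h, grad x \<bullet> h) (\<lambda>t. (x + t *\<^sub>R h, F (x + t *\<^sub>R h)))"
proof -
  have "open ((\<lambda>t::real. x + t *\<^sub>R h) -` base)"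
    by (intro open_vimage open_base continuous_intros)
  moreover have "0 \<in> (\<lambda>t::real. x + t *\<^sub>R h) -` base" using x by simp
  ultimately obtain \<epsilon> where \<epsilon>: "\<epsilon> > 0" "ball 0 \<epsilon> \<subseteq> (\<lambda>t::real. x + t *\<^sub>R h) -` base"
    using open_contains_ball by blast
  have ball: "ball 0 \<epsilon> = {-\<epsilon><..<\<epsilon>}" by (simp add: ball_eq_greaterThanLessThan)
  have base: "x + t *\<^sub>R h \<in> base" if "t \<in> {-\<epsilon><..<\<epsilon>}" for t
    using \<epsilon>(2) that unfolding ball by blast
  have "smooth_on {-\<epsilon><..<\<epsilon>} (\<lambda>t. (x + t *\<^sub>R h, F (x + t *\<^sub>R h)))"
  proof (intro smooth_on_Pair smooth_on_line)
    have "smooth_on {-\<epsilon><..<\<epsilon>} (\<lambda>t. \<phi> j (x $ j + h $ j * t))" for j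
    proof (rule smooth_on_affine_arg[of "I j"])
      show "open (I j)" "smooth_on (I j) (\<phi> j)" using interval smooth by (auto simp: open_interval_def)
      show "x $ j + h $ j * t \<in> I j" if "t \<in> {-\<epsilon><..<\<epsilon>}" for t
        using base[OF that] by (simp add: base_def mult.commute)
    qed auto
    then have "smooth_on {-\<epsilon><..<\<epsilon>} (\<lambda>t. \<Sum>j\<in>UNIV. \<phi> j (x $ j + h $ j * t))"
      by (intro smooth_on_sum) auto
    then show "smooth_on {-\<epsilon><..<\<epsilon>} (\<lambda>t. F (x + t *\<^sub>R h))"
      by (simp add: F_def mult.commute)
  qed auto
  moreover have "(\<lambda>t. (x + t *\<^sub>R h, F (x + t *\<^sub>R h))) ` {-\<epsilon><..<\<epsilon>} \<subseteq> M"
    using base by (auto simp: graph_over_def)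
  moreover have "((\<lambda>t. (x + t *\<^sub>R h, F (x + t *\<^sub>R h))) has_vector_derivative (h, grad x \<bullet> h)) (at 0)"
  proof (rule has_vector_derivative_Pair)
    show l: "((\<lambda>t. x + t *\<^sub>R h) has_vector_derivative h) (at 0)"
      by (auto intro!: derivative_eq_intros)
    then have l': "((\<lambda>t. x + t *\<^sub>R h) has_derivative (\<lambda>s. s *\<^sub>R h)) (at 0)"
      by (simp add: has_vector_derivative_def)
    have "(F has_derivative (\<lambda>h. grad x \<bullet> h)) (at (x + 0 *\<^sub>R h))"
      using F_has_derivative[OF x] by simp
    from has_derivative_compose[OF l' this]
    show "((\<lambda>t. F (x + t *\<^sub>R h)) has_vector_derivative grad x \<bullet> h) (at 0)"
      by (simp add: has_vector_derivative_def)
  qed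
  ultimately show ?thesis using \<epsilon>(1) by (auto simp: smooth_curve_in_def)
qed

lemma tangent_space_eq:
  assumes x: "x \<in> base"
  shows "tangent_space M (x, F x) = T x"
proof
  show "T x \<subseteq> tangent_space M (x, F x)"
    using smooth_curve_line[OF x] by (auto simp: T_def tangent_space_def)
  show "tangent_space M (x, F x) \<subseteq> T x"
  proof
    fix v assume "v \<in> tangent_space M (x, F x)"
    then obtain \<gamma> where \<gamma>: "smooth_curve_in M (x, F x) v \<gamma>" by (auto simp: tangent_space_def)
    obtain \<epsilon> where \<epsilon>: "\<epsilon> > 0" "\<And>t. t \<in> {-\<epsilon><..<\<epsilon>} \<Longrightarrow> fst (\<gamma> t) \<in> base \<and> \<gamma> t = (fst (\<gamma> t), F (fst (\<gamma> t)))"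
      using curve_in_base[OF \<gamma>] by blast
    have "((\<lambda>t. F (fst (\<gamma> t))) has_vector_derivative grad x \<bullet> fst v) (at 0)"
      by (rule has_vector_derivative_along_curve[OF F_has_derivative[OF x] \<gamma>])
    then have "((\<lambda>t. snd (\<gamma> t)) has_vector_derivative grad x \<bullet> fst v) (at 0)"
      by (rule has_vector_derivative_transform_within_open[of _ _ _ "{-\<epsilon><..<\<epsilon>}"])
        (use \<epsilon> in \<open>auto, metis snd_conv\<close>)
    moreover have "((\<lambda>t. snd (\<gamma> t)) has_vector_derivative snd v) (at 0)"
      using \<gamma> bounded_linear.has_vector_derivative[OF bounded_linear_snd, of \<gamma> v "at 0"]
      by (simp add: smooth_curve_in_def)
    ultimately have "snd v = grad x \<bullet> fst v"
      by (rule vector_derivative_unique_at[symmetric])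
    then show "v \<in> T x" by (auto simp: T_def intro!: image_eqI[of _ _ "fst v"] prod_eqI)
  qed
qed

text \<open>
  At each point the unit normal is determined up to sign, and on the connected base the sign cannot change.
\<close>

lemma orientation_eq:
  assumes N: "orientation M N"
  shows "\<exists>\<sigma>. \<sigma> \<noteq> 0 \<and> (\<forall>x\<in>base. N (x, F x) = \<sigma> *\<^sub>R \<nu> x)"
proof -
  define s where "s x = snd (N (x, F x))" for x
  have Nx: "N (x, F x) = s x *\<^sub>R (- grad x, 1) \<and> \<bar>s x\<bar> = inverse (W x)" if x: "x \<in> base" for x
  proof -
    let ?a = "fst (N (x, F x))"
    have M: "(x, F x) \<in> M" using x by (auto simp: graph_over_def)
    have "N (x, F x) \<bullet> (h, grad x \<bullet> h) = 0" for h
      using N M tangent_space_eq[OF x] by (auto simp: orientation_def T_def)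
    then have "(?a + s x *\<^sub>R grad x) \<bullet> h = 0" for h
      by (simp add: inner_prod_def s_def inner_add_left)
    then have "?a + s x *\<^sub>R grad x = 0" by (metis inner_eq_zero_iff)
    then have eq: "N (x, F x) = s x *\<^sub>R (- grad x, 1)"
      by (intro prod_eqI) (simp_all add: s_def eq_neg_iff_add_eq_0)
    have "norm (N (x, F x)) = 1" using N M by (simp add: orientation_def)
    then have "\<bar>s x\<bar> * W x = 1"
      unfolding eq norm_scaleR by (simp add: norm_eq_sqrt_inner[of "(- grad x, 1::real)"] W_def add.commute)
    then show ?thesis using eq W_pos[of x] by (simp add: field_simps)
  qed
  have "continuous_on base F"
    using F_has_derivative by (auto intro!: continuous_at_imp_continuous_on has_derivative_continuous)
  then have "continuous_on base (\<lambda>x. (x, F x))"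
    by (intro continuous_on_Pair continuous_on_id)
  moreover have "continuous_on M N" using N by (simp add: orientation_def)
  ultimately have "continuous_on base (\<lambda>x. N (x, F x))"
    by (intro continuous_on_compose2[of M N _ "\<lambda>x. (x, F x)"]) (simp_all add: graph_over_def)
  then have "continuous_on base s"
    unfolding s_def by (intro continuous_intros)
  then have conn: "connected (s ` base)" using connected_base by (rule connected_continuous_image)
  have "s x \<noteq> 0" if "x \<in> base" for x using Nx[OF that] W_pos[of x] by auto
  then have no0: "0 \<notin> s ` base" by auto
  have "\<exists>\<sigma>. \<sigma> \<noteq> 0 \<and> (\<forall>x\<in>base. s x = \<sigma> * inverse (W x))"
  proof (cases "\<exists>x\<in>base. s x < 0")
    case True
    then obtain x where x: "x \<in> base" "s x < 0" by blast
    have "s y < 0" if "y \<in> base" for y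
    proof (rule ccontr)
      assume "\<not> s y < 0"
      then have "0 \<in> {s x..s y}" using x by simp
      moreover have "{s x..s y} \<subseteq> s ` base"
        using conn x that by (intro connected_contains_Icc) auto
      ultimately show False using no0 by blast
    qed
    then have "\<forall>y\<in>base. s y = - 1 * inverse (W y)" using Nx by fastforce
    then show ?thesis by (intro exI[of _ "-1"]) auto
  next
    case False
    then have "\<forall>y\<in>base. s y = 1 * inverse (W y)" using Nx by fastforce
    then show ?thesis by (intro exI[of _ "1"]) auto
  qed
  then obtain \<sigma> where "\<sigma> \<noteq> 0" "\<forall>x\<in>base. s x = \<sigma> * inverse (W x)" by blast
  then show ?thesis using Nx by (intro exI[of _ \<sigma>]) (auto simp: \<nu>_def)
qed

lemma normal_derivative_graph:
  assumes x: "x \<in> base" and N: "\<forall>x\<in>base. N (x, F x) = \<sigma> *\<^sub>R \<nu> x"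
  shows "normal_derivative M N (x, F x) v (\<sigma> *\<^sub>R d\<nu> x (fst v))"
  unfolding normal_derivative_def
proof (intro allI impI)
  fix \<gamma> assume \<gamma>: "smooth_curve_in M (x, F x) v \<gamma>"
  obtain \<epsilon> where \<epsilon>: "\<epsilon> > 0" "\<And>t. t \<in> {-\<epsilon><..<\<epsilon>} \<Longrightarrow> fst (\<gamma> t) \<in> base \<and> \<gamma> t = (fst (\<gamma> t), F (fst (\<gamma> t)))"
    using curve_in_base[OF \<gamma>] by blast
  have "((\<lambda>t. \<sigma> *\<^sub>R \<nu> (fst (\<gamma> t))) has_vector_derivative \<sigma> *\<^sub>R d\<nu> x (fst v)) (at 0)"
    by (rule has_vector_derivative_along_curve[OF has_derivative_scaleR_right[OF \<nu>_has_derivative[OF x]] \<gamma>])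
  then show "((N \<circ> \<gamma>) has_vector_derivative \<sigma> *\<^sub>R d\<nu> x (fst v)) (at 0)"
    by (rule has_vector_derivative_transform_within_open[of _ _ _ "{-\<epsilon><..<\<epsilon>}"])
      (use \<epsilon> N in \<open>auto, metis\<close>)
qed

text \<open>
  The derivative of a unit field is orthogonal to it, hence tangent; here checked by computation.
\<close>

lemma d\<nu>_in_T: "d\<nu> x h \<in> T x"
proof -
  have "snd (d\<nu> x h) = grad x \<bullet> fst (d\<nu> x h)"
  proof -
    let ?g = "grad x \<bullet> hess x h" and ?w = "W x"
    have "grad x \<bullet> fst (d\<nu> x h) = - (inverse ?w * ?g) + ?g * inverse (?w ^ 3) * (grad x \<bullet> grad x)"
      by (simp add: d\<nu>_def inner_add_right inner_diff_right)
    also have "grad x \<bullet> grad x = ?w\<^sup>2 - 1" by (simp add: W_sq)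
    also have "- (inverse ?w * ?g) + ?g * inverse (?w ^ 3) * (?w\<^sup>2 - 1) = - (?g * inverse (?w ^ 3))"
      using W_pos[of x] by (simp add: field_simps power2_eq_square power3_eq_cube)
    also have "\<dots> = snd (d\<nu> x h)" by (simp add: d\<nu>_def)
    finally show ?thesis by simp
  qed
  then show ?thesis by (auto simp: T_def intro!: image_eqI[of _ _ "fst (d\<nu> x h)"] prod_eqI)
qed

lemma d\<nu>_inner_T: "u \<in> T x \<Longrightarrow> d\<nu> x h \<bullet> u = - inverse (W x) * (hess x h \<bullet> fst u)"
  by (auto simp: T_def d\<nu>_def inner_diff_left)

lemma hess_inner: "hess x h \<bullet> k = (\<Sum>j\<in>UNIV. d2 j (x $ j) * h $ j * k $ j)"
  by (simp add: hess_def inner_vec_def)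

text \<open>
  Write the metric of the graph as \<open>G = 1 + g g\<^sup>T\<close> with \<open>g\<close> the gradient, and let \<open>H\<close> be the diagonal matrix of second
  derivatives.  If the columns of \<open>P\<close> are the base components of an orthonormal eigenbasis of the shape operator, then
  \<open>P\<^sup>T G P = 1\<close> and \<open>P\<^sup>T (\<tau> H) P\<close> is the diagonal matrix of principal curvatures.  Hence the product of the
  \<open>1 + t \<kappa> i\<close> is \<open>det P ^ 2 * det (G + t \<tau> H)\<close>, a diagonal matrix plus one of rank one.
\<close>

lemma curvature_generating_function:
  assumes x: "x \<in> base" and N: "orientation M N"
  shows "\<exists>\<kappa> \<delta> \<tau>. \<delta> \<noteq> 0 \<and> \<tau> \<noteq> 0 \<and>
    (\<forall>r. S_curvature r M N (x, F x) = esym r \<kappa> {1..CARD('n)}) \<and>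
    (\<forall>t. (\<Prod>i=1..CARD('n). 1 + t * \<kappa> i) = \<delta> * ((\<Prod>j\<in>UNIV. 1 + t * (\<tau> * d2 j (x $ j))) +
       (\<Sum>k\<in>UNIV. (d1 k (x $ k))\<^sup>2 * (\<Prod>j\<in>UNIV - {k}. 1 + t * (\<tau> * d2 j (x $ j))))))"
proof -
  obtain \<sigma> where \<sigma>: "\<sigma> \<noteq> 0" "\<forall>x\<in>base. N (x, F x) = \<sigma> *\<^sub>R \<nu> x"
    using orientation_eq[OF N] by blast
  define L where "L v = - (\<sigma> *\<^sub>R d\<nu> x (fst v))" for v :: "(real^'n) \<times> real"
  \<comment> \<open>The second fundamental form in base coordinates is \<open>\<tau>\<close> times the Hessian.\<close>
  define \<tau> where "\<tau> = \<sigma> * inverse (W x)"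
  have \<tau>: "\<tau> \<noteq> 0" using \<sigma> W_pos[of x] by (simp add: \<tau>_def)
  have shape: "shape_operator M N (x, F x) v = L v" if "v \<in> T x" for v
    using shape_operator_eq[OF normal_derivative_graph[OF x \<sigma>(2)], of v] that tangent_space_eq[OF x]
    by (simp add: L_def)
  have linL: "linear L"
    using linear_add[OF linear_hess[of x]] linear_scale[OF linear_hess[of x]]
    by (auto simp: linear_iff L_def d\<nu>_def inner_add_right algebra_simps)
  have L_T: "L v \<in> T x" for v
    unfolding L_def by (intro subspace_neg subspace_scale subspace_T d\<nu>_in_T)
  have L_inner: "L v \<bullet> u = \<tau> * (\<Sum>j\<in>UNIV. d2 j (x $ j) * fst v $ j * fst u $ j)" if "u \<in> T x" for v u
    using d\<nu>_inner_T[OF that, of "fst v"] by (simp add: L_def \<tau>_def hess_inner)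
  have sa: "L v \<bullet> w = v \<bullet> L w" if "v \<in> T x" "w \<in> T x" for v w
    using L_inner[OF that(1), of w] L_inner[OF that(2), of v]
    by (simp add: inner_commute[of v] mult_ac)
  obtain B \<mu> where B: "B \<subseteq> T x" "pairwise orthogonal B" "\<forall>b\<in>B. norm b = 1 \<and> L b = \<mu> b *\<^sub>R b" "span B = T x"
    using self_adjoint_eigenbasis[OF linL subspace_T L_T sa] by blast
  have finB: "finite B" and cardB: "card B = CARD('n)"
    using orthonormal_set[OF B(2)] B(3,4) dim_T[of x] by auto
  have eig: "dim {v \<in> T x. shape_operator M N (x, F x) v = c *\<^sub>R v} = card {b \<in> B. \<mu> b = c}" for c
  proof -
    have "{v \<in> T x. shape_operator M N (x, F x) v = c *\<^sub>R v} = {v \<in> span B. L v = c *\<^sub>R v}"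
      using shape B(4) by auto
    also have "dim \<dots> = card {b \<in> B. \<mu> b = c}"
      by (rule dim_eigenspace) (use B linL sa in auto)
    finally show ?thesis .
  qed
  have pc: "principal_curvatures M N (x, F x) \<kappa> \<longleftrightarrow> (\<forall>c. card {i \<in> {1..CARD('n)}. \<kappa> i = c} = card {b \<in> B. \<mu> b = c})" for \<kappa>
    unfolding principal_curvatures_def tangent_space_eq[OF x] dim_T eig ..
  define \<kappa> where "\<kappa> = (SOME \<kappa>. principal_curvatures M N (x, F x) \<kappa>)"
  obtain en where en: "bij_betw en {1..CARD('n)} B"
    using finite_same_card_bij[OF _ finB, of "{1..CARD('n)}"] cardB by auto
  have "principal_curvatures M N (x, F x) (\<lambda>i. \<mu> (en i))"
    unfolding pc
  proof
    fix c
    have "bij_betw en {i \<in> {1..CARD('n)}. \<mu> (en i) = c} {b \<in> B. \<mu> b = c}"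
      by (rule bij_betw_subset[OF en]) (use bij_betw_imp_surj_on[OF en] in auto)
    then show "card {i \<in> {1..CARD('n)}. \<mu> (en i) = c} = card {b \<in> B. \<mu> b = c}"
      by (rule bij_betw_same_card)
  qed
  then have "principal_curvatures M N (x, F x) \<kappa>" 
    unfolding \<kappa>_def by (rule someI[where P = "principal_curvatures M N (x, F x)"])
  then have prod_\<kappa>: "(\<Prod>i=1..CARD('n). 1 + t * \<kappa> i) = (\<Prod>b\<in>B. 1 + t * \<mu> b)" for t
    using prod_eq_if_fibers_eq[of "{1..CARD('n)}" B \<kappa> \<mu> "\<lambda>c. 1 + t * c"] finB unfolding pc by auto
  obtain bb :: "'n \<Rightarrow> (real^'n) \<times> real" where bb: "bij_betw bb UNIV B"
    using finite_same_card_bij[OF _ finB, of "UNIV::'n set"] cardB by auto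
  have bbB: "bb j \<in> B" for j using bb by (auto simp: bij_betw_def)
  then have bbT: "bb j \<in> T x" for j using B(1) by blast
  have bb_inner: "bb i \<bullet> bb j = (if i = j then 1 else 0)" for i j
  proof (cases "i = j")
    case True
    then show ?thesis using B(3) bbB[of j] by (simp add: dot_square_norm)
  next
    case False
    then have "bb i \<noteq> bb j" using bb by (auto simp: bij_betw_def inj_on_def)
    then show ?thesis using False B(2) bbB by (auto simp: pairwise_def orthogonal_def)
  qed
  define P where "P = (\<chi> i j. fst (bb j) $ i)"
  \<comment> \<open>The matrix \<open>G + t \<tau> H\<close>.\<close>
  define Q where "Q t = (\<chi> i j. (if i = j then 1 + t * (\<tau> * d2 i (x $ i)) else 0) + d1 i (x $ i) * d1 j (x $ j))" for t
  have entry: "(transpose P ** (Q t ** P)) $ i $ j = (if i = j then 1 + t * \<mu> (bb i) else 0)" for t i j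
  proof -
    let ?a = "fst (bb i)" and ?b = "fst (bb j)"
    have snd_eq: "snd (bb k) = grad x \<bullet> fst (bb k)" for k using bbT[of k] by (auto simp: T_def)
    have "(transpose P ** (Q t ** P)) $ i $ j =
       (\<Sum>k\<in>UNIV. ?a $ k * (\<Sum>l\<in>UNIV. ((if k = l then 1 + t * (\<tau> * d2 k (x $ k)) else 0) + grad x $ k * grad x $ l) * ?b $ l))"
      by (simp add: matrix_matrix_mult_def transpose_def P_def Q_def grad_def)
    also have "\<dots> = (\<Sum>k\<in>UNIV. ?a $ k * ((1 + t * (\<tau> * d2 k (x $ k))) * ?b $ k + grad x $ k * (grad x \<bullet> ?b)))"
    proof (intro sum.cong refl arg_cong2[where f = "(*)"])
      fix k
      have "(\<Sum>l\<in>UNIV. ((if k = l then 1 + t * (\<tau> * d2 k (x $ k)) else 0) + grad x $ k * grad x $ l) * ?b $ l)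
         = (\<Sum>l\<in>UNIV. (if k = l then (1 + t * (\<tau> * d2 k (x $ k))) * ?b $ l else 0) + grad x $ k * (grad x $ l * ?b $ l))"
        by (intro sum.cong refl) (auto simp: algebra_simps)
      also have "\<dots> = (1 + t * (\<tau> * d2 k (x $ k))) * ?b $ k + grad x $ k * (grad x \<bullet> ?b)"
        by (simp add: sum.distrib inner_vec_def sum_distrib_left)
      finally show "(\<Sum>l\<in>UNIV. ((if k = l then 1 + t * (\<tau> * d2 k (x $ k)) else 0) + grad x $ k * grad x $ l) * ?b $ l)
         = (1 + t * (\<tau> * d2 k (x $ k))) * ?b $ k + grad x $ k * (grad x \<bullet> ?b)" .
    qed
    also have "\<dots> = (\<Sum>k\<in>UNIV. ?a $ k * ?b $ k) + (\<Sum>k\<in>UNIV. grad x $ k * ?a $ k) * (grad x \<bullet> ?b)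
        + t * (\<tau> * (\<Sum>k\<in>UNIV. d2 k (x $ k) * ?a $ k * ?b $ k))"
      by (simp add: algebra_simps sum.distrib sum_distrib_left sum_distrib_right)
    also have "(\<Sum>k\<in>UNIV. ?a $ k * ?b $ k) = ?a \<bullet> ?b" by (simp add: inner_vec_def)
    also have "(\<Sum>k\<in>UNIV. grad x $ k * ?a $ k) = grad x \<bullet> ?a" by (simp add: inner_vec_def)
    also have "\<tau> * (\<Sum>k\<in>UNIV. d2 k (x $ k) * ?a $ k * ?b $ k) = L (bb i) \<bullet> bb j"
      using L_inner[OF bbT] by simp
    also have "L (bb i) = \<mu> (bb i) *\<^sub>R bb i" using B(3) bbB by blast
    also have "?a \<bullet> ?b + (grad x \<bullet> ?a) * (grad x \<bullet> ?b) = bb i \<bullet> bb j"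
      by (simp add: inner_prod_def snd_eq)
    finally show ?thesis by (simp add: bb_inner)
  qed
  have "det (transpose P ** (Q t ** P)) = (\<Prod>b\<in>B. 1 + t * \<mu> b)" for t
  proof -
    have "det (transpose P ** (Q t ** P)) = (\<Prod>i\<in>UNIV. (transpose P ** (Q t ** P)) $ i $ i)"
      by (rule det_diagonal) (simp add: entry)
    also have "\<dots> = (\<Prod>i\<in>UNIV. 1 + t * \<mu> (bb i))" by (simp add: entry)
    also have "\<dots> = (\<Prod>b\<in>B. 1 + t * \<mu> b)" using prod.reindex_bij_betw[OF bb] .
    finally show ?thesis .
  qed
  then have det: "(det P)\<^sup>2 * det (Q t) = (\<Prod>b\<in>B. 1 + t * \<mu> b)" for t
    by (simp add: det_mul det_transpose power2_eq_square mult_ac)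
  have "(det P)\<^sup>2 \<noteq> 0" using det[of 0] by auto
  moreover have "S_curvature r M N (x, F x) = esym r \<kappa> {1..CARD('n)}" for r
    unfolding S_curvature_def \<kappa>_def tangent_space_eq[OF x] dim_T ..
  moreover have "(\<Prod>i=1..CARD('n). 1 + t * \<kappa> i) = (det P)\<^sup>2 * ((\<Prod>j\<in>UNIV. 1 + t * (\<tau> * d2 j (x $ j))) +
       (\<Sum>k\<in>UNIV. (d1 k (x $ k))\<^sup>2 * (\<Prod>j\<in>UNIV - {k}. 1 + t * (\<tau> * d2 j (x $ j)))))" for t
    unfolding prod_\<kappa> det[symmetric] Q_def det_diagonal_plus_rank_one by (simp add: power2_eq_square)
  ultimately show ?thesis using \<tau> by blast
qed

end

section \<open>Profiles for which the numerator vanishes\<close>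

lemma open_intervalD: "open_interval J \<Longrightarrow> open J" "open_interval J \<Longrightarrow> convex J" "open_interval J \<Longrightarrow> J \<noteq> {}"
  by (auto simp: open_interval_def is_interval_convex)

lemma DERIV_zero_on_open_interval:
  fixes f :: "real \<Rightarrow> real"
  assumes "open_interval J" "\<And>t. t \<in> J \<Longrightarrow> (f has_real_derivative 0) (at t)"
  shows "\<exists>c. \<forall>t\<in>J. f t = c"
  using has_field_derivative_zero_constant[of J f] open_intervalD[OF assms(1)] assms(2)
  by (metis has_field_derivative_at_within)

text \<open>
  For \<open>r + 1\<close> functions that satisfy a Riccati equation \<open>h = c (\<beta> + v)\<close>, and have
  all \<open>h i\<close> nonzero, the numerator therefore vanishes exactly if the \<open>1 / c i\<close> sum to zero.
\<close>

lemma curv_num_riccati: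
  assumes "finite K" "card K = Suc r" "\<And>i. i \<in> K \<Longrightarrow> c i \<noteq> 0"
    and "\<And>i. i \<in> K \<Longrightarrow> h i = c i * (\<beta> + v i)"
  shows "curv_num r h v K \<beta> = (\<Prod>i\<in>K. c i * (\<beta> + v i)) * (\<Sum>m\<in>K. 1 / c m)"
proof -
  have "(\<beta> + v m) * (\<Prod>i\<in>K - {m}. h i) = (\<Prod>i\<in>K. c i * (\<beta> + v i)) * (1 / c m)" if m: "m \<in> K" for m
  proof -
    have "(\<Prod>i\<in>K - {m}. h i) = (\<Prod>i\<in>K - {m}. c i * (\<beta> + v i))"
      using assms(4) by (intro prod.cong) auto
    moreover have "(\<Prod>i\<in>K. c i * (\<beta> + v i)) = c m * (\<beta> + v m) * (\<Prod>i\<in>K - {m}. c i * (\<beta> + v i))"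
      using assms(1) m by (rule prod.remove)
    ultimately show ?thesis using assms(3)[OF m] by simp
  qed
  then show ?thesis
    unfolding curv_num_card_pred[OF assms(1,2)] sum_distrib_left by (intro sum.cong) auto
qed

text \<open>
  Here \<open>d1 i\<close> and \<open>d2 i\<close> are the first and second derivatives of the profile \<open>f i\<close>, and \<open>K\<close> collects the
  profiles that are not affine.  The others contribute only the constant \<open>\<beta> = 1 + \<Sum> (a m)^2\<close>.
  With \<open>r\<close> indices in \<open>K\<close> the numerator is \<open>\<beta>\<close> times a product of second derivatives, which is nonzero somewhere.
  With \<open>r + 1\<close> of them, freezing all variables but one at points of nonzero second derivative leaves the equation
  \<open>f'' = c (\<beta> + f'^2)\<close>.  More are impossible by \<open>curv_num_line_nonzero\<close>: two points of each curve
  \<open>(f'', f'^2)\<close> already span a suitable line.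
\<close>

lemma curv_num_zero_classification:
  fixes d1 d2 :: "nat \<Rightarrow> real \<Rightarrow> real" and J :: "nat \<Rightarrow> real set"
  assumes A: "finite A" and J: "\<And>i. i \<in> A \<Longrightarrow> open_interval (J i)"
    and d: "\<And>i t. i \<in> A \<Longrightarrow> t \<in> J i \<Longrightarrow> (d1 i has_real_derivative d2 i t) (at t)"
    and zero: "\<And>x. (\<And>i. i \<in> A \<Longrightarrow> x i \<in> J i) \<Longrightarrow>
      curv_num r (\<lambda>i. d2 i (x i)) (\<lambda>i. (d1 i (x i))\<^sup>2) A 1 = 0"
  defines "K \<equiv> {i \<in> A. \<exists>t\<in>J i. d2 i t \<noteq> 0}"
  shows "\<exists>a. (\<forall>i\<in>A - K. \<forall>t\<in>J i. d1 i t = a i) \<and>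
    (card K < r \<or> card K = Suc r \<and>
      (\<exists>c. (\<forall>i\<in>K. c i \<noteq> 0 \<and> (\<forall>t\<in>J i. d2 i t = c i * (1 + (\<Sum>m\<in>A - K. (a m)\<^sup>2) + (d1 i t)\<^sup>2))) \<and>
        (\<Sum>i\<in>K. 1 / c i) = 0))"
proof -
  have KA: "K \<subseteq> A" and finK: "finite K" using A by (auto simp: K_def)
  have "\<exists>a. \<forall>t\<in>J i. d1 i t = a" if i: "i \<in> A - K" for i
  proof (rule DERIV_zero_on_open_interval)
    show "open_interval (J i)" using J i by auto
    show "(d1 i has_real_derivative 0) (at t)" if "t \<in> J i" for t
      using d[of i t] i that by (auto simp: K_def)
  qed
  then obtain a where a: "\<forall>i\<in>A - K. \<forall>t\<in>J i. d1 i t = a i" by metis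
  define \<beta> where "\<beta> = 1 + (\<Sum>m\<in>A - K. (a m)\<^sup>2)"
  have \<beta>: "\<beta> > 0" unfolding \<beta>_def by (intro add_pos_nonneg sum_nonneg) auto
  have \<beta>v: "\<beta> + s\<^sup>2 > 0" for s using \<beta> by (intro add_pos_nonneg) auto
  have "\<exists>t. i \<in> A \<longrightarrow> t \<in> J i \<and> (i \<in> K \<longrightarrow> d2 i t \<noteq> 0)" for i
    using open_intervalD(3)[OF J, of i] by (auto simp: K_def)
  then obtain y where y: "\<And>i. i \<in> A \<Longrightarrow> y i \<in> J i" "\<And>i. i \<in> K \<Longrightarrow> d2 i (y i) \<noteq> 0"
    using KA by (metis subsetD)
  have zeroK: "curv_num r (\<lambda>i. d2 i (x i)) (\<lambda>i. (d1 i (x i))\<^sup>2) K \<beta> = 0"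
    if x: "\<And>i. i \<in> K \<Longrightarrow> x i \<in> J i" for x
  proof -
    define z where "z i = (if i \<in> K then x i else y i)" for i
    have z: "z i \<in> J i" if "i \<in> A" for i using x y that by (auto simp: z_def)
    have "0 = curv_num r (\<lambda>i. d2 i (z i)) (\<lambda>i. (d1 i (z i))\<^sup>2) A 1" using zero z by simp
    also have "\<dots> = curv_num r (\<lambda>i. d2 i (z i)) (\<lambda>i. (d1 i (z i))\<^sup>2) K (1 + (\<Sum>m\<in>A - K. (d1 m (z m))\<^sup>2))"
      using A KA z by (intro curv_num_drop_zeros) (auto simp: K_def)
    also have "(\<Sum>m\<in>A - K. (d1 m (z m))\<^sup>2) = (\<Sum>m\<in>A - K. (a m)\<^sup>2)"
      using a z by (intro sum.cong) auto
    also have "curv_num r (\<lambda>i. d2 i (z i)) (\<lambda>i. (d1 i (z i))\<^sup>2) K (1 + (\<Sum>m\<in>A - K. (a m)\<^sup>2))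
        = curv_num r (\<lambda>i. d2 i (x i)) (\<lambda>i. (d1 i (x i))\<^sup>2) K \<beta>"
      unfolding \<beta>_def by (rule curv_num_cong) (auto simp: z_def)
    finally show ?thesis by simp
  qed
  have "card K \<noteq> r"
  proof
    assume "card K = r"
    then have "\<beta> * (\<Prod>i\<in>K. d2 i (y i)) = 0"
      using zeroK[of y] y(1) KA curv_num_card[OF finK] by auto
    then show False using \<beta> y(2) finK by simp
  qed
  moreover have "\<not> r + 2 \<le> card K"
  proof
    assume "r + 2 \<le> card K"
    \<comment> \<open>The square of \<open>f'\<close> is not constant: otherwise \<open>f' f'' = 0\<close>, so \<open>f'\<close> vanishes where \<open>f''\<close> does not, and then
      everywhere, contradicting \<open>f'' \<noteq> 0\<close>.\<close>
    have "\<exists>t. i \<in> K \<longrightarrow> t \<in> J i \<and> (d1 i t)\<^sup>2 \<noteq> (d1 i (y i))\<^sup>2" for i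
    proof (rule ccontr)
      assume "\<not> ?thesis"
      then have i: "i \<in> K" and const: "\<And>t. t \<in> J i \<Longrightarrow> (d1 i t)\<^sup>2 = (d1 i (y i))\<^sup>2" by auto
      have iA: "i \<in> A" using i KA by auto
      note yi = y(1)[OF iA]
      have "((\<lambda>t. (d1 i t)\<^sup>2) has_real_derivative 2 * d1 i (y i) * d2 i (y i)) (at (y i))"
        using d[OF iA yi] by (auto intro!: derivative_eq_intros)
      moreover have "((\<lambda>t. (d1 i t)\<^sup>2) has_real_derivative 0) (at (y i))"
        by (rule has_field_derivative_transform_within_open[OF DERIV_const open_intervalD(1)[OF J[OF iA]] yi])
          (rule const[symmetric])
      ultimately have "2 * d1 i (y i) * d2 i (y i) = 0" by (rule DERIV_unique)
      then have "d1 i (y i) = 0" using y(2)[OF i] by simp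
      then have "d1 i t = 0" if "t \<in> J i" for t using const[OF that] by simp
      then have "(d1 i has_real_derivative 0) (at (y i))"
        by (intro has_field_derivative_transform_within_open[OF DERIV_const open_intervalD(1)[OF J[OF iA]] yi]) simp
      then show False using DERIV_unique[OF d[OF iA yi]] y(2)[OF i] by simp
    qed
    then obtain z where z: "\<And>i. i \<in> K \<Longrightarrow> z i \<in> J i" "\<And>i. i \<in> K \<Longrightarrow> (d1 i (z i))\<^sup>2 \<noteq> (d1 i (y i))\<^sup>2"
      by metis
    define u w where "u i = (d1 i (y i))\<^sup>2" and "w i = (d1 i (z i))\<^sup>2" for i
    \<comment> \<open>The line \<open>h = p + q v\<close> through two points of the curve, one of them with \<open>h \<noteq> 0\<close>, whence \<open>(p, q) \<noteq> (0, 0)\<close>.\<close>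
    define q where "q i = (d2 i (z i) - d2 i (y i)) / (w i - u i)" for i
    define p where "p i = d2 i (y i) - q i * u i" for i
    have uw: "u i \<noteq> w i" if "i \<in> K" for i using z(2)[OF that] by (simp add: u_def w_def)
    have at_u: "p i + q i * u i = d2 i (y i)" for i by (simp add: p_def)
    have at_w: "p i + q i * w i = d2 i (z i)" if "i \<in> K" for i
    proof -
      have "q i * (w i - u i) = d2 i (z i) - d2 i (y i)" using uw[OF that] by (simp add: q_def)
      then show ?thesis by (simp add: p_def algebra_simps)
    qed
    have "curv_num r (\<lambda>i. p i + q i * v i) v K \<beta> = 0" for v
    proof (rule curv_num_extend[OF finK uw])
      fix v assume v: "\<And>i. i \<in> K \<Longrightarrow> v i \<in> {u i, w i}"
      define x where "x i = (if v i = u i then y i else z i)" for i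
      have "curv_num r (\<lambda>i. p i + q i * v i) v K \<beta>
          = curv_num r (\<lambda>i. d2 i (x i)) (\<lambda>i. (d1 i (x i))\<^sup>2) K \<beta>"
      proof (rule curv_num_cong)
        fix i assume i: "i \<in> K"
        show "p i + q i * v i = d2 i (x i)" "v i = (d1 i (x i))\<^sup>2"
          using v[OF i] at_u at_w[OF i] uw[OF i] by (auto simp: x_def u_def w_def)
      qed
      also have "\<dots> = 0" using y(1) z(1) KA by (intro zeroK) (auto simp: x_def)
      finally show "curv_num r (\<lambda>i. p i + q i * v i) v K \<beta> = 0" .
    qed
    moreover have "p i \<noteq> 0 \<or> q i \<noteq> 0" if "i \<in> K" for i
      using at_u[of i] y(2)[OF that] by auto
    ultimately show False
      using curv_num_line_nonzero[OF finK \<open>r + 2 \<le> card K\<close>, of p q \<beta>] by blast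
  qed
  moreover have "\<exists>c. (\<forall>i\<in>K. c i \<noteq> 0 \<and> (\<forall>t\<in>J i. d2 i t = c i * (\<beta> + (d1 i t)\<^sup>2))) \<and> (\<Sum>i\<in>K. 1 / c i) = 0"
    if card: "card K = Suc r"
  proof -
    have "\<exists>c. c \<noteq> 0 \<and> (\<forall>t\<in>J m. d2 m t = c * (\<beta> + (d1 m t)\<^sup>2))" if m: "m \<in> K" for m
    proof -
      define P where "P = (\<Prod>i\<in>K - {m}. d2 i (y i))"
      define R where "R = (\<Sum>l\<in>K - {m}. (\<beta> + (d1 l (y l))\<^sup>2) * (\<Prod>i\<in>K - {l} - {m}. d2 i (y i)))"
      have P: "P \<noteq> 0" using y(2) finK by (simp add: P_def)
      have rel: "(\<beta> + (d1 m t)\<^sup>2) * P + d2 m t * R = 0" if t: "t \<in> J m" for t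
      proof -
        let ?x = "y(m := t)"
        have "0 = curv_num r (\<lambda>i. d2 i (?x i)) (\<lambda>i. (d1 i (?x i))\<^sup>2) K \<beta>"
          using y(1) KA t by (intro zeroK[symmetric]) auto
        also have "\<dots> = (\<Sum>l\<in>K. (\<beta> + (d1 l (?x l))\<^sup>2) * (\<Prod>i\<in>K - {l}. d2 i (?x i)))"
          by (rule curv_num_card_pred[OF finK card])
        also have "\<dots> = (\<beta> + (d1 m (?x m))\<^sup>2) * (\<Prod>i\<in>K - {m}. d2 i (?x i)) +
            (\<Sum>l\<in>K - {m}. (\<beta> + (d1 l (?x l))\<^sup>2) * (\<Prod>i\<in>K - {l}. d2 i (?x i)))"
          by (rule sum.remove[OF finK m])
        also have "(\<Prod>i\<in>K - {m}. d2 i (?x i)) = P"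
          unfolding P_def by (rule prod.cong) auto
        also have "(\<Sum>l\<in>K - {m}. (\<beta> + (d1 l (?x l))\<^sup>2) * (\<Prod>i\<in>K - {l}. d2 i (?x i))) = d2 m t * R"
          unfolding R_def sum_distrib_left
        proof (rule sum.cong[OF refl])
          fix l assume l: "l \<in> K - {m}"
          have "(\<Prod>i\<in>K - {l}. d2 i (?x i)) = d2 m t * (\<Prod>i\<in>K - {l} - {m}. d2 i (?x i))"
            using prod.remove[of "K - {l}" m "\<lambda>i. d2 i (?x i)"] finK m l by auto
          also have "(\<Prod>i\<in>K - {l} - {m}. d2 i (?x i)) = (\<Prod>i\<in>K - {l} - {m}. d2 i (y i))"
            by (rule prod.cong) auto
          finally show "(\<beta> + (d1 l (?x l))\<^sup>2) * (\<Prod>i\<in>K - {l}. d2 i (?x i))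
              = d2 m t * ((\<beta> + (d1 l (y l))\<^sup>2) * (\<Prod>i\<in>K - {l} - {m}. d2 i (y i)))"
            using l by simp
        qed
        finally show ?thesis by simp
      qed
      have mA: "m \<in> A" using m KA by auto
      have "R \<noteq> 0" using rel[OF y(1)[OF mA]] P \<beta>v[of "d1 m (y m)"] by auto
      then show ?thesis
        using P rel by (intro exI[of _ "- P / R"]) (auto simp: field_simps eq_neg_iff_add_eq_0)
    qed
    then have "\<forall>m\<in>K. \<exists>c. c \<noteq> 0 \<and> (\<forall>t\<in>J m. d2 m t = c * (\<beta> + (d1 m t)\<^sup>2))" by blast
    then obtain c where c: "\<forall>m\<in>K. c m \<noteq> 0 \<and> (\<forall>t\<in>J m. d2 m t = c m * (\<beta> + (d1 m t)\<^sup>2))"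
      by metis
    have "0 = curv_num r (\<lambda>i. d2 i (y i)) (\<lambda>i. (d1 i (y i))\<^sup>2) K \<beta>"
      using y(1) KA by (intro zeroK[symmetric]) auto
    also have "\<dots> = (\<Prod>i\<in>K. c i * (\<beta> + (d1 i (y i))\<^sup>2)) * (\<Sum>m\<in>K. 1 / c m)"
      using c y(1) KA by (intro curv_num_riccati[OF finK card]) auto
    finally have "(\<Prod>i\<in>K. c i * (\<beta> + (d1 i (y i))\<^sup>2)) * (\<Sum>m\<in>K. 1 / c m) = 0" by simp
    moreover have "(\<Prod>i\<in>K. c i * (\<beta> + (d1 i (y i))\<^sup>2)) \<noteq> 0"
      using c \<beta>v finK by (simp add: less_imp_neq[THEN not_sym])
    ultimately show ?thesis using c by (intro exI[of _ c]) simp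
  qed
  moreover from calculation(1,2) have "card K < r \<or> card K = Suc r" by linarith
  ultimately show ?thesis using a unfolding \<beta>_def by blast
qed

text \<open>
  The equation says that \<open>arctan (f' / sqrt \<beta>)\<close> has constant derivative \<open>c * sqrt \<beta>\<close>.  As \<open>arctan\<close> takes values in
  \<open>(- pi / 2, pi / 2)\<close>, the bound on the argument of the cosine holds on all of \<open>J\<close>.
\<close>

lemma arctan_ode_solution:
  fixes f d1 d2 :: "real \<Rightarrow> real"
  assumes J: "open_interval J" and c: "c \<noteq> 0" and \<beta>: "\<beta> > 0"
    and f: "\<And>t. t \<in> J \<Longrightarrow> (f has_real_derivative d1 t) (at t)"
    and d1: "\<And>t. t \<in> J \<Longrightarrow> (d1 has_real_derivative d2 t) (at t)"
    and ode: "\<And>t. t \<in> J \<Longrightarrow> d2 t = c * (\<beta> + (d1 t)\<^sup>2)"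
  shows "\<exists>b d. \<forall>t\<in>J. \<bar>c * sqrt \<beta> * t + b\<bar> < pi / 2 \<and> f t = - (1 / c) * ln (cos (c * sqrt \<beta> * t + b)) + d"
proof -
  define s where "s = sqrt \<beta>"
  have s: "s > 0" "s * s = \<beta>" using \<beta> by (simp_all add: s_def)
  have "\<exists>b. \<forall>t\<in>J. arctan (d1 t / s) - c * s * t = b"
  proof (rule DERIV_zero_on_open_interval[OF J])
    fix t assume t: "t \<in> J"
    have "((\<lambda>t. d1 t / s) has_real_derivative d2 t / s) (at t)"
      using d1[OF t] by (rule DERIV_cdivide)
    from DERIV_diff[OF DERIV_chain2[OF DERIV_arctan this] DERIV_cmult_Id[of "c * s"]]
    have "((\<lambda>t. arctan (d1 t / s) - c * s * t) has_real_derivative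
        inverse (1 + (d1 t / s)\<^sup>2) * (d2 t / s) - c * s) (at t)" .
    moreover have "inverse (1 + (d1 t / s)\<^sup>2) * (d2 t / s) = c * s"
    proof -
      define X where "X = 1 + (d1 t / s)\<^sup>2"
      have "s\<^sup>2 * X = \<beta> + (d1 t)\<^sup>2"
        using s \<beta> by (simp add: X_def distrib_left power_divide power2_eq_square)
      then have "d2 t = c * (s\<^sup>2 * X)" using ode[OF t] by simp
      moreover have "X > 0" unfolding X_def by (intro add_pos_nonneg) auto
      ultimately show ?thesis
        unfolding X_def[symmetric] using s(1) by (simp add: field_simps power2_eq_square)
    qed
    ultimately show "((\<lambda>t. arctan (d1 t / s) - c * s * t) has_real_derivative 0) (at t)" by simp
  qed
  then obtain b where "\<forall>t\<in>J. arctan (d1 t / s) - c * s * t = b" by blast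
  then have b: "arctan (d1 t / s) = c * s * t + b" if "t \<in> J" for t
    using that by (auto simp: algebra_simps)
  have range: "\<bar>c * s * t + b\<bar> < pi / 2" if "t \<in> J" for t
    using arctan_bounded[of "d1 t / s"] unfolding b[OF that] abs_less_iff by linarith
  have d1_eq: "d1 t = s * tan (c * s * t + b)" if "t \<in> J" for t
    using b[OF that, symmetric] s by (simp add: tan_arctan)
  have "\<exists>d. \<forall>t\<in>J. f t + (1 / c) * ln (cos (c * s * t + b)) = d"
  proof (rule DERIV_zero_on_open_interval[OF J])
    fix t assume t: "t \<in> J"
    have pos: "cos (c * s * t + b) > 0" by (intro cos_gt_zero_pi) (use range[OF t] in \<open>unfold abs_less_iff, linarith+\<close>)
    have "((\<lambda>t. ln (cos (c * s * t + b))) has_real_derivative - (c * s) * tan (c * s * t + b)) (at t)"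
      using pos by (auto intro!: derivative_eq_intros simp: tan_def)
    from DERIV_add[OF f[OF t] DERIV_cmult[OF this, of "1 / c"]]
    show "((\<lambda>t. f t + (1 / c) * ln (cos (c * s * t + b))) has_real_derivative 0) (at t)"
      using c d1_eq[OF t] by simp
  qed
  then obtain d where d: "\<And>t. t \<in> J \<Longrightarrow> f t + (1 / c) * ln (cos (c * s * t + b)) = d" by blast
  have "f t = - (1 / c) * ln (cos (c * s * t + b)) + d" if "t \<in> J" for t
    using d[OF that] by (simp add: algebra_simps)
  then show ?thesis using range unfolding s_def by blast
qed

section \<open>Translation graphs in numbered coordinates\<close>

definition translation_graph_of ::
    "(nat \<Rightarrow> 'n::finite) \<Rightarrow> (nat \<Rightarrow> real \<Rightarrow> real) \<Rightarrow> (nat \<Rightarrow> real set) \<Rightarrow> ((real ^ 'n) \<times> real) set" where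
  "translation_graph_of e f J = graph_over (coord_box e J) (\<lambda>x. \<Sum>i=1..CARD('n). f i (x $ e i))"

definition curvature_numerator_at :: "nat \<Rightarrow> nat \<Rightarrow> (nat \<Rightarrow> real \<Rightarrow> real) \<Rightarrow> (nat \<Rightarrow> real) \<Rightarrow> real" where
  "curvature_numerator_at n r f x =
     curv_num r (\<lambda>i. higher_deriv 2 (f i) (x i)) (\<lambda>i. (higher_deriv 1 (f i) (x i))\<^sup>2) {1..n} 1"

text \<open>
  Comparing coefficients of \<open>t ^ r\<close> in the generating function of the principal curvatures shows that \<open>S\<^sub>r\<close> is a nonzero
  multiple of the numerator.  The second conclusion says that the shape operator is a genuine derivative of the normal field,
  on which the congruence invariance of its curvatures depends.
\<close>

lemma translation_graph_curvature:
  fixes e :: "nat \<Rightarrow> 'n::finite"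
  assumes e: "bij_betw e {1..CARD('n)} UNIV"
    and f: "\<And>i. i \<in> {1..CARD('n)} \<Longrightarrow> open_interval (J i) \<and> smooth_on (J i) (f i)"
    and N: "orientation (translation_graph_of e f J) N"
    and p: "p \<in> translation_graph_of e f J"
  shows "S_curvature r (translation_graph_of e f J) N p = 0 \<longleftrightarrow>
      curvature_numerator_at CARD('n) r f (\<lambda>i. fst p $ e i) = 0" (is ?curv)
    and "\<exists>w. normal_derivative (translation_graph_of e f J) N p v w" (is ?normal)
proof -
  let ?A = "{1..CARD('n)}"
  define e' where "e' = inv_into ?A e"
  have e'A: "e' j \<in> ?A" and ee': "e (e' j) = j" for j
    using bij_betwE[OF bij_betw_inv_into[OF e]] bij_betw_inv_into_right[OF e, of j]
    unfolding e'_def by blast+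
  have e'e: "e' (e i) = i" if "i \<in> ?A" for i
    using bij_betw_inv_into_left[OF e that] by (simp add: e'_def)
  interpret G: separable_graph "\<lambda>j. f (e' j)" "\<lambda>j. J (e' j)"
    using f e'A by unfold_locales blast+
  have base: "coord_box e J = G.base"
  proof -
    have "(\<forall>i\<in>?A. x $ e i \<in> J i) \<longleftrightarrow> (\<forall>j. x $ j \<in> J (e' j))" for x
    proof
      assume *: "\<forall>i\<in>?A. x $ e i \<in> J i"
      show "\<forall>j. x $ j \<in> J (e' j)"
      proof
        fix j show "x $ j \<in> J (e' j)" using bspec[OF * e'A[of j]] unfolding ee' .
      qed
    next
      assume *: "\<forall>j. x $ j \<in> J (e' j)"
      show "\<forall>i\<in>?A. x $ e i \<in> J i"
      proof
        fix i assume i: "i \<in> ?A"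
        show "x $ e i \<in> J i" using spec[OF *, of "e i"] unfolding e'e[OF i] .
      qed
    qed
    then show ?thesis unfolding coord_box_def G.base_def by blast
  qed
  have reindex: "(\<Sum>j\<in>UNIV. g j) = (\<Sum>i\<in>?A. g (e i))" for g :: "'n \<Rightarrow> real"
    using sum.reindex_bij_betw[OF e, of g] by simp
  have F: "(\<Sum>i\<in>?A. f i (x $ e i)) = G.F x" for x
    unfolding G.F_def reindex by (intro sum.cong) (auto simp: e'e)
  have M: "translation_graph_of e f J = G.M"
    unfolding translation_graph_of_def base F ..
  obtain x where x: "x \<in> G.base" and p_eq: "p = (x, G.F x)"
    using p unfolding M by (auto simp: graph_over_def)
  show ?normal
    using G.orientation_eq[OF N[unfolded M]] G.normal_derivative_graph[OF x] unfolding M p_eq by blast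
  let ?h = "\<lambda>i. higher_deriv 2 (f i) (x $ e i)" and ?u = "\<lambda>i. higher_deriv 1 (f i) (x $ e i)"
  obtain \<kappa> \<delta> \<tau> where \<delta>: "\<delta> \<noteq> 0" and \<tau>: "\<tau> \<noteq> 0"
    and S: "S_curvature r G.M N (x, G.F x) = esym r \<kappa> ?A"
    and gen: "\<And>t. (\<Prod>i=1..CARD('n). 1 + t * \<kappa> i) = \<delta> * ((\<Prod>j\<in>UNIV. 1 + t * (\<tau> * G.d2 j (x $ j))) +
       (\<Sum>k\<in>UNIV. (G.d1 k (x $ k))\<^sup>2 * (\<Prod>j\<in>UNIV - {k}. 1 + t * (\<tau> * G.d2 j (x $ j)))))"
    using G.curvature_generating_function[OF x N[unfolded M]] by blast
  have "(\<Prod>j\<in>UNIV. 1 + t * (\<tau> * G.d2 j (x $ j))) = (\<Prod>i\<in>?A. 1 + t * (\<tau> * ?h i))" for t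
    using prod.reindex_bij_betw[OF e, of "\<lambda>j. 1 + t * (\<tau> * G.d2 j (x $ j))"]
    by (simp add: G.d2_def e'e)
  moreover have "(\<Prod>j\<in>UNIV - {e k}. 1 + t * (\<tau> * G.d2 j (x $ j))) = (\<Prod>i\<in>?A - {k}. 1 + t * (\<tau> * ?h i))"
    if k: "k \<in> ?A" for t k
  proof -
    have "bij_betw e (?A - {k}) (UNIV - {e k})"
      using bij_betw_DiffI[OF e, of "{k}" "{e k}"] k by (auto simp: bij_betw_def)
    from prod.reindex_bij_betw[OF this, of "\<lambda>j. 1 + t * (\<tau> * G.d2 j (x $ j))"]
    show ?thesis by (simp add: G.d2_def e'e)
  qed
  ultimately have gen': "(\<Prod>i\<in>?A. 1 + t * \<kappa> i) = \<delta> * ((\<Prod>i\<in>?A. 1 + t * (\<tau> * ?h i)) +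
       (\<Sum>k\<in>?A. (?u k)\<^sup>2 * (\<Prod>i\<in>?A - {k}. 1 + t * (\<tau> * ?h i))))" for t
    unfolding gen reindex by (simp add: G.d1_def e'e)
  have "(\<Prod>i\<in>?A. [:1, \<kappa> i:]) = smult \<delta> ((\<Prod>i\<in>?A. [:1, \<tau> * ?h i:]) +
      (\<Sum>k\<in>?A. smult ((?u k)\<^sup>2) (\<Prod>i\<in>?A - {k}. [:1, \<tau> * ?h i:])))"
    unfolding poly_eq_poly_eq_iff[symmetric] fun_eq_iff
    using gen' by (simp add: poly_prod poly_sum)
  then have "poly.coeff (\<Prod>i\<in>?A. [:1, \<kappa> i:]) r = poly.coeff (smult \<delta> ((\<Prod>i\<in>?A. [:1, \<tau> * ?h i:]) +
      (\<Sum>k\<in>?A. smult ((?u k)\<^sup>2) (\<Prod>i\<in>?A - {k}. [:1, \<tau> * ?h i:])))) r"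
    by (rule arg_cong)
  then have "esym r \<kappa> ?A = \<delta> * (esym r (\<lambda>i. \<tau> * ?h i) ?A + (\<Sum>k\<in>?A. (?u k)\<^sup>2 * esym r (\<lambda>i. \<tau> * ?h i) (?A - {k})))"
    by (simp add: coeff_prod_linear coeff_sum)
  also have "\<dots> = \<delta> * \<tau> ^ r * curvature_numerator_at CARD('n) r f (\<lambda>i. x $ e i)"
    by (simp add: esym_scale curvature_numerator_at_def curv_num_def algebra_simps sum_distrib_left)
  finally show ?curv using \<delta> \<tau> unfolding M p_eq S by simp
qed

lemma coord_box_realize:
  fixes e :: "nat \<Rightarrow> 'n::finite"
  assumes e: "bij_betw e {1..CARD('n)} UNIV" and y: "\<And>i. i \<in> {1..CARD('n)} \<Longrightarrow> y i \<in> J i"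
  obtains x where "x \<in> coord_box e J" "\<And>i. i \<in> {1..CARD('n)} \<Longrightarrow> x $ e i = y i"
proof
  let ?x = "\<chi> j. y (inv_into {1..CARD('n)} e j)"
  show "?x $ e i = y i" if "i \<in> {1..CARD('n)}" for i
    using bij_betw_inv_into_left[OF e that] by simp
  then show "?x \<in> coord_box e J" using y unfolding coord_box_def by auto
qed

text \<open>
  The numbering \<open>e\<close> makes points of the box the same as independent choices \<open>x i \<in> J i\<close>.
\<close>

lemma translation_graph_curvature_zero_iff:
  fixes e :: "nat \<Rightarrow> 'n::finite"
  assumes e: "bij_betw e {1..CARD('n)} UNIV"
    and f: "\<And>i. i \<in> {1..CARD('n)} \<Longrightarrow> open_interval (J i) \<and> smooth_on (J i) (f i)"
    and N: "orientation (translation_graph_of e f J) N"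
  shows "(\<forall>p\<in>translation_graph_of e f J. S_curvature r (translation_graph_of e f J) N p = 0) \<longleftrightarrow>
    (\<forall>x. (\<forall>i\<in>{1..CARD('n)}. x i \<in> J i) \<longrightarrow> curvature_numerator_at CARD('n) r f x = 0)"
proof -
  have "(\<forall>p\<in>translation_graph_of e f J. S_curvature r (translation_graph_of e f J) N p = 0) \<longleftrightarrow>
      (\<forall>p\<in>translation_graph_of e f J. curvature_numerator_at CARD('n) r f (\<lambda>i. fst p $ e i) = 0)"
    using translation_graph_curvature(1)[OF e f N] by blast
  also have "\<dots> \<longleftrightarrow> (\<forall>x\<in>coord_box e J. curvature_numerator_at CARD('n) r f (\<lambda>i. x $ e i) = 0)"
    by (simp add: translation_graph_of_def graph_over_def)
  also have "\<dots> \<longleftrightarrow> (\<forall>x. (\<forall>i\<in>{1..CARD('n)}. x i \<in> J i) \<longrightarrow> curvature_numerator_at CARD('n) r f x = 0)"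
  proof (intro iffI allI impI ballI)
    fix x assume zero: "\<forall>x\<in>coord_box e J. curvature_numerator_at CARD('n) r f (\<lambda>i. x $ e i) = 0"
      and x: "\<forall>i\<in>{1..CARD('n)}. x i \<in> J i"
    obtain z where z: "z \<in> coord_box e J" "\<And>i. i \<in> {1..CARD('n)} \<Longrightarrow> z $ e i = x i"
      using coord_box_realize[OF e, of x J] x by blast
    have "curvature_numerator_at CARD('n) r f x = curvature_numerator_at CARD('n) r f (\<lambda>i. z $ e i)"
      unfolding curvature_numerator_at_def by (rule curv_num_cong) (simp_all add: z)
    then show "curvature_numerator_at CARD('n) r f x = 0" using zero z by simp
  next
    fix x assume "\<forall>x. (\<forall>i\<in>{1..CARD('n)}. x i \<in> J i) \<longrightarrow> curvature_numerator_at CARD('n) r f x = 0"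
      and "x \<in> coord_box e J"
    then show "curvature_numerator_at CARD('n) r f (\<lambda>i. x $ e i) = 0" by (simp add: coord_box_def)
  qed
  finally show ?thesis .
qed

text \<open>
  A congruent copy that is itself a translation graph, possibly with quite different profiles, may be used to test
  for zero curvature.
\<close>

lemma congruent_translation_graph_curvature_zero_iff:
  fixes e :: "nat \<Rightarrow> 'n::finite"
  assumes e: "bij_betw e {1..CARD('n)} UNIV"
    and f: "\<And>i. i \<in> {1..CARD('n)} \<Longrightarrow> open_interval (J i) \<and> smooth_on (J i) (f i)"
    and g: "\<And>i. i \<in> {1..CARD('n)} \<Longrightarrow> open_interval (I i) \<and> smooth_on (I i) (g i)"
    and N: "orientation (translation_graph_of e f J) N"
    and congr: "congruent_sets (translation_graph_of e f J) (translation_graph_of e g I)"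
  shows "(\<forall>p\<in>translation_graph_of e f J. S_curvature r (translation_graph_of e f J) N p = 0) \<longleftrightarrow>
    (\<forall>x. (\<forall>i\<in>{1..CARD('n)}. x i \<in> I i) \<longrightarrow> curvature_numerator_at CARD('n) r g x = 0)"
proof -
  let ?M = "translation_graph_of e f J" and ?M' = "translation_graph_of e g I"
  obtain T c where T: "orthogonal_transformation T" and M': "?M' = (\<lambda>x. c + T x) ` ?M"
    using congr by (auto simp: congruent_sets_def)
  let ?N' = "\<lambda>y. T (N (inv T (y - c)))"
  have N': "orientation ?M' ?N'" unfolding M' by (rule orientation_congruent[OF T N])
  have "S_curvature r ?M' ?N' (c + T p) = S_curvature r ?M N p" if "p \<in> ?M" for p
    unfolding M' by (rule S_curvature_congruent[OF T translation_graph_curvature(2)[OF e f N that]])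
  then have "(\<forall>p\<in>?M. S_curvature r ?M N p = 0) \<longleftrightarrow> (\<forall>p\<in>?M'. S_curvature r ?M' ?N' p = 0)"
    by (simp add: M')
  then show ?thesis using translation_graph_curvature_zero_iff[OF e g N'] by simp
qed

text \<open>
  Permuting the coordinates of the base is an orthogonal transformation.
\<close>

lemma congruent_permuted_translation_graph:
  fixes e :: "nat \<Rightarrow> 'n::finite"
  assumes e: "bij_betw e {1..CARD('n)} UNIV" and \<pi>: "bij_betw \<pi> {1..CARD('n)} {1..CARD('n)}"
  shows "congruent_sets (translation_graph_of e f J) (translation_graph_of e (\<lambda>i. f (\<pi> i)) (\<lambda>i. J (\<pi> i)))"
proof -
  let ?A = "{1..CARD('n)}"
  define \<rho> where "\<rho> j = e (\<pi> (inv_into ?A e j))" for j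
  have \<rho>: "bij \<rho>"
    using bij_betw_trans[OF bij_betw_trans[OF bij_betw_inv_into[OF e] \<pi>] e] by (simp add: \<rho>_def[abs_def] o_def)
  have \<rho>e: "\<rho> (e i) = e (\<pi> i)" if "i \<in> ?A" for i
    using bij_betw_inv_into_left[OF e that] by (simp add: \<rho>_def)
  define R :: "real ^ 'n \<Rightarrow> real ^ 'n" where "R x = (\<chi> j. x $ \<rho> j)" for x
  define T :: "(real ^ 'n) \<times> real \<Rightarrow> (real ^ 'n) \<times> real" where "T p = (R (fst p), snd p)" for p
  have "linear T" by (auto simp: linear_iff T_def R_def vec_eq_iff)
  moreover have "R x \<bullet> R y = x \<bullet> y" for x y
    using sum.reindex_bij_betw[OF \<rho>, of "\<lambda>j. x $ j * y $ j"] by (simp add: R_def inner_vec_def)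
  ultimately have T: "orthogonal_transformation T"
    by (simp add: orthogonal_transformation_def T_def inner_prod_def)
  have Re: "R x $ e i = x $ e (\<pi> i)" if "i \<in> ?A" for x i using \<rho>e[OF that] by (simp add: R_def)
  have box: "R x \<in> coord_box e (\<lambda>i. J (\<pi> i)) \<longleftrightarrow> x \<in> coord_box e J" for x
  proof -
    have "(\<forall>i\<in>?A. x $ e (\<pi> i) \<in> J (\<pi> i)) \<longleftrightarrow> (\<forall>k\<in>\<pi> ` ?A. x $ e k \<in> J k)" by simp
    also have "\<pi> ` ?A = ?A" using \<pi> by (simp add: bij_betw_def)
    finally show ?thesis by (simp add: coord_box_def Re)
  qed
  have R_surj: "R (\<chi> j. y $ inv \<rho> j) = y" for y
    using \<rho> by (simp add: R_def vec_eq_iff bij_is_inj)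
  have boxes: "R ` coord_box e J = coord_box e (\<lambda>i. J (\<pi> i))"
  proof
    show "coord_box e (\<lambda>i. J (\<pi> i)) \<subseteq> R ` coord_box e J"
    proof
      fix y assume "y \<in> coord_box e (\<lambda>i. J (\<pi> i))"
      then have "(\<chi> j. y $ inv \<rho> j) \<in> coord_box e J" using box R_surj[of y] by metis
      then show "y \<in> R ` coord_box e J" using R_surj[of y] by (intro image_eqI[of _ R "\<chi> j. y $ inv \<rho> j"]) simp_all
    qed
  qed (auto simp: box)
  have sum: "(\<Sum>i\<in>?A. f (\<pi> i) (R x $ e i)) = (\<Sum>i\<in>?A. f i (x $ e i))" for x
    using sum.reindex_bij_betw[OF \<pi>, of "\<lambda>i. f i (x $ e i)"] by (simp add: Re)
  have "translation_graph_of e (\<lambda>i. f (\<pi> i)) (\<lambda>i. J (\<pi> i)) = (\<lambda>x. 0 + T x) ` translation_graph_of e f J"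
    unfolding translation_graph_of_def graph_over_def boxes[symmetric] image_image sum T_def by simp
  then show ?thesis unfolding congruent_sets_def using T by blast
qed

text \<open>
  Used to move the profiles that are not affine to the last coordinates.
\<close>

lemma exists_permutation_onto_tail:
  assumes K: "K \<subseteq> {1..n::nat}" "card K = m"
  shows "\<exists>\<pi>. bij_betw \<pi> {1..n} {1..n} \<and> \<pi> ` {1..n - m} = {1..n} - K \<and> \<pi> ` {n - m + 1..n} = K"
proof -
  have finK: "finite K" and mn: "m \<le> n"
    using K finite_subset card_mono[OF _ K(1)] by auto
  obtain g1 where g1: "bij_betw g1 {1..n - m} ({1..n} - K)"
    using finite_same_card_bij[of "{1..n - m}" "{1..n} - K"] K finK by (auto simp: card_Diff_subset)
  obtain g2 where g2: "bij_betw g2 {n - m + 1..n} K"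
    using finite_same_card_bij[of "{n - m + 1..n}" K] K finK mn by auto
  define \<pi> where "\<pi> i = (if i \<in> {1..n - m} then g1 i else g2 i)" for i
  have "bij_betw \<pi> ({1..n - m} \<union> {n - m + 1..n}) (({1..n} - K) \<union> K)"
    unfolding \<pi>_def by (rule bij_betw_disjoint_Un[OF g1 g2]) auto
  moreover have "{1..n - m} \<union> {n - m + 1..n} = {1..n}" using mn by auto
  moreover have "({1..n} - K) \<union> K = {1..n}" using K by auto
  moreover have "\<pi> ` {1..n - m} = g1 ` {1..n - m}" by (rule image_cong) (auto simp: \<pi>_def)
  moreover have "\<pi> ` {n - m + 1..n} = g2 ` {n - m + 1..n}" by (rule image_cong) (auto simp: \<pi>_def)
  ultimately show ?thesis using g1 g2 by (intro exI[of _ \<pi>]) (simp add: bij_betw_def)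
qed

lemma higher_deriv_eqI:
  fixes f d1 d2 :: "real \<Rightarrow> real"
  assumes J: "open J" and d: "\<And>t. t \<in> J \<Longrightarrow> (f has_real_derivative d1 t) (at t)"
    "\<And>t. t \<in> J \<Longrightarrow> (d1 has_real_derivative d2 t) (at t)" and t: "t \<in> J"
  shows "higher_deriv 1 f t = d1 t" "higher_deriv 2 f t = d2 t"
proof -
  have 1: "higher_deriv 1 f s = d1 s" if "s \<in> J" for s
    using d(1)[OF that] higher_deriv_Suc[of 0 f s]
    by (simp add: has_real_derivative_iff_has_vector_derivative vector_derivative_at)
  then show "higher_deriv 1 f t = d1 t" using t .
  have "(higher_deriv 1 f has_real_derivative d2 t) (at t)"
    by (rule has_field_derivative_transform_within_open[OF d(2)[OF t] J t]) (rule 1[symmetric])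
  then show "higher_deriv 2 f t = d2 t"
    using higher_deriv_Suc[of 1 f t]
    by (simp add: has_real_derivative_iff_has_vector_derivative vector_derivative_at numeral_2_eq_2)
qed

lemma smooth_on_plus_const: "open J \<Longrightarrow> smooth_on J f \<Longrightarrow> smooth_on J (\<lambda>t. f t + c)" for f :: "real \<Rightarrow> real"
  using smooth_on_affine_image[of J f id c] by (simp add: linear_id add.commute)

lemma sum_split_at: "m \<le> n \<Longrightarrow> sum g {1..n::nat} = sum g {1..m} + sum g {m + 1..n}" for g :: "nat \<Rightarrow> real"
proof -
  assume "m \<le> n"
  then have "{1..n} = {1..m} \<union> {m + 1..n}" by auto
  then show ?thesis by (simp add: sum.union_disjoint)
qed

section \<open>Cylinders and generalized periodic Enneper hypersurfaces\<close>

text \<open>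
  As boxes of nonempty intervals project onto their sides, inclusion of a box in one of the natural domains can be read off
  coordinate by coordinate.
\<close>

lemma coord_box_subset_component:
  fixes e :: "nat \<Rightarrow> 'n::finite"
  assumes e: "bij_betw e {1..CARD('n)} UNIV" and I: "\<And>i. i \<in> {1..CARD('n)} \<Longrightarrow> I i \<noteq> {}"
    and sub: "coord_box e I \<subseteq> D" and j: "j \<in> {1..CARD('n)}" and t: "t \<in> I j"
  obtains x where "x \<in> D" "x $ e j = t"
proof -
  define y where "y i = (if i = j then t else SOME s. s \<in> I i)" for i
  have "y i \<in> I i" if "i \<in> {1..CARD('n)}" for i
    using t I[OF that] by (auto simp: y_def some_in_eq)
  then obtain x where "x \<in> coord_box e I" "\<And>i. i \<in> {1..CARD('n)} \<Longrightarrow> x $ e i = y i"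
    using coord_box_realize[OF e, of y I] by blast
  then show ?thesis using that[of x] sub j by (auto simp: y_def)
qed

lemma cylinder_fun_eq_sum:
  fixes e :: "nat \<Rightarrow> 'n::finite"
  assumes "2 \<le> r" "r \<le> CARD('n)"
  shows "cylinder_fun e r a f b x =
    (\<Sum>i=1..CARD('n). if i \<le> CARD('n) - r + 1 then a i * x $ e i else f i (x $ e i)) + b"
proof -
  let ?n = "CARD('n)"
  have "(\<Sum>i=1..?n - r + 1. if i \<le> ?n - r + 1 then a i * x $ e i else f i (x $ e i)) = (\<Sum>i=1..?n - r + 1. a i * x $ e i)"
    by (rule sum.cong) auto
  moreover have "(\<Sum>i=?n - r + 1 + 1..?n. if i \<le> ?n - r + 1 then a i * x $ e i else f i (x $ e i)) = (\<Sum>i=?n - r + 2..?n. f i (x $ e i))"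
    by (rule sum.cong) auto
  moreover have "?n - r + 1 \<le> ?n" using assms by simp
  ultimately show ?thesis
    unfolding cylinder_fun_def Let_def by (subst sum_split_at[of "?n - r + 1" ?n]) auto
qed

text \<open>
  Only \<open>r - 1\<close> profiles have a nonzero second derivative, so no product of \<open>r\<close> second derivatives survives.
\<close>

lemma cylinder_curvature_zero:
  fixes e :: "nat \<Rightarrow> 'n::finite"
  assumes e: "bij_betw e {1..CARD('n)} UNIV" and r: "2 \<le> r" "r \<le> CARD('n)"
    and f: "\<And>j. j \<in> {CARD('n) - r + 2..CARD('n)} \<Longrightarrow> smooth_on (J j) (f j)"
    and I: "\<And>i. i \<in> {1..CARD('n)} \<Longrightarrow> open_interval (I i)"
    and sub: "coord_box e I \<subseteq> cylinder_domain e r J"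
  shows "\<exists>g. (\<forall>i\<in>{1..CARD('n)}. smooth_on (I i) (g i)) \<and>
    graph_over (coord_box e I) (cylinder_fun e r a f b) = translation_graph_of e g I \<and>
    (\<forall>x. (\<forall>i\<in>{1..CARD('n)}. x i \<in> I i) \<longrightarrow> curvature_numerator_at CARD('n) r g x = 0)"
proof -
  let ?n = "CARD('n)"
  \<comment> \<open>The constant \<open>b\<close> is put into the last profile.\<close>
  define g where "g i t = (if i \<le> ?n - r + 1 then a i * t else f i t) + (if i = ?n then b else 0)" for i t
  have opn: "open (I i)" if "i \<in> {1..?n}" for i using I[OF that] by (rule open_intervalD)
  have IJ: "I j \<subseteq> J j" if j: "j \<in> {?n - r + 2..?n}" for j
  proof
    fix t assume t: "t \<in> I j"
    have jn: "j \<in> {1..?n}" using j by auto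
    obtain x where "x \<in> cylinder_domain e r J" "x $ e j = t"
      using coord_box_subset_component[OF e open_intervalD(3)[OF I] sub jn t] by blast
    then show "t \<in> J j" using j by (auto simp: cylinder_domain_def)
  qed
  have smooth: "smooth_on (I i) (g i)" if i: "i \<in> {1..?n}" for i
  proof (cases "i \<le> ?n - r + 1")
    case True
    then show ?thesis using smooth_on_linear_real[OF opn[OF i]] by (simp add: g_def[abs_def])
  next
    case False
    then have "i \<in> {?n - r + 2..?n}" using i by auto
    then have "smooth_on (I i) (f i)" using smooth_on_subset[OF f IJ] by blast
    then show ?thesis using False smooth_on_plus_const[OF opn[OF i]] by (simp add: g_def[abs_def])
  qed
  have "cylinder_fun e r a f b x = (\<Sum>i=1..?n. g i (x $ e i))" for x
    unfolding cylinder_fun_eq_sum[OF r] g_def by (simp add: sum.distrib)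
  then have graph: "graph_over (coord_box e I) (cylinder_fun e r a f b) = translation_graph_of e g I"
    by (simp add: translation_graph_of_def graph_over_def)
  have "curvature_numerator_at ?n r g x = 0" if x: "\<forall>i\<in>{1..?n}. x i \<in> I i" for x
  proof -
    let ?K = "{?n - r + 2..?n}"
    have "higher_deriv 2 (g i) (x i) = 0" if i: "i \<in> {1..?n} - ?K" for i
    proof -
      have i': "i \<in> {1..?n}" "i \<le> ?n - r + 1" using i by auto
      show ?thesis
        using x i' by (intro higher_deriv_eqI(2)[OF opn[OF i'(1)], where ?d1.0 = "\<lambda>_. a i" and ?d2.0 = "\<lambda>_. 0"])
          (auto simp: g_def[abs_def] intro!: derivative_eq_intros)
    qed
    then have "curvature_numerator_at ?n r g x = curv_num r (\<lambda>i. higher_deriv 2 (g i) (x i)) (\<lambda>i. (higher_deriv 1 (g i) (x i))\<^sup>2) ?K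
        (1 + (\<Sum>m\<in>{1..?n} - ?K. (higher_deriv 1 (g m) (x m))\<^sup>2))"
      unfolding curvature_numerator_at_def by (intro curv_num_drop_zeros) auto
    also have "\<dots> = 0" using r by (intro curv_num_few) auto
    finally show ?thesis .
  qed
  then show ?thesis using smooth graph by blast
qed

text \<open>
  The constant \<open>c\<close> in the equation \<open>f'' = c (\<beta> + f'^2)\<close> for the profile in the variable \<open>k\<close>.
\<close>

definition enneper_coeff :: "nat \<Rightarrow> nat \<Rightarrow> (nat \<Rightarrow> real) \<Rightarrow> nat \<Rightarrow> real" where
  "enneper_coeff n r a k = (if k = n then - ((\<Prod>i=n-r..n-1. a i) / esym (r-1) a {n-r..n-1}) else a k)"

lemma enneper_arg_eq: "enneper_arg n r a b k t = enneper_coeff n r a k * sqrt (enneper_beta n r a) * t + b k"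
  by (simp add: enneper_arg_def enneper_coeff_def)

lemma enneper_beta_pos: "enneper_beta n r a > 0"
  unfolding enneper_beta_def by (intro add_pos_nonneg sum_nonneg) auto

lemma esym_pred_inverse_sum:
  assumes r: "1 \<le> r" "r < n" and a: "\<And>k. k \<in> {n-r..n-1} \<Longrightarrow> a k \<noteq> 0"
  shows "esym (r - 1) a {n-r..n-1} = (\<Prod>i=n-r..n-1. a i) * (\<Sum>k=n-r..n-1. 1 / a k)"
proof -
  have "card {n-r..n-1} = Suc (r - 1)" using r by simp
  then have "esym (r - 1) a {n-r..n-1} = (\<Sum>m=n-r..n-1. \<Prod>i\<in>{n-r..n-1} - {m}. a i)"
    by (intro esym_card_pred) auto
  also have "\<dots> = (\<Sum>m=n-r..n-1. (\<Prod>i=n-r..n-1. a i) * (1 / a m))"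
  proof (rule sum.cong[OF refl])
    fix m assume m: "m \<in> {n-r..n-1}"
    have "(\<Prod>i=n-r..n-1. a i) = a m * (\<Prod>i\<in>{n-r..n-1} - {m}. a i)"
      using m by (intro prod.remove) auto
    then show "(\<Prod>i\<in>{n-r..n-1} - {m}. a i) = (\<Prod>i=n-r..n-1. a i) * (1 / a m)"
      using a[OF m] by simp
  qed
  finally show ?thesis by (simp add: sum_distrib_left)
qed

text \<open>
  The coefficient in the last variable is chosen so that the reciprocals of all coefficients sum to zero.
\<close>

lemma enneper_coeff_last:
  assumes r: "1 \<le> r" "r < n" and a: "\<And>k. k \<in> {n-r..n-1} \<Longrightarrow> a k \<noteq> 0" and es: "esym (r-1) a {n-r..n-1} \<noteq> 0"
  shows "1 / enneper_coeff n r a n = - (\<Sum>k=n-r..n-1. 1 / a k)" "enneper_coeff n r a n \<noteq> 0"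
proof -
  let ?P = "\<Prod>i=n-r..n-1. a i" and ?S = "\<Sum>k=n-r..n-1. 1 / a k"
  have E: "esym (r-1) a {n-r..n-1} = ?P * ?S" by (rule esym_pred_inverse_sum[OF r a])
  have P: "?P \<noteq> 0" and S: "?S \<noteq> 0" using es unfolding E by auto
  have "enneper_coeff n r a n = - (?P / (?P * ?S))"
    unfolding enneper_coeff_def E by simp
  then have eq: "enneper_coeff n r a n = - (1 / ?S)" using P by simp
  show "1 / enneper_coeff n r a n = - ?S" unfolding eq by simp
  show "enneper_coeff n r a n \<noteq> 0" unfolding eq using S by simp
qed

lemma sum_split_last: "r < n \<Longrightarrow> sum g {n-r..n::nat} = sum g {n-r..n-1} + g n" for g :: "nat \<Rightarrow> real"
proof -
  assume "r < n"
  then have "{n-r..n} = insert n {n-r..n-1}" "n \<notin> {n-r..n-1}" by auto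
  then show ?thesis by simp
qed

text \<open>
  Separating the logarithm of the quotient, the terms in the last variable add up to a single logarithm with factor
  \<open>\<Sum> 1 / a k\<close>, which is \<open>- 1 / c\<close> for the last coefficient \<open>c\<close>.  So all variables are on an equal footing.
\<close>

lemma enneper_fun_eq_sum:
  fixes e :: "nat \<Rightarrow> 'n::finite"
  assumes r: "1 \<le> r" "r < CARD('n)" and a: "\<And>k. k \<in> {CARD('n)-r..CARD('n)-1} \<Longrightarrow> a k \<noteq> 0"
    and es: "esym (r-1) a {CARD('n)-r..CARD('n)-1} \<noteq> 0"
    and x: "x \<in> enneper_domain e r a b"
  shows "enneper_fun e r a b c x = (\<Sum>i=1..CARD('n). if i \<le> CARD('n) - r - 1 then a i * x $ e i
    else - (1 / enneper_coeff CARD('n) r a i) * ln (cos (enneper_arg CARD('n) r a b i (x $ e i)))) + c"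
proof -
  let ?n = "CARD('n)"
  let ?L = "\<lambda>k. ln (cos (enneper_arg ?n r a b k (x $ e k)))"
  have pos: "cos (enneper_arg ?n r a b k (x $ e k)) > 0" if "k \<in> {?n-r..?n}" for k
  proof -
    have "\<bar>enneper_arg ?n r a b k (x $ e k)\<bar> < pi / 2" using x that by (auto simp: enneper_domain_def)
    then show ?thesis by (intro cos_gt_zero_pi) (unfold abs_less_iff, linarith+)
  qed
  have "(\<Sum>k=?n-r..?n-1. 1 / a k * ln \<bar>cos (enneper_arg ?n r a b ?n (x $ e ?n)) / cos (enneper_arg ?n r a b k (x $ e k))\<bar>)
      = (\<Sum>k=?n-r..?n-1. - (1 / a k) * ?L k + 1 / a k * ?L ?n)"
  proof (rule sum.cong[OF refl])
    fix k assume k: "k \<in> {?n-r..?n-1}"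
    then have "k \<in> {?n-r..?n}" by auto
    then show "1 / a k * ln \<bar>cos (enneper_arg ?n r a b ?n (x $ e ?n)) / cos (enneper_arg ?n r a b k (x $ e k))\<bar>
        = - (1 / a k) * ?L k + 1 / a k * ?L ?n"
      using pos[of k] pos[of ?n] by (simp add: ln_div algebra_simps)
  qed
  also have "\<dots> = (\<Sum>k=?n-r..?n-1. - (1 / a k) * ?L k) + (\<Sum>k=?n-r..?n-1. 1 / a k) * ?L ?n"
    by (simp only: sum.distrib sum_distrib_right)
  also have "(\<Sum>k=?n-r..?n-1. 1 / a k) = - (1 / enneper_coeff ?n r a ?n)"
    using enneper_coeff_last(1)[OF r a es] by simp
  also have "(\<Sum>k=?n-r..?n-1. - (1 / a k) * ?L k) = (\<Sum>k=?n-r..?n-1. - (1 / enneper_coeff ?n r a k) * ?L k)"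
    using r by (intro sum.cong) (auto simp: enneper_coeff_def)
  also have "(\<Sum>k=?n-r..?n-1. - (1 / enneper_coeff ?n r a k) * ?L k) + - (1 / enneper_coeff ?n r a ?n) * ?L ?n
      = (\<Sum>k=?n-r..?n. - (1 / enneper_coeff ?n r a k) * ?L k)"
    using sum_split_last[OF r(2), of "\<lambda>k. - (1 / enneper_coeff ?n r a k) * ?L k"] by simp
  finally have main: "(\<Sum>k=?n-r..?n-1. 1 / a k * ln \<bar>cos (enneper_arg ?n r a b ?n (x $ e ?n)) / cos (enneper_arg ?n r a b k (x $ e k))\<bar>)
      = (\<Sum>k=?n-r..?n. - (1 / enneper_coeff ?n r a k) * ?L k)" .
  let ?g = "\<lambda>i. if i \<le> ?n - r - 1 then a i * x $ e i else - (1 / enneper_coeff ?n r a i) * ?L i"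
  have "(\<Sum>i=1..?n - r - 1. ?g i) = (\<Sum>i=1..?n - r - 1. a i * x $ e i)"
    by (rule sum.cong) auto
  moreover have "(\<Sum>i=?n - r - 1 + 1..?n. ?g i) = (\<Sum>i=?n - r..?n. - (1 / enneper_coeff ?n r a i) * ?L i)"
    using r by (intro sum.cong) auto
  moreover have "(\<Sum>i=1..?n. ?g i) = (\<Sum>i=1..?n - r - 1. ?g i) + (\<Sum>i=?n - r - 1 + 1..?n. ?g i)"
    by (rule sum_split_at) simp
  ultimately show ?thesis
    unfolding enneper_fun_def Let_def main by simp
qed

lemma enneper_profile_derivatives:
  assumes c: "c \<noteq> 0" and arg: "\<bar>c * s * t + b\<bar> < pi / 2"
  shows "((\<lambda>t. - (1 / c) * ln (cos (c * s * t + b)) + d) has_real_derivative s * tan (c * s * t + b)) (at t)"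
    and "((\<lambda>t. s * tan (c * s * t + b)) has_real_derivative c * (s\<^sup>2 + (s * tan (c * s * t + b))\<^sup>2)) (at t)"
proof -
  have pos: "cos (c * s * t + b) > 0"
    by (intro cos_gt_zero_pi) (use arg in \<open>unfold abs_less_iff, linarith+\<close>)
  show "((\<lambda>t. - (1 / c) * ln (cos (c * s * t + b)) + d) has_real_derivative s * tan (c * s * t + b)) (at t)"
    using pos c by (auto intro!: derivative_eq_intros simp: tan_def)
  have lin: "((\<lambda>t. c * s * t + b) has_real_derivative c * s) (at t)"
    by (auto intro!: derivative_eq_intros)
  have "inverse ((cos (c * s * t + b))\<^sup>2) = 1 + (tan (c * s * t + b))\<^sup>2"
    using pos tan_sec[of "c * s * t + b"] by (simp add: power_inverse)
  then have "((\<lambda>t. tan (c * s * t + b)) has_real_derivative (1 + (tan (c * s * t + b))\<^sup>2) * (c * s)) (at t)"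
    using DERIV_chain2[OF DERIV_tan lin] pos by simp
  from DERIV_cmult[OF this, of s]
  show "((\<lambda>t. s * tan (c * s * t + b)) has_real_derivative c * (s\<^sup>2 + (s * tan (c * s * t + b))\<^sup>2)) (at t)"
    by (simp add: algebra_simps power2_eq_square)
qed

lemma enneper_profile_smooth:
  fixes c s b d :: real
  assumes I: "open I" and arg: "\<And>t. t \<in> I \<Longrightarrow> \<bar>c * s * t + b\<bar> < pi / 2"
  shows "smooth_on I (\<lambda>t. - (1 / c) * ln (cos (c * s * t + b)) + d)"
proof -
  have "smooth_on {-(pi/2)<..<pi/2} (\<lambda>t. ln (cos t))"
    by (rule smooth_on_ln_cos) auto
  then have "smooth_on I (\<lambda>t. ln (cos (b + (c * s) * t)))"
  proof (rule smooth_on_affine_arg[OF open_greaterThanLessThan _ I])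
    fix t assume "t \<in> I"
    from arg[OF this] show "b + c * s * t \<in> {-(pi/2)<..<pi/2}"
      unfolding abs_less_iff greaterThanLessThan_iff by linarith
  qed
  moreover have "linear (\<lambda>y. - (1 / c) * y)" by (simp add: linear_iff add_divide_distrib)
  ultimately have "smooth_on I (\<lambda>t. d + - (1 / c) * ln (cos (b + (c * s) * t)))"
    by (rule smooth_on_affine_image[OF I])
  then show ?thesis by (simp only: add.commute)
qed

text \<open>
  By \<open>enneper_profile_derivatives\<close> the \<open>r + 1\<close> profiles solve the Riccati equation of
  \<open>curv_num_riccati\<close> with coefficients whose reciprocals sum to zero.
\<close>

lemma enneper_curvature_zero:
  fixes e :: "nat \<Rightarrow> 'n::finite"
  assumes e: "bij_betw e {1..CARD('n)} UNIV" and r: "1 \<le> r" "r < CARD('n)"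
    and a: "\<And>k. k \<in> {CARD('n)-r..CARD('n)-1} \<Longrightarrow> a k \<noteq> 0" and es: "esym (r-1) a {CARD('n)-r..CARD('n)-1} \<noteq> 0"
    and I: "\<And>i. i \<in> {1..CARD('n)} \<Longrightarrow> open_interval (I i)"
    and sub: "coord_box e I \<subseteq> enneper_domain e r a b"
  shows "\<exists>g. (\<forall>i\<in>{1..CARD('n)}. smooth_on (I i) (g i)) \<and>
    graph_over (coord_box e I) (enneper_fun e r a b c) = translation_graph_of e g I \<and>
    (\<forall>x. (\<forall>i\<in>{1..CARD('n)}. x i \<in> I i) \<longrightarrow> curvature_numerator_at CARD('n) r g x = 0)"
proof -
  let ?n = "CARD('n)"
  let ?K = "{?n-r..?n}"
  let ?C = "enneper_coeff ?n r a"
  define s where "s = sqrt (enneper_beta ?n r a)"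
  have s2: "s\<^sup>2 = enneper_beta ?n r a" using enneper_beta_pos[of ?n r a] by (simp add: s_def)
  have arg_eq: "enneper_arg ?n r a b k t = ?C k * s * t + b k" for k t
    by (simp add: enneper_arg_eq s_def)
  \<comment> \<open>The constant \<open>c\<close> is put into the last profile.\<close>
  define dd where "dd i = (if i = ?n then c else 0)" for i
  define g where "g i t = (if i \<le> ?n - r - 1 then a i * t else - (1 / ?C i) * ln (cos (?C i * s * t + b i))) + dd i" for i t
  have C: "?C k \<noteq> 0" if "k \<in> ?K" for k
    using a[of k] enneper_coeff_last(2)[OF r a es] that by (cases "k = ?n") (auto simp: enneper_coeff_def)
  have opn: "open (I i)" if "i \<in> {1..?n}" for i using I[OF that] by (rule open_intervalD)
  have Kn: "?K \<subseteq> {1..?n}" using r by auto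
  have arg: "\<bar>?C k * s * t + b k\<bar> < pi / 2" if k: "k \<in> ?K" and t: "t \<in> I k" for k t
  proof -
    obtain x where "x \<in> enneper_domain e r a b" "x $ e k = t"
      using coord_box_subset_component[OF e open_intervalD(3)[OF I] sub _ t] k Kn by blast
    then show ?thesis using k by (auto simp: enneper_domain_def arg_eq)
  qed
  have g_lin: "g i = (\<lambda>t. a i * t + dd i)" if "i \<le> ?n - r - 1" for i using that by (simp add: g_def[abs_def])
  have g_K: "g i = (\<lambda>t. - (1 / ?C i) * ln (cos (?C i * s * t + b i)) + dd i)" if "i \<in> ?K" for i
  proof -
    have "\<not> i \<le> ?n - r - 1" using that r by auto
    then show ?thesis by (simp only: g_def[abs_def] if_False)
  qed
  have split: "i \<le> ?n - r - 1 \<or> i \<in> ?K" if "i \<in> {1..?n}" for i using that by auto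
  have smooth: "smooth_on (I i) (g i)" if i: "i \<in> {1..?n}" for i
    using split[OF i]
  proof
    assume "i \<le> ?n - r - 1"
    then show ?thesis using smooth_on_linear_real[OF opn[OF i]] by (simp add: g_lin)
  next
    assume iK: "i \<in> ?K"
    show ?thesis unfolding g_K[OF iK] by (rule enneper_profile_smooth[OF opn[OF i] arg[OF iK]])
  qed
  have "enneper_fun e r a b c x = (\<Sum>i=1..?n. g i (x $ e i))" if "x \<in> coord_box e I" for x
  proof -
    have "(\<Sum>i=1..?n. dd i) = c" by (simp add: dd_def)
    moreover have "x \<in> enneper_domain e r a b" using sub that by blast
    ultimately show ?thesis
      unfolding g_def sum.distrib arg_eq[symmetric] using enneper_fun_eq_sum[OF r a es] by simp
  qed
  then have graph: "graph_over (coord_box e I) (enneper_fun e r a b c) = translation_graph_of e g I"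
    unfolding translation_graph_of_def graph_over_def by (intro image_cong) auto
  have "curvature_numerator_at ?n r g x = 0" if x: "\<forall>i\<in>{1..?n}. x i \<in> I i" for x
  proof -
    have lin: "higher_deriv 1 (g i) (x i) = a i" "higher_deriv 2 (g i) (x i) = 0" if i: "i \<in> {1..?n} - ?K" for i
    proof -
      have i': "i \<in> {1..?n}" "i \<le> ?n - r - 1" using i by auto
      have d: "(g i has_real_derivative a i) (at t)" for t
        unfolding g_lin[OF i'(2)] by (auto intro!: derivative_eq_intros)
      show "higher_deriv 1 (g i) (x i) = a i" "higher_deriv 2 (g i) (x i) = 0"
        using higher_deriv_eqI[OF opn[OF i'(1)] d DERIV_const] x i' by auto
    qed
    have ric: "higher_deriv 2 (g i) (x i) = ?C i * (enneper_beta ?n r a + (higher_deriv 1 (g i) (x i))\<^sup>2)" if i: "i \<in> ?K" for i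
    proof -
      have xi: "x i \<in> I i" and in_n: "i \<in> {1..?n}" using x i Kn by auto
      note d = enneper_profile_derivatives[OF C[OF i] arg[OF i]]
      show ?thesis
        unfolding g_K[OF i] using higher_deriv_eqI[OF opn[OF in_n] d xi, of "dd i"] s2 by simp
    qed
    have "{1..?n} - ?K = {1..?n - r - 1}" using r by auto
    then have beta: "1 + (\<Sum>m\<in>{1..?n} - ?K. (higher_deriv 1 (g m) (x m))\<^sup>2) = enneper_beta ?n r a"
      unfolding enneper_beta_def using lin(1) by simp
    have "curvature_numerator_at ?n r g x = curv_num r (\<lambda>i. higher_deriv 2 (g i) (x i)) (\<lambda>i. (higher_deriv 1 (g i) (x i))\<^sup>2) ?K
        (1 + (\<Sum>m\<in>{1..?n} - ?K. (higher_deriv 1 (g m) (x m))\<^sup>2))"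
      unfolding curvature_numerator_at_def using lin(2) Kn by (intro curv_num_drop_zeros) auto
    also have "\<dots> = (\<Prod>i\<in>?K. ?C i * (enneper_beta ?n r a + (higher_deriv 1 (g i) (x i))\<^sup>2)) * (\<Sum>m\<in>?K. 1 / ?C m)"
      unfolding beta using C ric r by (intro curv_num_riccati) auto
    also have "(\<Sum>m\<in>?K. 1 / ?C m) = 0"
    proof -
      have "(\<Sum>k=?n-r..?n-1. 1 / ?C k) = (\<Sum>k=?n-r..?n-1. 1 / a k)"
        using r by (intro sum.cong) (auto simp: enneper_coeff_def)
      then show ?thesis using enneper_coeff_last(1)[OF r a es] sum_split_last[OF r(2), of "\<lambda>k. 1 / ?C k"] by simp
    qed
    finally show ?thesis by simp
  qed
  then show ?thesis using smooth graph by blast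
qed

section \<open>Classification\<close>

lemma graph_over_cong: "(\<And>x. x \<in> D \<Longrightarrow> F x = G x) \<Longrightarrow> graph_over D F = graph_over D G"
  unfolding graph_over_def by (intro image_cong) auto

lemma affine_from_constant_derivative:
  fixes f :: "real \<Rightarrow> real"
  assumes "open_interval J" "\<And>t. t \<in> J \<Longrightarrow> (f has_real_derivative a) (at t)"
  shows "\<exists>d. \<forall>t\<in>J. f t = a * t + d"
proof -
  have "\<exists>d. \<forall>t\<in>J. f t - a * t = d"
    using assms(2) by (intro DERIV_zero_on_open_interval[OF assms(1)]) (auto intro!: derivative_eq_intros)
  then show ?thesis by (metis add.commute diff_add_cancel)
qed

text \<open>
  The two alternatives of \<open>curv_num_zero_classification\<close> lead to the two families, after a permutation of the coordinates.
  If fewer than \<open>r\<close> profiles are not affine, the set of their indices is enlarged to \<open>r - 1\<close> elements, and the graph is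
  affine in the remaining variables.
\<close>

lemma zero_curvature_classification:
  fixes e :: "nat \<Rightarrow> 'n::finite"
  assumes e: "bij_betw e {1..CARD('n)} UNIV" and r: "2 < r" "r < CARD('n)"
    and f: "\<And>i. i \<in> {1..CARD('n)} \<Longrightarrow> open_interval (J i) \<and> smooth_on (J i) (f i)"
    and zero: "\<forall>x. (\<forall>i\<in>{1..CARD('n)}. x i \<in> J i) \<longrightarrow> curvature_numerator_at CARD('n) r f x = 0"
  shows "(\<exists>a g b I.
       (\<forall>j\<in>{CARD('n)-r+2..CARD('n)}. open_interval (I j) \<and> smooth_on (I j) (g j)) \<and>
       congruent_to_graph e (translation_graph_of e f J) (cylinder_domain e r I) (cylinder_fun e r a g b)) \<or>
    (\<exists>a b c.
       (\<forall>k\<in>{CARD('n)-r..CARD('n)-1}. a k \<noteq> 0) \<and> esym (r-1) a {CARD('n)-r..CARD('n)-1} \<noteq> 0 \<and>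
       congruent_to_graph e (translation_graph_of e f J) (enneper_domain e r a b) (enneper_fun e r a b c))"
    (is "?cylinder \<or> ?enneper")
proof -
  let ?n = "CARD('n)"
  let ?A = "{1..?n}"
  let ?d1 = "\<lambda>i. higher_deriv 1 (f i)" and ?d2 = "\<lambda>i. higher_deriv 2 (f i)"
  have d1: "(f i has_real_derivative ?d1 i t) (at t)" and d2: "(?d1 i has_real_derivative ?d2 i t) (at t)"
    if "i \<in> ?A" "t \<in> J i" for i t
    using smooth_on_has_vector_derivative[of "J i" "f i" t 0] smooth_on_has_vector_derivative[of "J i" "f i" t 1] f[OF that(1)] that
    by (simp_all add: has_real_derivative_iff_has_vector_derivative numeral_2_eq_2)
  define K where "K = {i \<in> ?A. \<exists>t\<in>J i. ?d2 i t \<noteq> 0}"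
  have KA: "K \<subseteq> ?A" by (auto simp: K_def)
  obtain a where a: "\<forall>i\<in>?A - K. \<forall>t\<in>J i. ?d1 i t = a i"
    and cases: "card K < r \<or> card K = Suc r \<and>
      (\<exists>c. (\<forall>i\<in>K. c i \<noteq> 0 \<and> (\<forall>t\<in>J i. ?d2 i t = c i * (1 + (\<Sum>m\<in>?A - K. (a m)\<^sup>2) + (?d1 i t)\<^sup>2))) \<and>
        (\<Sum>i\<in>K. 1 / c i) = 0)"
    using curv_num_zero_classification[of ?A J ?d1 ?d2 r] f d2 zero
    unfolding K_def[symmetric] curvature_numerator_at_def by auto
  have "\<exists>d. \<forall>t\<in>J i. f i t = a i * t + d" if i: "i \<in> ?A - K" for i
    using f i d1 a by (intro affine_from_constant_derivative) (auto, metis DiffI atLeastAtMost_iff)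
  then obtain d where d: "\<forall>i\<in>?A - K. \<forall>t\<in>J i. f i t = a i * t + d i" by metis
  have in_box: "x $ e i \<in> J' i" if "x \<in> coord_box e J'" "i \<in> ?A" for x J' i
    using that by (simp add: coord_box_def)
  from cases show ?thesis
  proof
    assume "card K < r"
    then have "\<exists>K'. K \<subseteq> K' \<and> K' \<subseteq> ?A \<and> card K' = r - 1"
      using KA r by (intro exists_subset_between) auto
    then obtain K' where K': "K \<subseteq> K'" "K' \<subseteq> ?A" "card K' = r - 1" by blast
    obtain \<pi> where \<pi>: "bij_betw \<pi> ?A ?A" "\<pi> ` {1..?n - (r - 1)} = ?A - K'" "\<pi> ` {?n - (r - 1) + 1..?n} = K'"
      using exists_permutation_onto_tail[OF K'(2,3)] by blast
    have \<pi>A: "\<pi> i \<in> ?A" if "i \<in> ?A" for i using \<pi>(1) that by (auto simp: bij_betw_def)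
    have \<pi>K: "\<pi> i \<in> ?A - K" if "1 \<le> i" "i \<le> ?n - r + 1" for i
    proof -
      have "\<pi> i \<in> \<pi> ` {1..?n - (r - 1)}" using that r by auto
      then show ?thesis using \<pi>(2) K'(1) by auto
    qed
    let ?b = "\<Sum>i=1..?n. if i \<le> ?n - r + 1 then d (\<pi> i) else 0"
    let ?a = "\<lambda>i. a (\<pi> i)" and ?g = "\<lambda>i. f (\<pi> i)" and ?I = "\<lambda>i. J (\<pi> i)"
    have "cylinder_fun e r ?a ?g ?b x = (\<Sum>i=1..?n. f (\<pi> i) (x $ e i))" if x: "x \<in> coord_box e ?I" for x
    proof -
      have "2 \<le> r" "r \<le> ?n" using r by auto
      from cylinder_fun_eq_sum[OF this, of e ?a ?g ?b x] show ?thesis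
        unfolding sum.distrib[symmetric] using d \<pi>K in_box[OF x]
        by (auto intro!: sum.cong)
    qed
    then have "graph_over (coord_box e ?I) (cylinder_fun e r ?a ?g ?b) = translation_graph_of e ?g ?I"
      unfolding translation_graph_of_def by (rule graph_over_cong)
    then have "congruent_to_graph e (translation_graph_of e f J) (cylinder_domain e r ?I) (cylinder_fun e r ?a ?g ?b)"
      unfolding congruent_to_graph_def
      using congruent_permuted_translation_graph[OF e \<pi>(1), of f J] f \<pi>A r
      by (intro exI[of _ ?I]) (auto simp: coord_box_def cylinder_domain_def)
    moreover have "\<forall>j\<in>{?n-r+2..?n}. open_interval (?I j) \<and> smooth_on (?I j) (?g j)"
      using f \<pi>A by auto
    ultimately show ?thesis
      by (intro disjI1 exI[of _ ?a] exI[of _ ?g] exI[of _ ?b] exI[of _ ?I] conjI)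
  next
    assume "card K = Suc r \<and> (\<exists>c. (\<forall>i\<in>K. c i \<noteq> 0 \<and> (\<forall>t\<in>J i. ?d2 i t = c i * (1 + (\<Sum>m\<in>?A - K. (a m)\<^sup>2) + (?d1 i t)\<^sup>2))) \<and>
        (\<Sum>i\<in>K. 1 / c i) = 0)"
    then obtain c where card: "card K = Suc r"
      and c: "\<And>i. i \<in> K \<Longrightarrow> c i \<noteq> 0"
        "\<And>i t. i \<in> K \<Longrightarrow> t \<in> J i \<Longrightarrow> ?d2 i t = c i * (1 + (\<Sum>m\<in>?A - K. (a m)\<^sup>2) + (?d1 i t)\<^sup>2)"
        "(\<Sum>i\<in>K. 1 / c i) = 0" by blast
    define \<beta> where "\<beta> = 1 + (\<Sum>m\<in>?A - K. (a m)\<^sup>2)"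
    have \<beta>: "\<beta> > 0" unfolding \<beta>_def by (intro add_pos_nonneg sum_nonneg) auto
    have "\<exists>b d. \<forall>t\<in>J i. \<bar>c i * sqrt \<beta> * t + b\<bar> < pi / 2 \<and> f i t = - (1 / c i) * ln (cos (c i * sqrt \<beta> * t + b)) + d"
      if i: "i \<in> K" for i
    proof -
      have iA: "i \<in> ?A" using i KA by blast
      have "open_interval (J i)" using f[OF iA] by simp
      from arctan_ode_solution[OF this c(1)[OF i] \<beta> d1[OF iA] d2[OF iA] c(2)[OF i, folded \<beta>_def]]
      show ?thesis .
    qed
    then obtain b0 d0 where bd: "\<And>i t. i \<in> K \<Longrightarrow> t \<in> J i \<Longrightarrow> \<bar>c i * sqrt \<beta> * t + b0 i\<bar> < pi / 2 \<and>
        f i t = - (1 / c i) * ln (cos (c i * sqrt \<beta> * t + b0 i)) + d0 i"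
      by metis
    obtain \<pi> where \<pi>: "bij_betw \<pi> ?A ?A" "\<pi> ` {1..?n - Suc r} = ?A - K" "\<pi> ` {?n - Suc r + 1..?n} = K"
      using exists_permutation_onto_tail[OF KA card] by blast
    have \<pi>A: "\<pi> i \<in> ?A" if "i \<in> ?A" for i using \<pi>(1) that by (auto simp: bij_betw_def)
    have tail: "{?n - Suc r + 1..?n} = {?n - r..?n}" using r by auto
    have \<pi>K: "\<pi> i \<in> K" if "i \<in> {?n - r..?n}" for i using \<pi>(3) that unfolding tail by auto
    have \<pi>L: "\<pi> i \<in> ?A - K" if "1 \<le> i" "i \<le> ?n - r - 1" for i
      using \<pi>(2) that by auto
    have injA: "inj_on \<pi> ?A" using \<pi>(1) by (simp add: bij_betw_def)
    have inj: "inj_on \<pi> {?n - r..?n}" "inj_on \<pi> {1..?n - Suc r}"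
      by (rule inj_on_subset[OF injA]; use r in auto)+
    \<comment> \<open>Slopes for the affine variables and Riccati constants for the others share one parameter sequence.\<close>
    define a' where "a' i = (if i \<le> ?n - r - 1 then a (\<pi> i) else c (\<pi> i))" for i
    have beta: "enneper_beta ?n r a' = \<beta>"
      unfolding enneper_beta_def \<beta>_def \<pi>(2)[symmetric] sum.reindex[OF inj(2)] by (simp add: a'_def)
    have a'K: "a' i = c (\<pi> i)" if "i \<in> {?n - r..?n}" for i using that r by (auto simp: a'_def)
    have a'0: "a' i \<noteq> 0" if "i \<in> {?n - r..?n - 1}" for i
    proof -
      have i: "i \<in> {?n - r..?n}" using that by auto
      show ?thesis unfolding a'K[OF i] by (rule c(1)[OF \<pi>K[OF i]])
    qed
    have "(\<Sum>k=?n - r..?n. 1 / c (\<pi> k)) = 0"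
      using c(3) unfolding \<pi>(3)[symmetric] tail sum.reindex[OF inj(1)] by (simp add: o_def)
    then have inv_sum: "(\<Sum>k=?n - r..?n - 1. 1 / a' k) = - (1 / c (\<pi> ?n))"
    proof -
      have "(\<Sum>k=?n - r..?n - 1. 1 / a' k) = (\<Sum>k=?n - r..?n - 1. 1 / c (\<pi> k))"
        using a'K by (intro sum.cong) auto
      then show ?thesis
        using sum_split_last[OF r(2), of "\<lambda>k. 1 / c (\<pi> k)"] \<open>(\<Sum>k=?n - r..?n. 1 / c (\<pi> k)) = 0\<close> by simp
    qed
    have cn: "c (\<pi> ?n) \<noteq> 0" using c(1) \<pi>K[of ?n] by simp
    have r1: "1 \<le> r" using r by simp
    have es: "esym (r - 1) a' {?n - r..?n - 1} \<noteq> 0"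
    proof -
      have "esym (r - 1) a' {?n - r..?n - 1} = (\<Prod>i=?n - r..?n - 1. a' i) * - (1 / c (\<pi> ?n))"
        unfolding inv_sum[symmetric] by (rule esym_pred_inverse_sum[OF r1 r(2) a'0])
      moreover have "(\<Prod>i=?n - r..?n - 1. a' i) \<noteq> 0" using a'0 by simp
      ultimately show ?thesis using cn by (simp del: mult_minus_right)
    qed
    have coeff: "enneper_coeff ?n r a' k = c (\<pi> k)" if k: "k \<in> {?n - r..?n}" for k
    proof (cases "k = ?n")
      case True
      have "1 / enneper_coeff ?n r a' ?n = 1 / c (\<pi> ?n)"
        using enneper_coeff_last(1)[OF r1 r(2) a'0 es] inv_sum by simp
      then show ?thesis using True by simp
    qed (use a'K[OF k] in \<open>simp add: enneper_coeff_def\<close>)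
    let ?b = "\<lambda>i. b0 (\<pi> i)" and ?I = "\<lambda>i. J (\<pi> i)"
    let ?c = "\<Sum>i=1..?n. if i \<le> ?n - r - 1 then d (\<pi> i) else d0 (\<pi> i)"
    have arg: "enneper_arg ?n r a' ?b k t = c (\<pi> k) * sqrt \<beta> * t + b0 (\<pi> k)" if "k \<in> {?n - r..?n}" for k t
      unfolding enneper_arg_eq coeff[OF that] beta ..
    have box: "coord_box e ?I \<subseteq> enneper_domain e r a' ?b"
    proof
      fix x assume x: "x \<in> coord_box e ?I"
      have "\<bar>enneper_arg ?n r a' ?b k (x $ e k)\<bar> < pi / 2" if k: "k \<in> {?n - r..?n}" for k
        unfolding arg[OF k] using bd[OF \<pi>K[OF k]] in_box[OF x, of k] k r by auto
      then show "x \<in> enneper_domain e r a' ?b" by (simp add: enneper_domain_def)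
    qed
    have "enneper_fun e r a' ?b ?c x = (\<Sum>i=1..?n. f (\<pi> i) (x $ e i))" if x: "x \<in> coord_box e ?I" for x
    proof -
      have "enneper_fun e r a' ?b ?c x = (\<Sum>i=1..?n. (if i \<le> ?n - r - 1 then a' i * x $ e i
          else - (1 / enneper_coeff ?n r a' i) * ln (cos (enneper_arg ?n r a' ?b i (x $ e i)))) +
          (if i \<le> ?n - r - 1 then d (\<pi> i) else d0 (\<pi> i)))"
        using enneper_fun_eq_sum[OF r1 r(2) a'0 es, of x e ?b ?c] box x by (simp add: sum.distrib subset_iff)
      also have "\<dots> = (\<Sum>i=1..?n. f (\<pi> i) (x $ e i))"
      proof (rule sum.cong[OF refl])
        fix i assume i: "i \<in> ?A"
        show "(if i \<le> ?n - r - 1 then a' i * x $ e i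
          else - (1 / enneper_coeff ?n r a' i) * ln (cos (enneper_arg ?n r a' ?b i (x $ e i)))) +
          (if i \<le> ?n - r - 1 then d (\<pi> i) else d0 (\<pi> i)) = f (\<pi> i) (x $ e i)"
        proof (cases "i \<le> ?n - r - 1")
          case True
          then show ?thesis using d \<pi>L[of i] in_box[OF x i] i by (auto simp: a'_def)
        next
          case False
          then have iK: "i \<in> {?n - r..?n}" using i by auto
          show ?thesis
            using False bd[OF \<pi>K[OF iK] in_box[OF x i]] unfolding coeff[OF iK] arg[OF iK] by simp
        qed
      qed
      finally show ?thesis .
    qed
    then have "graph_over (coord_box e ?I) (enneper_fun e r a' ?b ?c) = translation_graph_of e (\<lambda>i. f (\<pi> i)) ?I"
      unfolding translation_graph_of_def by (rule graph_over_cong)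
    then have "congruent_to_graph e (translation_graph_of e f J) (enneper_domain e r a' ?b) (enneper_fun e r a' ?b ?c)"
      unfolding congruent_to_graph_def
      using congruent_permuted_translation_graph[OF e \<pi>(1), of f J] f \<pi>A box
      by (intro exI[of _ ?I]) auto
    then show ?thesis using a'0 es
      by (intro disjI2 exI[of _ a'] exI[of _ ?b] exI[of _ ?c] conjI) auto
  qed
qed

theorem theorem1:
  fixes e :: "nat \<Rightarrow> 'n::finite"
    and M :: "((real ^ 'n) \<times> real) set"
    and N :: "(real ^ 'n) \<times> real \<Rightarrow> (real ^ 'n) \<times> real"
    and n r :: nat
  assumes "n = CARD('n)" and "n \<ge> 3" and "2 < r" and "r < n"
    and "bij_betw e {1..n} UNIV"
    and "translation_hypersurface e M"
    and "orientation M N"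
  shows "(\<forall>p\<in>M. S_curvature r M N p = 0) \<longleftrightarrow>
    (\<exists>a f b J.
       (\<forall>j\<in>{n-r+2..n}. open_interval (J j) \<and> smooth_on (J j) (f j)) \<and>
       congruent_to_graph e M (cylinder_domain e r J) (cylinder_fun e r a f b)) \<or>
    (\<exists>a b c.
       (\<forall>k\<in>{n-r..n-1}. a k \<noteq> 0) \<and> esym (r-1) a {n-r..n-1} \<noteq> 0 \<and>
       congruent_to_graph e M (enneper_domain e r a b) (enneper_fun e r a b c))"
    (is "?zero \<longleftrightarrow> ?cylinder \<or> ?enneper")
proof -
  note n = assms(1)
  note e = assms(5)[unfolded n]
  have r: "2 \<le> r" "1 \<le> r" "r \<le> CARD('n)" "r < CARD('n)" using assms(3,4) n by auto
  obtain f J where f: "\<And>i. i \<in> {1..CARD('n)} \<Longrightarrow> open_interval (J i) \<and> smooth_on (J i) (f i)"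
    and M: "M = translation_graph_of e f J"
    using assms(6) unfolding translation_hypersurface_def translation_graph_of_def by blast
  note N = assms(7)[unfolded M]
  have backward: ?zero
    if I: "\<forall>i\<in>{1..CARD('n)}. open_interval (I i)" and congr: "congruent_sets M (graph_over (coord_box e I) F)"
      and g: "\<exists>g. (\<forall>i\<in>{1..CARD('n)}. smooth_on (I i) (g i)) \<and> graph_over (coord_box e I) F = translation_graph_of e g I \<and>
        (\<forall>x. (\<forall>i\<in>{1..CARD('n)}. x i \<in> I i) \<longrightarrow> curvature_numerator_at CARD('n) r g x = 0)" for I F
  proof -
    obtain g where g: "\<forall>i\<in>{1..CARD('n)}. smooth_on (I i) (g i)" "graph_over (coord_box e I) F = translation_graph_of e g I"
      "\<forall>x. (\<forall>i\<in>{1..CARD('n)}. x i \<in> I i) \<longrightarrow> curvature_numerator_at CARD('n) r g x = 0"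
      using g by blast
    have gI: "open_interval (I i) \<and> smooth_on (I i) (g i)" if "i \<in> {1..CARD('n)}" for i
      using I g(1) that by blast
    show ?zero
      using congruent_translation_graph_curvature_zero_iff[OF e f gI N congr[unfolded M g(2)], of r] g(3)
      unfolding M by simp
  qed
  show ?thesis
  proof
    assume ?zero
    then have "\<forall>x. (\<forall>i\<in>{1..CARD('n)}. x i \<in> J i) \<longrightarrow> curvature_numerator_at CARD('n) r f x = 0"
      using translation_graph_curvature_zero_iff[OF e f N, of r] unfolding M by simp
    from zero_curvature_classification[OF e assms(3) r(4) f this]
    show "?cylinder \<or> ?enneper" unfolding M n .
  next
    assume "?cylinder \<or> ?enneper"
    then show ?zero
    proof
      assume ?cylinder
      then obtain a h b H I where h: "\<And>j. j \<in> {CARD('n)-r+2..CARD('n)} \<Longrightarrow> smooth_on (H j) (h j)"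
        and I: "\<forall>i\<in>{1..CARD('n)}. open_interval (I i)" "coord_box e I \<subseteq> cylinder_domain e r H"
          "congruent_sets M (graph_over (coord_box e I) (cylinder_fun e r a h b))"
        unfolding n congruent_to_graph_def by blast
      show ?zero
        by (rule backward[OF I(1,3) cylinder_curvature_zero[OF e r(1,3) h _ I(2)]]) (use I(1) in auto)
    next
      assume ?enneper
      then obtain a b c I where a: "\<And>k. k \<in> {CARD('n)-r..CARD('n)-1} \<Longrightarrow> a k \<noteq> 0"
        "esym (r-1) a {CARD('n)-r..CARD('n)-1} \<noteq> 0"
        and I: "\<forall>i\<in>{1..CARD('n)}. open_interval (I i)" "coord_box e I \<subseteq> enneper_domain e r a b"
          "congruent_sets M (graph_over (coord_box e I) (enneper_fun e r a b c))"
        unfolding n congruent_to_graph_def by blast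
      show ?zero
        by (rule backward[OF I(1,3) enneper_curvature_zero[OF e r(2,4) a _ I(2)]]) (use I(1) in auto)
    qed
  qed
qed

end
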